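(* For integers $n\ge 2$ and $d\ge 2$, let $M_{n,d}$ denote the maximum number of nodal domains among all time-dependent homogeneous caloric polynomials of degree $d$ in $\mathbb{R}^{n+1}=\mathbb{R}^n\times\mathbb{R}$. For every $n\ge 2$, $M_{n,d}=\Theta(d^n)$ as $d\to\infty$, i.e. there is a constant $C>0$ such that $C^{-1}d^n\le M_{n,d}\le C d^n$ for all sufficiently large $d$. More precisely, for all $n\ge 2$ and $d\ge 2$, $$\left\lfloor \frac{d}{n}\right\rfloor^n\le M_{n,d}\le \binom{n+d}{n}.$$
   Context: Write points of $\mathbb{R}^{n+1}=\mathbb{R}^n\times\mathbb{R}$ as $(x,t)$ with $x\in\mathbb{R}^n$ (space), $t\in\mathbb{R}$ (time), and let $\Delta=\sum_{i=1}^n\partial_{x_i}^2$ (space variables only). A homogeneous caloric polynomial (hcp) of degree $d\in\{0,1,2,\dots\}$ in $\mathbb{R}^{n+1}$ is a real, not identically zero polynomial $p(x,t)$ satisfying the heat equation $(\partial_t-\Delta)p=0$ and the parabolic homogeneity $p(\lambda x,\lambda^2 t)=\lambda^d p(x,t)$ for all $\lambda>0$ and all $(x,t)$. An hcp $p$ is time-dependent if $\partial_t p\not\equiv 0$. The nodal domains of a continuous function $u$ on $\mathbb{R}^{n+1}$ are the connected components of $\{(x,t):u(x,t)\neq 0\}$. *)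

theory Defs
  imports "HOL-Analysis.Analysis" "HOL-Library.Extended_Nat"
begin

text \<open>
  Space-time \<open>R^n \<times> R\<close> is the type \<open>(real ^ 'n) \<times> real\<close> with \<open>n = CARD('n)\<close>.
  A polynomial in \<open>(x, t)\<close> is a function satisfying \<open>real_polynomial_function\<close>;
  over the reals a polynomial and its function determine each other.
\<close>

definition time_deriv :: "((real ^ 'n) \<times> real \<Rightarrow> real) \<Rightarrow> (real ^ 'n) \<times> real \<Rightarrow> real" where
  "time_deriv u = (\<lambda>(x, t). deriv (\<lambda>s. u (x, s)) t)"

definition space_deriv ::
    "'n::finite \<Rightarrow> ((real ^ 'n) \<times> real \<Rightarrow> real) \<Rightarrow> (real ^ 'n) \<times> real \<Rightarrow> real" where
  "space_deriv i u = (\<lambda>(x, t). deriv (\<lambda>s. u (x + s *\<^sub>R axis i 1, t)) 0)"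

definition space_laplacian ::
    "((real ^ 'n::finite) \<times> real \<Rightarrow> real) \<Rightarrow> (real ^ 'n) \<times> real \<Rightarrow> real" where
  "space_laplacian u = (\<lambda>z. \<Sum>i\<in>UNIV. space_deriv i (space_deriv i u) z)"

definition hcp :: "nat \<Rightarrow> ((real ^ 'n::finite) \<times> real \<Rightarrow> real) \<Rightarrow> bool" where
  "hcp d p \<longleftrightarrow>
     real_polynomial_function p \<and>
     (\<exists>z. p z \<noteq> 0) \<and>
     (\<forall>z. time_deriv p z - space_laplacian p z = 0) \<and>
     (\<forall>c>0. \<forall>x t. p (c *\<^sub>R x, c ^ 2 * t) = c ^ d * p (x, t))"

definition time_dependent :: "((real ^ 'n) \<times> real \<Rightarrow> real) \<Rightarrow> bool" where
  "time_dependent p \<longleftrightarrow> (\<exists>z. time_deriv p z \<noteq> 0)"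

definition nodal_domains :: "((real ^ 'n) \<times> real \<Rightarrow> real) \<Rightarrow> ((real ^ 'n) \<times> real) set set" where
  "nodal_domains u = components {z. u z \<noteq> 0}"

text \<open>Counting in \<open>enat\<close>, since \<open>card\<close> is \<open>0\<close> on infinite sets.\<close>

definition num_nodal_domains :: "((real ^ 'n) \<times> real \<Rightarrow> real) \<Rightarrow> enat" where
  "num_nodal_domains u =
     (if finite (nodal_domains u) then enat (card (nodal_domains u)) else \<infinity>)"

text \<open>
  The number \<open>M\<^sub>n\<^sub>,\<^sub>d\<close>. A supremum in \<open>enat\<close> always exists; that it is a maximum,
  i.e. attained, is a separate claim.
\<close>

definition max_nodal_domains :: "'n::finite itself \<Rightarrow> nat \<Rightarrow> enat" where
  "max_nodal_domains _ d =
     (SUP p \<in> {p :: (real ^ 'n) \<times> real \<Rightarrow> real. hcp d p \<and> time_dependent p}. num_nodal_domains p)"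

end

theory Submission
  imports Defs "HOL-Probability.Probability"
begin

text \<open>
  Lower bound: a product of one-dimensional heat polynomials with exponents at least \<open>k\<close> (in every
  coordinate) has, at time \<open>-1/2\<close>, the zeros of Hermite polynomials as nodal hyperplanes. The cells of
  this grid, extended parabolically to \<open>t < 0\<close>, are closed off from \<open>t \<ge> 0\<close> by zeros of the product,
  except for the cell that is unbounded in every direction; so \<open>k ^ n\<close> of them lie in different nodal
  domains.

  Upper bound: by the maximum principle and parabolic scaling every nodal domain meets the slice
  \<open>t = -1/2\<close>. There \<open>q x = p (x, -1/2)\<close> is an eigenfunction, with eigenvalue \<open>r ^ d\<close>, of the
  Ornstein-Uhlenbeck (Mehler) operators, which are symmetric contractions for the Gaussian measure and
  form a multiplicative semigroup in \<open>r\<close>. With more nodal domains than monomials of degree at most \<open>d\<close>,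
  some nonzero combination \<open>f = b q\<close>, where \<open>b\<close> is constant on each nodal domain, is orthogonal to all
  these monomials; then the quadratic form of \<open>f\<close> is at most \<open>r ^ (d + 1)\<close> times its squared norm.
  On the other hand it equals \<open>r ^ d\<close> times the squared norm up to a jump term of order \<open>o(1 - r)\<close>,
  as in Courant's nodal domain theorem. Letting \<open>r\<close> tend to \<open>1\<close> gives \<open>f = 0\<close>, a contradiction.
\<close>

subsection \<open>Heat polynomials\<close>

text \<open>The time \<open>-1/2\<close> turns homogeneity into an eigenvalue: averaging
  \<open>q\<close> around \<open>r *\<^sub>R x\<close> with variance \<open>1 - r\<^sup>2\<close>
  runs the heat flow for time \<open>(1 - r\<^sup>2) / 2\<close>, up to
  \<open>- r\<^sup>2 / 2\<close>, where homogeneity gives the value \<open>r ^ d * q x\<close>. The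
  obstacle is that nodal sets may be singular and \<open>b q\<close> has kinks across them. The
  Mehler form with \<open>r < 1\<close> only asks for measurability and growth; the price is that it
  is nonlocal, and the interaction between different domains is the jump term. The margin to beat is
  explicit: \<open>r ^ d - r ^ (d + 1)\<close> is \<open>r ^ d * (1 - r)\<close>, hence the order
  \<open>o(1 - r)\<close>. Orthogonality to all monomials of degree at most \<open>d\<close>,
  including those belonging to the eigenvalue \<open>r ^ d\<close>, creates this margin and fixes
  the binomial coefficient in the bound. The decay \<open>r ^ (d + 1)\<close> is first proved with
  an uncontrolled constant and only for small \<open>r\<close>, where the kernel can be expanded in
  powers of \<open>r\<close>; repeated squaring links every \<open>r < 1\<close> to that range and
  removes the constant.\<close>

text \<open>At \<open>t = -1/2\<close> these are the (probabilists') Hermite polynomials.\<close>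

fun heat_poly :: "nat \<Rightarrow> real \<Rightarrow> real \<Rightarrow> real" where
  "heat_poly 0 x t = 1"
| "heat_poly (Suc 0) x t = x"
| "heat_poly (Suc (Suc m)) x t = x * heat_poly (Suc m) x t + 2 * (real m + 1) * t * heat_poly m x t"

lemma heat_poly_rec:
  "heat_poly (Suc m) x t = x * heat_poly m x t + 2 * real m * t * heat_poly (m - 1) x t"
  by (cases m) auto

text \<open>The factor \<open>real m\<close> makes both sides vanish at \<open>m = 0\<close>, where
  the recursion itself would fail because \<open>m - 1\<close> truncates to
  \<open>0\<close>.\<close>

lemma heat_poly_rec_mult:
  "real m * heat_poly m x t
     = real m * (x * heat_poly (m - 1) x t + 2 * (real m - 1) * t * heat_poly (m - 2) x t)"
  using heat_poly_rec[of "m - 1" x t] by (cases m) (auto simp: numeral_2_eq_2)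

text \<open>The Appell property. Differentiating the recursion gives
  \<open>heat_poly (Suc m)\<close> plus terms that form \<open>m + 1\<close> times
  \<open>heat_poly (Suc m)\<close> by the recursion one degree lower.\<close>

lemma has_field_derivative_heat_poly_space [derivative_intros]:
  assumes "(f has_field_derivative f') (at x within S)"
  shows "((\<lambda>x. heat_poly m (f x) t) has_field_derivative real m * heat_poly (m - 1) (f x) t * f')
           (at x within S)"
proof -
  have "((\<lambda>x. heat_poly m x t) has_field_derivative real m * heat_poly (m - 1) x t) (at x)" for x
  proof (induction m x t rule: heat_poly.induct)
    case (3 m x t)
    show ?case unfolding heat_poly.simps
      by (rule derivative_eq_intros "3.IH" refl)+ (use heat_poly_rec[of m x t] in \<open>simp add: algebra_simps\<close>)
  qed (auto intro!: derivative_eq_intros)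
  from DERIV_chain2[OF this assms] show ?thesis .
qed

text \<open>By the Appell property the right-hand side is the second space derivative, so this is
  the one-dimensional heat equation.\<close>

lemma has_field_derivative_heat_poly_time:
  "((\<lambda>t. heat_poly m x t) has_field_derivative
     real m * (real m - 1) * heat_poly (m - 2) x t) (at t)"
proof (induction m x t rule: heat_poly.induct)
  case (3 m x t)
  show ?case unfolding heat_poly.simps
    apply (rule derivative_eq_intros "3.IH" refl)+
    using arg_cong[OF heat_poly_rec_mult[of m x t], of "\<lambda>u. (real m + 1) * u"]
    by (simp add: numeral_2_eq_2 algebra_simps)
qed (auto intro!: derivative_eq_intros)

lemma heat_poly_homogeneous:
  "heat_poly m (c * x) (c\<^sup>2 * t) = c ^ m * heat_poly m x t"
  by (induction m x t rule: heat_poly.induct) (auto simp: algebra_simps power2_eq_square)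

lemma heat_poly_time_0 [simp]: "heat_poly m x 0 = x ^ m"
  by (induction m x "0::real" rule: heat_poly.induct) auto

lemma heat_poly_minus: "heat_poly m (- x) t = (-1) ^ m * heat_poly m x t"
  by (induction m x t rule: heat_poly.induct) (auto simp: algebra_simps)

text \<open>Compared with the value \<open>1\<close> at \<open>(1, 0)\<close>, values above
  \<open>1\<close> at \<open>(1, 1)\<close> will reveal time dependence.\<close>

lemma heat_poly_ge_1: "heat_poly m 1 1 \<ge> 1"
proof (induction m "1::real" "1::real" rule: heat_poly.induct)
  case (3 m)
  have "heat_poly (Suc m) 1 1 \<le> heat_poly (Suc (Suc m)) 1 1" using 3 by simp
  then show ?case using 3 by linarith
qed auto

lemma heat_poly_gt_1:
  assumes "m \<ge> 2" shows "heat_poly m 1 1 > 1"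
proof -
  obtain k where k: "m = Suc (Suc k)" using assms by (metis Suc_le_D numeral_2_eq_2 Suc_le_mono)
  have "0 < (2 * real k + 2) * heat_poly k 1 1" using heat_poly_ge_1[of k] by simp
  then show ?thesis using heat_poly_ge_1[of "Suc k"] k by simp
qed

lemma polynomial_function_heat_poly:
  assumes "real_polynomial_function f" "real_polynomial_function g"
  shows "real_polynomial_function (\<lambda>z. heat_poly m (f z) (g z))"
proof -
  have "real_polynomial_function (\<lambda>z. heat_poly m (f z) (g z)) \<and>
        real_polynomial_function (\<lambda>z. heat_poly (Suc m) (f z) (g z))"
    by (induction m) (auto intro!: assms real_polynomial_function.intros(2-4))
  then show ?thesis by simp
qed

section \<open>Real zeros of the Hermite polynomials\<close>

text \<open>Rolle's theorem on a half-line; it supplies the zero beyond the outermost one when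
  passing from one Hermite polynomial to the next.\<close>

lemma Rolle_at_top:
  fixes g :: "real \<Rightarrow> real"
  assumes d: "\<And>x. (g has_field_derivative g' x) (at x)" and "g a = 0" and lim: "(g \<longlongrightarrow> 0) at_top"
  shows "\<exists>c>a. g' c = 0"
proof -
  have ct: "continuous_on S g" for S
    using d by (meson DERIV_isCont continuous_at_imp_continuous_on)
  have rolle: "\<exists>c. u < c \<and> c < v \<and> g' c = 0" if uv: "u < v" "g u = g v" for u v
  proof -
    obtain c where "u < c" "c < v" "(g has_field_derivative 0) (at c)"
      using Rolle[OF uv ct] d real_differentiable_def by blast
    then show ?thesis using DERIV_unique d by blast
  qed
  show ?thesis
  proof (cases "g (a + 1) = 0")
    case True then show ?thesis using rolle[of a "a + 1"] assms by auto
  next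
    case False
    have "\<forall>\<^sub>F x in at_top. \<bar>g x\<bar> < \<bar>g (a + 1)\<bar> / 2"
      using tendstoD[OF lim, of "\<bar>g (a + 1)\<bar> / 2"] False by (simp add: dist_real_def)
    then have "\<forall>\<^sub>F x in at_top. \<bar>g x\<bar> < \<bar>g (a + 1)\<bar> / 2 \<and> a + 1 < x"
      using eventually_gt_at_top[of "a + 1"] by (rule eventually_conj)
    then obtain b where b: "\<bar>g b\<bar> < \<bar>g (a + 1)\<bar> / 2" "a + 1 < b"
      using eventually_happens'[of at_top] by force
    \<comment> \<open>Half of the nonzero value at \<open>a + 1\<close> is taken on each side of
      that point: before it since \<open>g a = 0\<close>, after it since \<open>g b\<close> is
      smaller still in absolute value. Rolle applies between the two points.\<close>
    have "\<exists>u. a < u \<and> u < a + 1 \<and> g u = g (a + 1) / 2 \<and> (\<exists>v. a + 1 < v \<and> v < b \<and> g v = g (a + 1) / 2)"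
    proof (cases "g (a + 1) > 0")
      case True
      have gb: "g b \<le> g (a + 1) / 2" using b True by linarith
      obtain u where u: "a \<le> u" "u \<le> a + 1" "g u = g (a + 1) / 2"
        using IVT'[of g a "g (a + 1) / 2" "a + 1"] True assms ct by auto
      obtain v where v: "a + 1 \<le> v" "v \<le> b" "g v = g (a + 1) / 2"
        using IVT2'[of g b "g (a + 1) / 2" "a + 1"] b ct gb True by auto
      have "u \<noteq> a" "u \<noteq> a + 1" "v \<noteq> a + 1" "v \<noteq> b" using u v b True assms by auto
      then show ?thesis using u v by force
    next
      case F: False
      have gb: "g (a + 1) / 2 \<le> g b" using b F by linarith
      obtain u where u: "a \<le> u" "u \<le> a + 1" "g u = g (a + 1) / 2"
        using IVT2'[of g "a + 1" "g (a + 1) / 2" a] F assms ct by auto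
      obtain v where v: "a + 1 \<le> v" "v \<le> b" "g v = g (a + 1) / 2"
        using IVT'[of g "a + 1" "g (a + 1) / 2" b] b ct gb F by auto
      have "u \<noteq> a" "u \<noteq> a + 1" "v \<noteq> a + 1" "v \<noteq> b" using u v b F False assms by auto
      then show ?thesis using u v by force
    qed
    then show ?thesis using rolle by (metis less_trans)
  qed
qed

lemma tendsto_power_mult_gaussian:
  "((\<lambda>x::real. x ^ m * exp (- x\<^sup>2 / 2)) \<longlongrightarrow> 0) at_top"
  by real_asymp

lemma tendsto_heat_poly_gaussian:
  "((\<lambda>x. heat_poly m x t * exp (- x\<^sup>2 / 2)) \<longlongrightarrow> 0) at_top"
proof -
  \<comment> \<open>The extra power \<open>x ^ k\<close> is there because the recursion multiplies
    by \<open>x\<close>; two consecutive degrees are carried because it refers to both.\<close>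
  have "((\<lambda>x. x ^ k * (heat_poly m x t * exp (- x\<^sup>2 / 2))) \<longlongrightarrow> 0) at_top \<and>
        ((\<lambda>x. x ^ k * (heat_poly (Suc m) x t * exp (- x\<^sup>2 / 2))) \<longlongrightarrow> 0) at_top" for k
  proof (induction m arbitrary: k)
    case 0
    show ?case using tendsto_power_mult_gaussian[of k] tendsto_power_mult_gaussian[of "Suc k"]
      by (simp add: mult_ac)
  next
    case (Suc m)
    have "((\<lambda>x. x ^ Suc k * (heat_poly (Suc m) x t * exp (- x\<^sup>2 / 2)) +
            2 * (real m + 1) * t * (x ^ k * (heat_poly m x t * exp (- x\<^sup>2 / 2)))) \<longlongrightarrow>
            0 + 2 * (real m + 1) * t * 0) at_top"
      by (intro tendsto_intros) (use Suc in blast)+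
    then show ?case using Suc by (simp add: algebra_simps)
  qed
  from conjunct1[OF this[of 0]] show ?thesis by simp
qed

text \<open>The points \<open>a 0, ..., a (m - 1)\<close> are read as cutting the line into
  \<open>m + 1\<close> gaps, two of them unbounded; one point per gap interlaces with them and is
  therefore increasing.\<close>

lemma strict_interval_choice:
  fixes a :: "nat \<Rightarrow> real"
  assumes "\<And>i. i \<le> m \<Longrightarrow> \<exists>y. P y \<and> (i > 0 \<longrightarrow> a (i - 1) < y) \<and> (i < m \<longrightarrow> y < a i)"
  shows "\<exists>b. (\<forall>i<Suc m. P (b i)) \<and> (\<forall>i. Suc i < Suc m \<longrightarrow> b i < b (Suc i))"
proof -
  obtain b where b: "\<And>i. i \<le> m \<Longrightarrow> P (b i) \<and> (i > 0 \<longrightarrow> a (i - 1) < b i) \<and> (i < m \<longrightarrow> b i < a i)"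
    using assms by metis
  have "b i < b (Suc i)" if "i < m" for i
  proof -
    have "b i < a i" using b[of i] that by simp
    also have "a i < b (Suc i)" using b[of "Suc i"] that by simp
    finally show ?thesis .
  qed
  then show ?thesis using b by (intro exI[of _ b]) (simp add: less_Suc_eq_le)
qed

text \<open>Interlacing: up to the Gaussian factor, degree \<open>m + 1\<close> is minus the
  derivative of degree \<open>m\<close>, so Rolle puts a new zero between neighbouring zeros and one
  beyond each end.\<close>

lemma heat_poly_roots:
  "\<exists>a::nat \<Rightarrow> real. (\<forall>i<m. heat_poly m (a i) (-1/2) = 0) \<and> (\<forall>i. Suc i < m \<longrightarrow> a i < a (Suc i))"
proof (induction m)
  case (Suc m)
  show ?case
  proof (cases "m = 0")
    case True then show ?thesis by (auto intro!: exI[of _ "\<lambda>_. 0"])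
  next
    case m: False
    obtain a where a: "\<And>i. i < m \<Longrightarrow> heat_poly m (a i) (-1/2) = 0" "\<And>i. Suc i < m \<Longrightarrow> a i < a (Suc i)"
      using Suc by blast
    define g where "g = (\<lambda>x. heat_poly m x (-1/2) * exp (- x\<^sup>2 / 2))"
    \<comment> \<open>The derivative of \<open>g\<close>, because at \<open>t = -1/2\<close> the
      recursion reads
      \<open>heat_poly (Suc m) = x * heat_poly m - m * heat_poly (m - 1)\<close>.\<close>
    define g' where "g' = (\<lambda>x. - heat_poly (Suc m) x (-1/2) * exp (- x\<^sup>2 / 2))"
    have d: "(g has_field_derivative g' x) (at x)" for x
      unfolding g_def g'_def
      by (auto intro!: derivative_eq_intros simp add: heat_poly_rec[of m x] algebra_simps)
    have ga: "g (a i) = 0" if "i < m" for i using a(1)[OF that] by (simp add: g_def)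
    have top: "\<exists>y>a i. heat_poly (Suc m) y (-1/2) = 0" if "i < m" for i
      using Rolle_at_top[of g g' "a i"] d ga[OF that] tendsto_heat_poly_gaussian[of m "-1/2"]
      by (auto simp: g'_def g_def)
    \<comment> \<open>The lower end is the upper end reflected by the parity of the
      polynomials.\<close>
    have bot: "\<exists>y<a i. heat_poly (Suc m) y (-1/2) = 0" if "i < m" for i
    proof -
      have "g (- x) = (-1) ^ m * g x" for x by (simp add: g_def heat_poly_minus)
      then have "g (- a i) = 0" using ga[OF that] by simp
      then obtain c where c: "c > - a i" "g' c = 0"
        using Rolle_at_top[of g g' "- a i"] d tendsto_heat_poly_gaussian[of m "-1/2"]
        by (auto simp: g_def)
      then have "heat_poly (Suc m) (- c) (-1/2) = 0"
        by (simp add: heat_poly_minus g'_def del: heat_poly.simps)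
      then show ?thesis using c by (intro exI[of _ "- c"]) auto
    qed
    have mid: "\<exists>y. a i < y \<and> y < a (Suc i) \<and> heat_poly (Suc m) y (-1/2) = 0" if "Suc i < m" for i
    proof -
      have "\<exists>c>a i. c < a (Suc i) \<and> (g has_field_derivative 0) (at c)"
      proof (rule Rolle)
        show "continuous_on {a i..a (Suc i)} g"
          using d by (meson DERIV_isCont continuous_at_imp_continuous_on)
        show "a i < a (Suc i)" "g (a i) = g (a (Suc i))" using a(2)[OF that] ga that by auto
      qed (use d real_differentiable_def in blast)
      then obtain c where "a i < c" "c < a (Suc i)" "(g has_field_derivative 0) (at c)" by blast
      moreover then have "g' c = 0" using DERIV_unique d by blast
      ultimately show ?thesis by (auto simp: g'_def)
    qed
    show ?thesis
    proof (rule strict_interval_choice)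
      fix i assume "i \<le> m"
      then consider "i = 0" | "i = m" "i > 0" | j where "i = Suc j" "Suc j < m"
        by (metis le_neq_implies_less not0_implies_Suc zero_less_Suc)
      then show "\<exists>y. heat_poly (Suc m) y (-1/2) = 0 \<and> (i > 0 \<longrightarrow> a (i - 1) < y) \<and> (i < m \<longrightarrow> y < a i)"
      proof cases
        case 1 then show ?thesis using bot[of 0] m by auto
      next
        case 2 then show ?thesis using top[of "m - 1"] by auto
      next
        case 3 then show ?thesis using mid[of j] by auto
      qed
    qed
  qed
qed auto

text \<open>If \<open>heat_poly (Suc m)\<close> vanished on the interval, so would its derivative, a
  nonzero multiple of \<open>heat_poly m\<close>. This provides sample points off the zero
  set.\<close>

lemma heat_poly_nonzero_between:
  assumes "a < b" shows "\<exists>s. a < s \<and> s < b \<and> heat_poly m s t \<noteq> 0"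
proof (induction m)
  case 0 show ?case using dense[OF assms] by auto
next
  case (Suc m)
  show ?case
  proof (rule ccontr)
    assume "\<not> ?thesis"
    then have z: "heat_poly (Suc m) s t = 0" if "s \<in> {a<..<b}" for s using that by auto
    obtain s where s: "s \<in> {a<..<b}" "heat_poly m s t \<noteq> 0" using Suc by auto
    have "((\<lambda>x. heat_poly (Suc m) x t) has_field_derivative real (Suc m) * heat_poly m s t) (at s)"
      by (auto intro!: derivative_eq_intros simp del: heat_poly.simps)
    moreover have "((\<lambda>x. heat_poly (Suc m) x t) has_field_derivative 0) (at s)"
      by (rule has_field_derivative_transform_within_open[of "\<lambda>_. 0" _ _ "{a<..<b}"])
        (use s z in auto)
    ultimately show False using s DERIV_unique by force
  qed
qed

section \<open>Products of heat polynomials and their nodal grid\<close>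

text \<open>Products of solutions in separate space variables again solve the heat equation. They
  serve twice: as examples for the lower bound, and as the caloric polynomials whose value at
  \<open>t = 0\<close> is a given monomial.\<close>

definition heat_prod :: "('n::finite \<Rightarrow> nat) \<Rightarrow> (real ^ 'n) \<times> real \<Rightarrow> real" where
  "heat_prod m = (\<lambda>(x, t). \<Prod>i\<in>UNIV. heat_poly (m i) (x $ i) t)"

lemma heat_prod_split:
  "heat_prod m (x, t) = heat_poly (m i) (x $ i) t * (\<Prod>j\<in>UNIV - {i}. heat_poly (m j) (x $ j) t)"
  unfolding heat_prod_def by (simp add: prod.remove[of UNIV i])

lemma heat_prod_upd:
  "heat_prod (m(i := k)) (x, t) = heat_poly k (x $ i) t * (\<Prod>j\<in>UNIV - {i}. heat_poly (m j) (x $ j) t)"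
  unfolding heat_prod_split[of _ _ _ i] by (auto intro!: prod.cong)

text \<open>The scalar \<open>c\<close> makes the formula applicable to its own right-hand side, as
  the Laplacian requires.\<close>

lemma space_deriv_heat_prod:
  "space_deriv i (\<lambda>z. c * heat_prod m z) = (\<lambda>z. c * real (m i) * heat_prod (m(i := m i - 1)) z)"
proof
  fix z :: "(real ^ 'a) \<times> real"
  obtain x t where z: "z = (x, t)" by fastforce
  have "heat_prod m (x + s *\<^sub>R axis i 1, t) = heat_poly (m i) (x $ i + s) t * (\<Prod>j\<in>UNIV - {i}. heat_poly (m j) (x $ j) t)" for s
    unfolding heat_prod_split[of _ _ _ i] by (auto intro!: prod.cong simp: axis_def)
  moreover have "((\<lambda>s. c * (heat_poly (m i) (x $ i + s) t * (\<Prod>j\<in>UNIV - {i}. heat_poly (m j) (x $ j) t)))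
      has_field_derivative c * real (m i) * heat_prod (m(i := m i - 1)) z) (at 0)"
    unfolding z heat_prod_upd by (auto intro!: derivative_eq_intros)
  ultimately show "space_deriv i (\<lambda>z. c * heat_prod m z) z = c * real (m i) * heat_prod (m(i := m i - 1)) z"
    unfolding space_deriv_def z by (auto intro!: DERIV_imp_deriv)
qed

lemma space_laplacian_heat_prod:
  "space_laplacian (heat_prod m) z =
     (\<Sum>i\<in>UNIV. real (m i) * (real (m i) - 1) * heat_prod (m(i := m i - 2)) z)"
proof -
  have "space_deriv i (space_deriv i (heat_prod m)) z = real (m i) * (real (m i) - 1) * heat_prod (m(i := m i - 2)) z" for i
    using space_deriv_heat_prod[of i 1 m] space_deriv_heat_prod[of i "real (m i)" "m(i := m i - 1)"]
    by (cases "m i") (auto simp: numeral_2_eq_2)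
  then show ?thesis unfolding space_laplacian_def by simp
qed

lemma has_field_derivative_heat_prod_time:
  "((\<lambda>s. heat_prod m (x, s)) has_field_derivative
      (\<Sum>i\<in>UNIV. real (m i) * (real (m i) - 1) * heat_prod (m(i := m i - 2)) (x, t))) (at t)"
proof -
  have "((\<lambda>s. heat_prod m (x, s)) has_field_derivative
      (\<Sum>i\<in>UNIV. real (m i) * (real (m i) - 1) * heat_poly (m i - 2) (x $ i) t *
        (\<Prod>j\<in>UNIV - {i}. heat_poly (m j) (x $ j) t))) (at t)"
    unfolding heat_prod_def prod.case
    by (rule has_field_derivative_prod) (rule has_field_derivative_heat_poly_time)
  then show ?thesis unfolding heat_prod_upd by (simp add: mult.assoc)
qed

lemma time_deriv_heat_prod:
  "time_deriv (heat_prod m) z =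
     (\<Sum>i\<in>UNIV. real (m i) * (real (m i) - 1) * heat_prod (m(i := m i - 2)) z)"
  using DERIV_imp_deriv[OF has_field_derivative_heat_prod_time] unfolding time_deriv_def
  by (cases z) simp

lemma heat_prod_homogeneous:
  "heat_prod m (c *\<^sub>R x, c\<^sup>2 * t) = c ^ (\<Sum>i\<in>UNIV. m i) * heat_prod m (x, t)"
  by (simp add: heat_prod_def heat_poly_homogeneous prod.distrib power_sum)

lemma polynomial_function_heat_prod: "real_polynomial_function (heat_prod m)"
proof -
  have "real_polynomial_function (\<lambda>z::(real ^ 'a) \<times> real. heat_poly (m i) (fst z $ i) (snd z))" for i
    by (intro polynomial_function_heat_poly real_polynomial_function.intros(1)
        bounded_linear_compose[OF bounded_linear_vec_nth] bounded_linear_fst bounded_linear_snd)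
  then show ?thesis unfolding heat_prod_def case_prod_unfold
    by (intro real_polynomial_function_prod) auto
qed

lemma heat_prod_time_0: "heat_prod m (x, 0) = (\<Prod>i\<in>UNIV. (x $ i) ^ m i)"
  by (simp add: heat_prod_def)

lemma hcp_heat_prod:
  assumes "(\<Sum>i\<in>UNIV. m i) = d" shows "hcp d (heat_prod m)"
  unfolding hcp_def
proof (intro conjI)
  have "heat_prod m ((\<chi> i. 1), 0) \<noteq> 0" by (simp add: heat_prod_time_0)
  then show "\<exists>z. heat_prod m z \<noteq> 0" by blast
qed (use assms in \<open>auto simp: polynomial_function_heat_prod time_deriv_heat_prod
   space_laplacian_heat_prod heat_prod_homogeneous\<close>)

text \<open>Over the point with all coordinates \<open>1\<close> the value is \<open>1\<close> at
  \<open>t = 0\<close> and more than \<open>1\<close> at \<open>t = 1\<close>, so the time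
  derivative cannot vanish along this line.\<close>

lemma time_dependent_heat_prod:
  fixes m :: "'n::finite \<Rightarrow> nat"
  assumes "m i \<ge> 2" shows "time_dependent (heat_prod m)"
proof (rule ccontr)
  assume td: "\<not> time_dependent (heat_prod m)"
  define x :: "real ^ 'n" where "x = (\<chi> i. 1)"
  have "((\<lambda>s. heat_prod m (x, s)) has_field_derivative 0) (at t)" for t
  proof -
    obtain D where D: "((\<lambda>s. heat_prod m (x, s)) has_field_derivative D) (at t)"
      using has_field_derivative_heat_prod_time by blast
    have "deriv (\<lambda>s. heat_prod m (x, s)) t = 0"
      using td by (auto simp: time_dependent_def time_deriv_def)
    then have "D = 0" using DERIV_imp_deriv[OF D] by simp
    then show ?thesis using D by simp
  qed
  then have "heat_prod m (x, 1) = heat_prod m (x, 0)" using DERIV_isconst_all[of "\<lambda>s. heat_prod m (x, s)" 1 0] by blast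
  moreover have "heat_prod m (x, 0) = 1" by (simp add: heat_prod_time_0 x_def)
  moreover have "heat_prod m (x, 1) > 1"
  proof -
    have "(\<Prod>j\<in>UNIV - {i}. heat_poly (m j) 1 1) \<ge> 1"
      by (intro prod_ge_1) (simp add: heat_poly_ge_1)
    then have "heat_poly (m i) 1 1 * 1 \<le> heat_prod m (x, 1)"
      unfolding heat_prod_split[of m x 1 i] using heat_poly_ge_1[of "m i"]
      by (intro mult_mono) (auto simp: x_def)
    then show ?thesis using heat_poly_gt_1[OF assms] by linarith
  qed
  ultimately show False by simp
qed

text \<open>A bounded gap in one coordinate shrinks to the hyperplane \<open>x $ i = 0\<close> as \<open>t\<close> tends to \<open>0\<close>,
  where \<open>heat_prod m\<close> vanishes; this keeps the cell away from \<open>t = 0\<close>.\<close>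

lemma cell_separates:
  fixes lo hi :: "'n::finite \<Rightarrow> real" and bd :: "'n \<Rightarrow> bool"
  defines "U \<equiv> {(x, t). t < 0 \<and> (\<forall>i. lo i * sqrt (- 2 * t) < x $ i \<and> (bd i \<longrightarrow> x $ i < hi i * sqrt (- 2 * t)))}"
  assumes lo: "\<And>i. heat_poly (m i) (lo i) (-1/2) = 0"
    and hi: "\<And>i. bd i \<Longrightarrow> heat_poly (m i) (hi i) (-1/2) = 0"
    and bd: "bd k" and mk: "m k \<ge> 1"
    and C: "C \<in> nodal_domains (heat_prod m)" and "C \<inter> U \<noteq> {}"
  shows "C \<subseteq> U"
proof -
  \<comment> \<open>The closed cell adds to \<open>U\<close> only grid points and points with
    \<open>t = 0\<close>. Where \<open>heat_prod m\<close> is nonzero the two coincide, so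
    \<open>U\<close> is open and closed relative to the nonzero set.\<close>
  define V where "V = {(x, t). t \<le> 0 \<and> (\<forall>i. lo i * sqrt (- 2 * t) \<le> x $ i \<and> (bd i \<longrightarrow> x $ i \<le> hi i * sqrt (- 2 * t)))}"
  have U_eq: "U = (\<Inter>i. {z. snd z < 0} \<inter> {z. lo i * sqrt (- 2 * snd z) < fst z $ i} \<inter>
     (if bd i then {z. fst z $ i < hi i * sqrt (- 2 * snd z)} else UNIV))"
    unfolding U_def by (auto split: if_splits)
  have opU: "open U"
    unfolding U_eq by (intro open_INT ballI finite open_Int) (auto intro!: open_Collect_less continuous_intros)
  have V_eq: "V = (\<Inter>i. {z. snd z \<le> 0} \<inter> {z. lo i * sqrt (- 2 * snd z) \<le> fst z $ i} \<inter>
     (if bd i then {z. fst z $ i \<le> hi i * sqrt (- 2 * snd z)} else UNIV))"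
    unfolding V_def by (auto split: if_splits)
  have clV: "closed V"
    unfolding V_eq by (intro closed_INT ballI closed_Int) (auto intro!: closed_Collect_le continuous_intros)
  \<comment> \<open>By homogeneity a Hermite zero \<open>r\<close> at time \<open>-1/2\<close>
    propagates along the parabola \<open>x $ i = r * sqrt (- 2 * t)\<close>.\<close>
  have edge: "heat_prod m (x, t) = 0"
    if t: "t < 0" and r: "heat_poly (m i) r (-1/2) = 0" and x: "x $ i = r * sqrt (- 2 * t)" for x t i r
  proof -
    have "(sqrt (- 2 * t))\<^sup>2 * (-1/2) = t" using t by simp
    then have "heat_poly (m i) (x $ i) t = 0"
      using heat_poly_homogeneous[of "m i" "sqrt (- 2 * t)" r "-1/2"] r x by (simp add: mult.commute)
    then show ?thesis unfolding heat_prod_split[of m x t i] by simp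
  qed
  have VU: "z \<in> U" if z: "z \<in> V" "heat_prod m z \<noteq> 0" for z
  proof -
    obtain x t where zz: "z = (x, t)" by fastforce
    have "t \<noteq> 0"
    proof
      assume t: "t = 0"
      then have "lo k * sqrt (- 2 * t) \<le> x $ k" "x $ k \<le> hi k * sqrt (- 2 * t)"
        using z bd unfolding V_def zz by auto
      then have "x $ k = 0" using t by simp
      then have "heat_prod m z = 0" using mk t unfolding zz by (simp add: heat_prod_split[of m x 0 k])
      then show False using z by simp
    qed
    then have t: "t < 0" using z unfolding V_def zz by auto
    have "lo i * sqrt (- 2 * t) < x $ i" for i
      using z edge[OF t lo, of x i] unfolding V_def zz by (metis (mono_tags, lifting) case_prodD less_eq_real_def mem_Collect_eq)
    moreover have "x $ i < hi i * sqrt (- 2 * t)" if "bd i" for i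
      using z edge[OF t hi, of i x] that unfolding V_def zz by (metis (mono_tags, lifting) case_prodD less_eq_real_def mem_Collect_eq)
    ultimately show ?thesis using t unfolding U_def zz by auto
  qed
  have UV: "U \<subseteq> V" unfolding U_def V_def by (auto simp: less_imp_le)
  have con: "connected C" and C0: "C \<subseteq> {z. heat_prod m z \<noteq> 0}"
    using C in_components_connected in_components_subset unfolding nodal_domains_def by blast+
  have "C \<subseteq> U \<union> - V" using VU C0 by auto
  then have "- V \<inter> C = {}"
    using connectedD[OF con opU, of "- V"] clV UV \<open>C \<inter> U \<noteq> {}\<close> by auto
  then show ?thesis using VU C0 by auto
qed

lemma mono_of_Suc_less:
  fixes a :: "nat \<Rightarrow> 'a::order"
  assumes "\<And>i. Suc i < m \<Longrightarrow> a i < a (Suc i)" "i \<le> j" "j < m"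
  shows "a i \<le> a j"
  using assms(2,3)
proof (induction j rule: dec_induct)
  case (step n)
  then show ?case using assms(1)[of n] by (metis Suc_lessD less_imp_le order_trans)
qed simp

lemma num_nodal_domains_ge:
  assumes "I \<subseteq> nodal_domains u" "finite I"
  shows "enat (card I) \<le> num_nodal_domains u"
  using assms by (auto simp: num_nodal_domains_def intro: card_mono)

text \<open>Only the first \<open>k\<close> zeros per coordinate are used. An index
  \<open>j < k - 1\<close> stands for the gap above zero number \<open>j\<close>, and
  \<open>k - 1\<close> for everything above the last used zero; so a function \<open>J\<close> into
  \<open>{..<k}\<close> names a cell.\<close>

lemma num_nodal_domains_heat_prod:
  fixes m :: "'n::finite \<Rightarrow> nat"
  assumes k: "k \<ge> 1" and km: "\<And>i. k \<le> m i"
  shows "enat (k ^ CARD('n)) \<le> num_nodal_domains (heat_prod m)"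
proof -
  have "\<exists>a. \<forall>i. (\<forall>j<m i. heat_poly (m i) (a i j) (-1/2) = 0) \<and> (\<forall>j. Suc j < m i \<longrightarrow> a i j < a i (Suc j))"
    using heat_poly_roots by (intro choice) blast
  then obtain a :: "'n \<Rightarrow> nat \<Rightarrow> real"
    where a: "\<And>i j. j < m i \<Longrightarrow> heat_poly (m i) (a i j) (-1/2) = 0" "\<And>i j. Suc j < m i \<Longrightarrow> a i j < a i (Suc j)"
    by metis
  have mono: "a i j \<le> a i j'" if "j \<le> j'" "j' < k" for i j j'
    using mono_of_Suc_less[of "m i" "a i" j j'] a(2) that km[of i] by force
  \<comment> \<open>Sample points inside the gaps. The unbounded one may contain further zeros, so
    the point has to avoid the zero set as well.\<close>
  have "\<exists>s. a i j < s \<and> (Suc j < k \<longrightarrow> s < a i (Suc j)) \<and> heat_poly (m i) s (-1/2) \<noteq> 0" for i j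
  proof (cases "Suc j < k")
    case True
    then show ?thesis using heat_poly_nonzero_between a(2)[of j i] km[of i] by (meson less_le_trans)
  next
    case False
    then show ?thesis using heat_poly_nonzero_between[of "a i j" "a i j + 1"] by auto
  qed
  then obtain s where s: "\<And>i j. a i j < s i j" "\<And>i j. Suc j < k \<Longrightarrow> s i j < a i (Suc j)"
    "\<And>i j. heat_poly (m i) (s i j) (-1/2) \<noteq> 0"
    by metis
  define N where "N = {z. heat_prod m z \<noteq> 0}"
  define z :: "('n \<Rightarrow> nat) \<Rightarrow> (real ^ 'n) \<times> real" where "z J = ((\<chi> i. s i (J i)), -1/2)" for J
  define comp where "comp J = connected_component_set N (z J)" for J
  define P where "P = (UNIV :: 'n set) \<rightarrow>\<^sub>E {..<k}"
  have zN: "z J \<in> N" for J using s(3) by (auto simp: N_def z_def heat_prod_def)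
  have compn: "comp J \<in> nodal_domains (heat_prod m)" for J
    using zN unfolding comp_def nodal_domains_def N_def[symmetric] by (auto simp: components_def)
  have zc: "z J \<in> comp J" for J using zN unfolding comp_def by (simp add: connected_component_refl)
  \<comment> \<open>\<open>cell_separates\<close> asks for one coordinate bounded above, hence
    \<open>i0\<close>. Every coordinate of \<open>z J'\<close> then lies in the gap of
    \<open>J\<close>, and disjointness of the gaps forces equal indices.\<close>
  have same: "J' = J" if J: "J \<in> P" and J': "J' \<in> P" and i0: "Suc (J i0) < k" and eq: "comp J = comp J'" for J J' i0
  proof
    fix i
    define U where "U = {(x::real ^ 'n, t). t < 0 \<and> (\<forall>i. a i (J i) * sqrt (- 2 * t) < x $ i \<and>
        (Suc (J i) < k \<longrightarrow> x $ i < a i (Suc (J i)) * sqrt (- 2 * t)))}"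
    have Jk: "J i < k" "J' i < k" for i using J J' by (auto simp: P_def PiE_iff)
    have "comp J \<subseteq> U"
      unfolding U_def
    proof (rule cell_separates[where k = i0])
      show "heat_poly (m i) (a i (J i)) (-1/2) = 0" for i using a(1) Jk km by (meson less_le_trans)
      show "heat_poly (m i) (a i (Suc (J i))) (-1/2) = 0" if "Suc (J i) < k" for i
        using a(1) that km by (meson less_le_trans)
      have "z J \<in> U" using s by (auto simp: U_def z_def)
      then have "comp J \<inter> U \<noteq> {}" using zc[of J] by blast
      then show "comp J \<inter> {(x, t). t < 0 \<and> (\<forall>i. a i (J i) * sqrt (- 2 * t) < x $ i \<and>
        (Suc (J i) < k \<longrightarrow> x $ i < a i (Suc (J i)) * sqrt (- 2 * t)))} \<noteq> {}"
        by (simp only: U_def not_False_eq_True)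
      show "1 \<le> m i0" using k km[of i0] by linarith
    qed (fact i0 compn)+
    then have "z J' \<in> U" using zc[of J'] eq by auto
    then have *: "a i (J i) < s i (J' i)" "Suc (J i) < k \<Longrightarrow> s i (J' i) < a i (Suc (J i))"
      by (auto simp: U_def z_def)
    show "J' i = J i"
    proof (rule linorder_cases[of "J' i" "J i"])
      assume lt: "J' i < J i"
      then have "Suc (J' i) < k" using Jk(1)[of i] by simp
      then have "s i (J' i) < a i (Suc (J' i))" by (rule s)
      also have "\<dots> \<le> a i (J i)" using mono lt Jk by simp
      finally show ?thesis using * by simp
    next
      assume lt: "J i < J' i"
      then have "Suc (J i) < k" using Jk(2)[of i] by simp
      then have "s i (J' i) < a i (Suc (J i))" by (rule *)
      also have "\<dots> \<le> a i (J' i)" using mono lt Jk by simp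
      finally show ?thesis using s(1)[of i "J' i"] by simp
    qed
  qed
  have "inj_on comp P"
  proof (rule inj_onI, rule ccontr)
    fix J J' assume J: "J \<in> P" "J' \<in> P" and eq: "comp J = comp J'" and ne: "J \<noteq> J'"
    \<comment> \<open>If neither cell has a coordinate bounded above, both indices are constantly
      \<open>k - 1\<close>.\<close>
    have top: "J i = k - 1" "J' i = k - 1" for i
    proof -
      have "J i < k" "J' i < k" using J by (auto simp: P_def PiE_iff)
      moreover have "\<not> Suc (J i) < k" "\<not> Suc (J' i) < k"
        using same[OF J(1,2) _ eq] same[OF J(2,1) _ eq[symmetric]] ne by auto
      ultimately show "J i = k - 1" "J' i = k - 1" by auto
    qed
    then have "J = J'" by auto
    then show False using ne by simp
  qed
  then have "card (comp ` P) = k ^ CARD('n)"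
    by (simp add: card_image P_def card_PiE)
  moreover have "finite P" by (simp add: P_def finite_PiE)
  ultimately show ?thesis
    using num_nodal_domains_ge[of "comp ` P" "heat_prod m"] compn by auto
qed

lemma exists_hcp_many_nodal_domains:
  assumes n: "CARD('n::finite) \<ge> 2" and d: "d \<ge> 2"
  shows "\<exists>p :: (real ^ 'n) \<times> real \<Rightarrow> real. hcp d p \<and> time_dependent p \<and>
    enat ((d div CARD('n)) ^ CARD('n)) \<le> num_nodal_domains p"
proof -
  \<comment> \<open>A quotient of \<open>1\<close> is reset to \<open>0\<close>: for
    \<open>d = CARD('n)\<close> all exponents would be \<open>1\<close> and the product
    time-independent, while the bound \<open>1\<close> only asks for one domain. With
    \<open>k = 0\<close> the whole degree \<open>d\<close> goes into coordinate
    \<open>i0\<close>.\<close>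
  define k where "k = (if d div CARD('n) \<le> 1 then 0 else d div CARD('n))"
  define i0 :: 'n where "i0 = undefined"
  define m where "m = (\<lambda>i. if i = i0 then d - (CARD('n) - 1) * k else k)"
  have kd: "CARD('n) * k \<le> d" by (simp add: k_def)
  have n1: "(CARD('n) - 1) * k + k = CARD('n) * k" using n by (simp add: diff_mult_distrib)
  have "(\<Sum>i\<in>UNIV. m i) = m i0 + (\<Sum>i\<in>UNIV - {i0}. m i)" by (simp add: sum.remove)
  also have "(\<Sum>i\<in>UNIV - {i0}. m i) = (CARD('n) - 1) * k" by (simp add: m_def)
  also have "m i0 + (CARD('n) - 1) * k = d" using kd n1 by (simp add: m_def)
  finally have hcp: "hcp d (heat_prod m)" by (rule hcp_heat_prod)
  have "k \<le> d - (CARD('n) - 1) * k" using kd n1 by linarith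
  then have mk: "k \<le> m i" for i by (simp add: m_def)
  have k: "k = 0 \<or> k \<ge> 2" by (auto simp: k_def)
  then have "m i0 \<ge> 2" using mk[of i0] d by (auto simp: m_def)
  then have td: "time_dependent (heat_prod m)" by (rule time_dependent_heat_prod)
  have "enat ((d div CARD('n)) ^ CARD('n)) \<le> num_nodal_domains (heat_prod m)"
  proof (cases "k = 0")
    case False
    then show ?thesis using num_nodal_domains_heat_prod[of k m] mk by (simp add: k_def split: if_splits)
  next
    case True
    obtain z where "heat_prod m z \<noteq> 0" using hcp by (auto simp: hcp_def)
    then have "connected_component_set {z. heat_prod m z \<noteq> 0} z \<in> nodal_domains (heat_prod m)"
      by (auto simp: nodal_domains_def components_def)
    then have "enat 1 \<le> num_nodal_domains (heat_prod m)"
      using num_nodal_domains_ge[of "{connected_component_set {z. heat_prod m z \<noteq> 0} z}"] by simp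
    moreover have "(d div CARD('n)) ^ CARD('n) \<le> 1"
      using True power_le_one[of "d div CARD('n)" "CARD('n)"] by (auto simp: k_def split: if_splits)
    ultimately show ?thesis by (meson enat_ord_simps(1) order_trans)
  qed
  then show ?thesis using hcp td by blast
qed

subsection \<open>The maximum principle\<close>

lemma polynomial_function_growth:
  fixes f :: "'a::real_normed_vector \<Rightarrow> real"
  assumes "real_polynomial_function f"
  shows "\<exists>C N. C \<ge> 0 \<and> (\<forall>z. \<bar>f z\<bar> \<le> C * (1 + norm z) ^ N)"
  using assms
proof induction
  case (linear f)
  then obtain K where K: "K > 0" "\<And>z. norm (f z) \<le> norm z * K" using bounded_linear.pos_bounded by blast
  have "\<bar>f z\<bar> \<le> K * (1 + norm z) ^ 1" for z
    using K(2)[of z] K(1) by (simp add: algebra_simps)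
  then show ?case using K by (meson less_imp_le)
next
  case (const c)
  show ?case by (rule exI[of _ "\<bar>c\<bar>"], rule exI[of _ 0]) auto
next
  case (add f g)
  then obtain C N D M where *: "C \<ge> 0" "D \<ge> 0" "\<And>z. \<bar>f z\<bar> \<le> C * (1 + norm z) ^ N" "\<And>z. \<bar>g z\<bar> \<le> D * (1 + norm z) ^ M"
    by metis
  have "\<bar>f z + g z\<bar> \<le> (C + D) * (1 + norm z) ^ (N + M)" for z
  proof -
    have "\<bar>f z + g z\<bar> \<le> C * (1 + norm z) ^ N + D * (1 + norm z) ^ M" using *(3,4)[of z] by linarith
    also have "\<dots> \<le> C * (1 + norm z) ^ (N + M) + D * (1 + norm z) ^ (N + M)"
      using * by (intro add_mono mult_left_mono power_increasing) auto
    finally show ?thesis by (simp add: algebra_simps)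
  qed
  then show ?case using * by (meson add_nonneg_nonneg)
next
  case (mult f g)
  then obtain C N D M where *: "C \<ge> 0" "D \<ge> 0" "\<And>z. \<bar>f z\<bar> \<le> C * (1 + norm z) ^ N" "\<And>z. \<bar>g z\<bar> \<le> D * (1 + norm z) ^ M"
    by metis
  have "\<bar>f z * g z\<bar> \<le> (C * D) * (1 + norm z) ^ (N + M)" for z
  proof -
    have "\<bar>f z * g z\<bar> \<le> (C * (1 + norm z) ^ N) * (D * (1 + norm z) ^ M)"
      unfolding abs_mult using * by (intro mult_mono) auto
    then show ?thesis by (simp add: algebra_simps power_add)
  qed
  then show ?case using * by (meson mult_nonneg_nonneg)
qed

text \<open>Since \<open>deriv\<close> is arbitrary where no derivative exists, existence has to
  come from the polynomial structure; the result is again a polynomial, so derivatives can be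
  iterated.\<close>

lemma polynomial_function_directional_derivative:
  fixes f :: "'a::real_normed_vector \<Rightarrow> real"
  assumes "real_polynomial_function f"
  shows "\<exists>f'. real_polynomial_function f' \<and>
    (\<forall>z s. ((\<lambda>s. f (z + s *\<^sub>R v)) has_field_derivative f' (z + s *\<^sub>R v)) (at s))"
  using assms
proof induction
  case (linear f)
  then interpret bounded_linear f .
  have "((\<lambda>s. f (z + s *\<^sub>R v)) has_field_derivative f v) (at s)" for z s
    unfolding add scale by (auto intro!: derivative_eq_intros)
  then show ?case by (intro exI[of _ "\<lambda>_. f v"]) auto
next
  case (const c)
  show ?case by (rule exI[of _ "\<lambda>_. 0"]) auto
next
  case (add f g)
  then obtain f' g' where *: "real_polynomial_function f'" "real_polynomial_function g'"
    "\<And>z s. ((\<lambda>s. f (z + s *\<^sub>R v)) has_field_derivative f' (z + s *\<^sub>R v)) (at s)"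
    "\<And>z s. ((\<lambda>s. g (z + s *\<^sub>R v)) has_field_derivative g' (z + s *\<^sub>R v)) (at s)" by metis
  show ?case
    by (rule exI[of _ "\<lambda>z. f' z + g' z"]) (use * in \<open>auto intro!: derivative_intros real_polynomial_function.intros(3)\<close>)
next
  case (mult f g)
  then obtain f' g' where *: "real_polynomial_function f'" "real_polynomial_function g'"
    "\<And>z s. ((\<lambda>s. f (z + s *\<^sub>R v)) has_field_derivative f' (z + s *\<^sub>R v)) (at s)"
    "\<And>z s. ((\<lambda>s. g (z + s *\<^sub>R v)) has_field_derivative g' (z + s *\<^sub>R v)) (at s)" by metis
  have "((\<lambda>s. f (z + s *\<^sub>R v) * g (z + s *\<^sub>R v)) has_field_derivative
      f' (z + s *\<^sub>R v) * g (z + s *\<^sub>R v) + f (z + s *\<^sub>R v) * g' (z + s *\<^sub>R v)) (at s)" for z s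
    by (rule DERIV_mult'[OF *(3) *(4), THEN DERIV_cong]) simp
  then show ?case
    by (intro exI[of _ "\<lambda>z. f' z * g z + f z * g' z"])
      (use * mult in \<open>auto intro!: real_polynomial_function.intros(3,4)\<close>)
qed

lemma space_deriv_polynomial:
  fixes p :: "(real ^ 'n::finite) \<times> real \<Rightarrow> real"
  assumes "real_polynomial_function p"
  shows "real_polynomial_function (space_deriv i p)"
    and "((\<lambda>s. p (x + s *\<^sub>R axis i 1, t)) has_field_derivative space_deriv i p (x + s *\<^sub>R axis i 1, t)) (at s)"
proof -
  obtain f' where f': "real_polynomial_function f'"
    "\<And>z s. ((\<lambda>s. p (z + s *\<^sub>R (axis i 1, 0))) has_field_derivative f' (z + s *\<^sub>R (axis i 1, 0))) (at s)"
    using polynomial_function_directional_derivative[OF assms] by blast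
  have d: "((\<lambda>s. p (x + s *\<^sub>R axis i 1, t)) has_field_derivative f' (x + s *\<^sub>R axis i 1, t)) (at s)" for x t s
    using f'(2)[of "(x, t)" s] by simp
  then have "space_deriv i p (x, t) = f' (x, t)" for x t
    unfolding space_deriv_def using DERIV_imp_deriv[OF d[of x t 0]] by simp
  then have "space_deriv i p = f'" by auto
  then show "real_polynomial_function (space_deriv i p)"
    "((\<lambda>s. p (x + s *\<^sub>R axis i 1, t)) has_field_derivative space_deriv i p (x + s *\<^sub>R axis i 1, t)) (at s)"
    using f' d by auto
qed

lemma time_deriv_polynomial:
  fixes p :: "(real ^ 'n) \<times> real \<Rightarrow> real"
  assumes "real_polynomial_function p"
  shows "real_polynomial_function (time_deriv p)"
    and "((\<lambda>s. p (x, s)) has_field_derivative time_deriv p (x, s)) (at s)"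
proof -
  obtain f' where f': "real_polynomial_function f'"
    "\<And>z s. ((\<lambda>s. p (z + s *\<^sub>R (0, 1))) has_field_derivative f' (z + s *\<^sub>R (0, 1))) (at s)"
    using polynomial_function_directional_derivative[OF assms] by blast
  have d: "((\<lambda>s. p (x, s)) has_field_derivative f' (x, s)) (at s)" for x s
    using f'(2)[of "(x, 0)" s] by simp
  have "time_deriv p = f'"
    unfolding time_deriv_def using DERIV_imp_deriv[OF d] by auto
  then show "real_polynomial_function (time_deriv p)"
    "((\<lambda>s. p (x, s)) has_field_derivative time_deriv p (x, s)) (at s)"
    using f' d by auto
qed

lemma local_max_second_derivative:
  fixes f :: "real \<Rightarrow> real"
  assumes d: "\<And>s. (f has_field_derivative f' s) (at s)" and d2: "(f' has_field_derivative D) (at 0)"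
    and e: "e > 0" and max: "\<And>s. \<bar>s\<bar> < e \<Longrightarrow> f s \<le> f 0"
  shows "D \<le> 0"
proof (rule ccontr)
  assume "\<not> D \<le> 0"
  then obtain h where h: "h > 0" "\<And>s. s > 0 \<Longrightarrow> s < h \<Longrightarrow> f' 0 < f' s"
    using DERIV_pos_inc_right[OF d2] by auto
  have "f' 0 = 0" using DERIV_local_max[OF d[of 0] e] max by simp
  define s where "s = min e h / 2"
  have s: "0 < s" "s < e" "s < h" using e h by (auto simp: s_def)
  obtain z where "z > 0" "z < s" "f s - f 0 = (s - 0) * f' z" using MVT2[of 0 s f f'] s d by blast
  moreover from this have "s * f' z > 0" using h(2)[of z] s \<open>f' 0 = 0\<close> by simp
  ultimately have "f s > f 0" by simp
  then show False using max[of s] s by simp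
qed

text \<open>A strict supersolution of the heat equation that outgrows every polynomial.\<close>

definition barrier :: "(real ^ 'n::finite) \<times> real \<Rightarrow> real" where
  "barrier = (\<lambda>(x, t). exp (2 * t) * (\<Sum>i\<in>UNIV. 2 * cosh (x $ i)))"

text \<open>The Laplacian of \<open>barrier\<close> is \<open>barrier\<close> itself, as
  \<open>cosh\<close> is its own second derivative; the time rate \<open>2\<close> exceeds that
  factor \<open>1\<close>, so the heat operator leaves a strictly positive
  \<open>barrier\<close>.\<close>

lemma barrier_time: "((\<lambda>s. barrier (x, s)) has_field_derivative 2 * barrier (x, t)) (at t)"
  unfolding barrier_def by (auto intro!: derivative_eq_intros)

definition barrier_deriv :: "'n \<Rightarrow> (real ^ 'n::finite) \<times> real \<Rightarrow> real" where
  "barrier_deriv i = (\<lambda>(x, t). exp (2 * t) * 2 * sinh (x $ i))"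

lemma barrier_space:
  "((\<lambda>s. barrier (x + s *\<^sub>R axis i 1, t)) has_field_derivative barrier_deriv i (x + s *\<^sub>R axis i 1, t)) (at s)"
proof -
  have "barrier (x + s *\<^sub>R axis i 1, t) =
      exp (2 * t) * (2 * cosh (x $ i + s)) + exp (2 * t) * (\<Sum>j\<in>UNIV - {i}. 2 * cosh (x $ j))" for s
  proof -
    have "(\<Sum>j\<in>UNIV - {i}. 2 * cosh ((x + s *\<^sub>R axis i 1) $ j)) = (\<Sum>j\<in>UNIV - {i}. 2 * cosh (x $ j))"
      by (rule sum.cong) (auto simp: axis_def)
    then show ?thesis unfolding barrier_def by (simp add: sum.remove[of UNIV i] distrib_left)
  qed
  then show ?thesis unfolding barrier_deriv_def by (auto intro!: derivative_eq_intros)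
qed

lemma barrier_space2:
  "((\<lambda>s. barrier_deriv i (x + s *\<^sub>R axis i 1, t)) has_field_derivative exp (2 * t) * (2 * cosh (x $ i))) (at 0)"
  unfolding barrier_deriv_def by (auto intro!: derivative_eq_intros)

text \<open>The Euclidean norm is at most the sum of the absolute coordinates, so one of them is at
  least \<open>norm x / CARD('n)\<close>, and its \<open>cosh\<close> alone gives the bound.\<close>

lemma barrier_ge: "t \<ge> 0 \<Longrightarrow> exp (norm (x :: real ^ 'n::finite) / CARD('n)) \<le> barrier (x, t)"
proof -
  assume t: "t \<ge> 0"
  have "\<exists>i. norm x / CARD('n) \<le> \<bar>x $ i\<bar>"
  proof (rule ccontr)
    assume "\<not> ?thesis"
    then have "(\<Sum>i\<in>UNIV. \<bar>x $ i\<bar>) < (\<Sum>i\<in>(UNIV::'n set). norm x / CARD('n))"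
      by (intro sum_strict_mono) (auto simp: not_le)
    then show False using norm_le_l1_cart[of x] by simp
  qed
  then obtain i where i: "norm x / CARD('n) \<le> \<bar>x $ i\<bar>" by blast
  have "exp (norm x / CARD('n)) \<le> exp \<bar>x $ i\<bar>" using i by simp
  also have "\<dots> \<le> 2 * cosh (x $ i)" by (auto simp: cosh_def abs_if)
  also have "\<dots> \<le> (\<Sum>i\<in>UNIV. 2 * cosh (x $ i))"
    by (rule member_le_sum) (auto intro: less_imp_le)
  also have "\<dots> \<le> exp (2 * t) * \<dots>"
    using t mult_right_mono[of 1 "exp (2 * t)" "\<Sum>i\<in>UNIV. 2 * cosh (x $ i)"]
    by (simp add: sum_nonneg)
  also have "\<dots> = barrier (x, t)" by (simp add: barrier_def)
  finally show ?thesis .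
qed

lemma continuous_on_barrier: "continuous_on S barrier"
  unfolding barrier_def case_prod_unfold cosh_def by (intro continuous_intros)

lemma polynomial_less_exp:
  fixes C e T :: real
  assumes "e > 0" "k > 0"
  shows "\<exists>R. \<forall>r\<ge>R. C * (1 + T + r) ^ N < e * exp (r / k)"
proof -
  have "((\<lambda>r. C * ((1 + T + r) ^ N * exp (- (r / k)))) \<longlongrightarrow> C * 0) at_top"
    using assms by (intro tendsto_mult tendsto_const) real_asymp
  then have "\<forall>\<^sub>F r in at_top. C * ((1 + T + r) ^ N * exp (- (r / k))) < e"
    using order_tendstoD(2)[of _ "C * 0" at_top e] assms by auto
  then obtain R where "\<And>r. r \<ge> R \<Longrightarrow> C * ((1 + T + r) ^ N * exp (- (r / k))) < e"
    by (auto simp: eventually_at_top_linorder)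
  then show ?thesis by (intro exI[of _ R]) (auto simp: exp_minus field_simps)
qed

text \<open>Compactness for the maximum principle on an unbounded domain: for times in
  \<open>[0, T]\<close> the exponential growth of \<open>barrier\<close> defeats the polynomial
  \<open>u\<close> far out in space.\<close>

lemma bounded_superlevel_barrier:
  fixes u :: "(real ^ 'n::finite) \<times> real \<Rightarrow> real"
  assumes u: "real_polynomial_function u" and e: "e > 0"
  shows "bounded {z. 0 \<le> snd z \<and> snd z \<le> T \<and> 0 \<le> u z - e * barrier z}"
proof -
  obtain C N where C: "C \<ge> 0" "\<And>z. \<bar>u z\<bar> \<le> C * (1 + norm z) ^ N"
    using polynomial_function_growth[OF u] by blast
  obtain R where R: "\<And>r. r \<ge> R \<Longrightarrow> C * (1 + \<bar>T\<bar> + r) ^ N < e * exp (r / real CARD('n))"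
    using polynomial_less_exp[OF e, of "real CARD('n)" C "\<bar>T\<bar>" N] by auto
  have "norm z \<le> R + \<bar>T\<bar>" if z: "0 \<le> snd z" "snd z \<le> T" "0 \<le> u z - e * barrier z" for z
  proof -
    obtain x t where zz: "z = (x, t)" by fastforce
    have nz: "norm z \<le> norm x + \<bar>T\<bar>"
      using norm_Pair_le[of x t] z zz by simp
    have "norm x \<le> R"
    proof (rule ccontr)
      assume "\<not> norm x \<le> R"
      then have "C * (1 + \<bar>T\<bar> + norm x) ^ N < e * exp (norm x / real CARD('n))" using R by simp
      also have "\<dots> \<le> e * barrier z" using barrier_ge[of t x] z e zz by simp
      also have "\<dots> \<le> C * (1 + norm z) ^ N" using C(2)[of z] z by simp
      also have "\<dots> \<le> C * (1 + \<bar>T\<bar> + norm x) ^ N" using nz C by (intro mult_left_mono power_mono) auto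
      finally show False by simp
    qed
    then show ?thesis using nz by simp
  qed
  then show ?thesis unfolding bounded_iff by blast
qed

lemma nodal_domain_props:
  assumes "W \<in> nodal_domains u" and "continuous_on UNIV u"
  shows "open W" "W \<noteq> {}" "\<And>z. z \<in> W \<Longrightarrow> u z \<noteq> 0" "\<And>z. z \<in> closure W \<Longrightarrow> u z \<noteq> 0 \<Longrightarrow> z \<in> W"
    and "\<And>S. connected S \<Longrightarrow> S \<inter> W \<noteq> {} \<Longrightarrow> (\<And>z. z \<in> S \<Longrightarrow> u z \<noteq> 0) \<Longrightarrow> S \<subseteq> W"
proof -
  have W: "W \<in> components {z. u z \<noteq> 0}" using assms by (simp add: nodal_domains_def)
  have op: "open {z. u z \<noteq> 0}" using assms(2) by (intro open_Collect_neq) auto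
  show "open W" using open_components[OF op W] .
  show "W \<noteq> {}" using in_components_nonempty[OF W] .
  show nz: "u z \<noteq> 0" if "z \<in> W" for z using in_components_subset[OF W] that by auto
  show max: "S \<subseteq> W" if "connected S" "S \<inter> W \<noteq> {}" "\<And>z. z \<in> S \<Longrightarrow> u z \<noteq> 0" for S
  proof -
    have "S \<subseteq> {z. u z \<noteq> 0}" "W \<inter> S \<noteq> {}" using that by blast+
    then show ?thesis using components_maximal[OF W that(1)] by blast
  qed
  show "z \<in> W" if z: "z \<in> closure W" "u z \<noteq> 0" for z
  proof -
    have "connected (insert z W)"
      using connected_intermediate_closure[OF in_components_connected[OF W], of "insert z W"]
        z closure_subset by blast
    then have "insert z W \<subseteq> W"
      by (rule max) (use \<open>W \<noteq> {}\<close> nz z in auto)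
    then show ?thesis by auto
  qed
qed

text \<open>If \<open>W\<close> stayed in nonnegative time, \<open>w = u - e * barrier\<close> would
  have a positive maximum over the part of \<open>W\<close> up to time \<open>T\<close>. There its
  time derivative is nonnegative and its Laplacian nonpositive, whereas the heat operator applied to
  \<open>w\<close> is \<open>- e * barrier < 0\<close>.\<close>

lemma caloric_positive_domain_meets_past:
  fixes u :: "(real ^ 'n::finite) \<times> real \<Rightarrow> real"
  assumes u: "real_polynomial_function u" and cal: "\<And>z. time_deriv u z - space_laplacian u z = 0"
    and W: "W \<in> nodal_domains u" and pos: "\<And>z. z \<in> W \<Longrightarrow> u z > 0"
  shows "\<exists>z\<in>W. snd z < 0"
proof (rule ccontr)
  assume "\<not> ?thesis"
  then have past: "\<And>z. z \<in> W \<Longrightarrow> 0 \<le> snd z" by (meson not_le)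
  have ct: "continuous_on UNIV u"
    using u by (auto intro: continuous_on_subset differentiable_imp_continuous_on
        differentiable_on_real_polynomial_function)
  note Wp = nodal_domain_props[OF W ct]
  obtain z1 where z1: "z1 \<in> W" using Wp by blast
  define T where "T = snd z1"
  have bpos: "barrier z > 0" if "z \<in> W" for z
    using barrier_ge[of "snd z" "fst z"] past[OF that] by (auto intro: less_le_trans[OF exp_gt_zero])
  \<comment> \<open>Chosen so that \<open>w z1\<close> is half of \<open>u z1\<close>, hence
    positive.\<close>
  define e where "e = u z1 / (2 * barrier z1)"
  have e: "e > 0" using pos z1 bpos by (simp add: e_def)
  define w where "w z = u z - e * barrier z" for z
  have w1: "w z1 > 0" using pos[OF z1] bpos[OF z1] by (simp add: w_def e_def)
  have ctw: "continuous_on UNIV w" unfolding w_def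
    by (intro continuous_intros ct continuous_on_barrier)
  define K where "K = closure W \<inter> ({z. 0 \<le> snd z} \<inter> {z. snd z \<le> T} \<inter> {z. w z1 \<le> w z})"
  have "closed K" unfolding K_def
    by (intro closed_Int closed_closure closed_Collect_le continuous_intros ctw)
  moreover have "bounded K"
    by (rule bounded_subset[OF bounded_superlevel_barrier[OF u e, of T]]) (use w1 in \<open>auto simp: K_def w_def\<close>)
  ultimately have "compact K" by (simp add: compact_eq_bounded_closed)
  moreover have z1K: "z1 \<in> K" using z1 past closure_subset by (auto simp: K_def T_def)
  ultimately obtain z0 where z0: "z0 \<in> K" "\<And>z. z \<in> K \<Longrightarrow> w z \<le> w z0"
    using continuous_attains_sup[of K w] ctw by (metis continuous_on_subset empty_iff top_greatest)
  have w0: "w z1 \<le> w z0" using z0 z1K by auto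
  have max: "w z \<le> w z0" if "z \<in> W" "snd z \<le> T" for z
  proof (cases "w z1 \<le> w z")
    case True
    have "z \<in> closure W" using that closure_subset by blast
    then have "z \<in> K" unfolding K_def using True that past[of z] by simp
    then show ?thesis by (rule z0)
  next
    case False then show ?thesis using w0 by simp
  qed
  obtain x0 t0 where zz: "z0 = (x0, t0)" by fastforce
  have "barrier z0 > 0"
    using barrier_ge[of t0 x0] z0 zz by (auto simp: K_def intro: less_le_trans[OF exp_gt_zero])
  then have "u z0 > 0" using w0 w1 e unfolding w_def by (smt (verit) mult_pos_pos)
  \<comment> \<open>The closure of \<open>W\<close> adds only zeros of \<open>u\<close>, so a
    maximum point with \<open>u z0 > 0\<close> is not on the nodal boundary.\<close>
  then have z0W: "z0 \<in> W" using Wp(4) z0 by (auto simp: K_def)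
  then obtain r where r: "r > 0" "ball z0 r \<subseteq> W" using Wp(1) open_contains_ball by blast
  have t0T: "t0 \<le> T" using z0 zz by (auto simp: K_def)
  have D2: "space_deriv i (space_deriv i u) z0 - e * (exp (2 * t0) * (2 * cosh (x0 $ i))) \<le> 0" for i
  proof (rule local_max_second_derivative[where f = "\<lambda>s. w (x0 + s *\<^sub>R axis i 1, t0)"
        and f' = "\<lambda>s. space_deriv i u (x0 + s *\<^sub>R axis i 1, t0) - e * barrier_deriv i (x0 + s *\<^sub>R axis i 1, t0)" and e = r])
    show "((\<lambda>s. w (x0 + s *\<^sub>R axis i 1, t0)) has_real_derivative
        space_deriv i u (x0 + s *\<^sub>R axis i 1, t0) - e * barrier_deriv i (x0 + s *\<^sub>R axis i 1, t0)) (at s)" for s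
      unfolding w_def by (intro DERIV_diff DERIV_cmult space_deriv_polynomial(2) u barrier_space)
    show "((\<lambda>s. space_deriv i u (x0 + s *\<^sub>R axis i 1, t0) - e * barrier_deriv i (x0 + s *\<^sub>R axis i 1, t0)) has_real_derivative
        space_deriv i (space_deriv i u) z0 - e * (exp (2 * t0) * (2 * cosh (x0 $ i)))) (at 0)"
      using space_deriv_polynomial(2)[OF space_deriv_polynomial(1)[OF u], where x = x0 and i = i and t = t0 and s = 0]
      unfolding zz by (intro DERIV_diff DERIV_cmult barrier_space2) simp
    show "w (x0 + s *\<^sub>R axis i 1, t0) \<le> w (x0 + 0 *\<^sub>R axis i 1, t0)" if "\<bar>s\<bar> < r" for s
    proof -
      have "(x0 + s *\<^sub>R axis i 1, t0) \<in> ball z0 r"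
        using that by (simp add: zz dist_Pair_Pair dist_norm norm_axis_1)
      then show ?thesis using max[of "(x0 + s *\<^sub>R axis i 1, t0)"] r t0T zz by auto
    qed
  qed (use r in auto)
  have "(\<Sum>i\<in>UNIV. space_deriv i (space_deriv i u) z0 - e * (exp (2 * t0) * (2 * cosh (x0 $ i)))) \<le> 0"
    by (intro sum_nonpos D2)
  then have lap: "space_laplacian u z0 \<le> e * barrier z0"
    unfolding space_laplacian_def zz barrier_def by (simp add: sum_subtractf sum_distrib_left)
  \<comment> \<open>Since \<open>t0 = T\<close> is possible, only earlier times are compared: a
    negative derivative would make \<open>w\<close> larger just before \<open>t0\<close>.\<close>
  have "time_deriv u z0 - e * (2 * barrier z0) \<ge> 0"
  proof (rule ccontr)
    assume neg: "\<not> ?thesis"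
    have "((\<lambda>s. w (x0, s)) has_real_derivative time_deriv u z0 - e * (2 * barrier z0)) (at t0)"
      unfolding w_def zz by (intro DERIV_diff DERIV_cmult time_deriv_polynomial(2) u barrier_time)
    from DERIV_neg_dec_left[OF this] neg obtain d where d: "d > 0"
      "\<And>h. h > 0 \<Longrightarrow> h < d \<Longrightarrow> w (x0, t0) < w (x0, t0 - h)" by auto
    define h where "h = min d r / 2"
    have h: "h > 0" "h < d" "h < r" using d r by (auto simp: h_def)
    then have "(x0, t0 - h) \<in> ball z0 r" by (simp add: zz dist_Pair_Pair dist_real_def)
    then have "w (x0, t0 - h) \<le> w z0" using max[of "(x0, t0 - h)"] r h t0T by auto
    then show False using d(2)[OF h(1,2)] zz by simp
  qed
  then have "e * (2 * barrier z0) \<le> e * barrier z0" using lap cal[of z0] by linarith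
  then show False using e \<open>barrier z0 > 0\<close> by simp
qed

lemma caloric_linear_combination:
  fixes u v :: "(real ^ 'n::finite) \<times> real \<Rightarrow> real"
  assumes u: "real_polynomial_function u" "\<And>z. time_deriv u z - space_laplacian u z = 0"
    and v: "real_polynomial_function v" "\<And>z. time_deriv v z - space_laplacian v z = 0"
  shows "real_polynomial_function (\<lambda>z. a * u z + b * v z)"
    and "time_deriv (\<lambda>z. a * u z + b * v z) z - space_laplacian (\<lambda>z. a * u z + b * v z) z = 0"
proof -
  have sd: "space_deriv i (\<lambda>z. a * f z + b * g z) = (\<lambda>z. a * space_deriv i f z + b * space_deriv i g z)"
    if "real_polynomial_function f" "real_polynomial_function g" for f g :: "(real ^ 'n) \<times> real \<Rightarrow> real" and i
  proof
    fix z
    show "space_deriv i (\<lambda>z. a * f z + b * g z) z = a * space_deriv i f z + b * space_deriv i g z"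
      using DERIV_imp_deriv[OF DERIV_add[OF
          DERIV_cmult[OF space_deriv_polynomial(2)[OF that(1), where x = "fst z" and i = i and t = "snd z" and s = 0]]
          DERIV_cmult[OF space_deriv_polynomial(2)[OF that(2), where x = "fst z" and i = i and t = "snd z" and s = 0]]]]
      by (cases z) (simp add: space_deriv_def)
  qed
  have "time_deriv (\<lambda>z. a * u z + b * v z) z = a * time_deriv u z + b * time_deriv v z"
    using DERIV_imp_deriv[OF DERIV_add[OF DERIV_cmult[OF time_deriv_polynomial(2)[OF u(1)]]
        DERIV_cmult[OF time_deriv_polynomial(2)[OF v(1)]]]]
    by (cases z) (simp add: time_deriv_def)
  moreover have "space_laplacian (\<lambda>z. a * u z + b * v z) z = a * space_laplacian u z + b * space_laplacian v z"
    unfolding space_laplacian_def sd[OF u(1) v(1)] sd[OF space_deriv_polynomial(1)[OF u(1)] space_deriv_polynomial(1)[OF v(1)]]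
    by (simp add: sum.distrib sum_distrib_left)
  ultimately show "time_deriv (\<lambda>z. a * u z + b * v z) z - space_laplacian (\<lambda>z. a * u z + b * v z) z = 0"
    using u(2)[of z] v(2)[of z] by simp
  show "real_polynomial_function (\<lambda>z. a * u z + b * v z)"
    using u(1) v(1) by (intro real_polynomial_function.intros(2-4))
qed

lemma caloric_domain_meets_past:
  fixes u :: "(real ^ 'n::finite) \<times> real \<Rightarrow> real"
  assumes u: "real_polynomial_function u" and cal: "\<And>z. time_deriv u z - space_laplacian u z = 0"
    and W: "W \<in> nodal_domains u"
  shows "\<exists>z\<in>W. snd z < 0"
proof -
  have ct: "continuous_on UNIV u"
    using u by (auto intro: continuous_on_subset differentiable_imp_continuous_on
        differentiable_on_real_polynomial_function)
  note Wp = nodal_domain_props[OF W ct]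
  have con: "connected W" using W by (simp add: nodal_domains_def in_components_connected)
  have "(\<forall>z\<in>W. u z > 0) \<or> (\<forall>z\<in>W. - u z > 0)"
  proof (rule ccontr)
    assume "\<not> ?thesis"
    then obtain a b where ab: "a \<in> W" "b \<in> W" "u a \<le> 0" "0 \<le> u b" by force
    have "connected (u ` W)" by (intro connected_continuous_image con continuous_on_subset[OF ct]) auto
    then have "0 \<in> u ` W" using connectedD_interval[of "u ` W" "u a" "u b" 0] ab by auto
    then show False using Wp(3) by auto
  qed
  then show ?thesis
  proof
    assume "\<forall>z\<in>W. u z > 0"
    then show ?thesis using caloric_positive_domain_meets_past[OF u cal W] by blast
  next
    assume "\<forall>z\<in>W. - u z > 0"
    moreover have "real_polynomial_function (\<lambda>z. - u z)"
      "\<And>z. time_deriv (\<lambda>z. - u z) z - space_laplacian (\<lambda>z. - u z) z = 0"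
      using caloric_linear_combination[OF u cal u cal, of "-1" 0] by simp_all
    moreover have "W \<in> nodal_domains (\<lambda>z. - u z)" using W by (simp add: nodal_domains_def)
    ultimately show ?thesis by (intro caloric_positive_domain_meets_past) auto
  qed
qed

text \<open>By homogeneity the parabola of points \<open>(l *\<^sub>R x, l\<^sup>2 * t)\<close> with
  \<open>l > 0\<close> stays in one nodal domain, and for \<open>t < 0\<close> it crosses the
  slice.\<close>

lemma nodal_domain_meets_slice:
  fixes p :: "(real ^ 'n::finite) \<times> real \<Rightarrow> real"
  assumes p: "hcp d p" and W: "W \<in> nodal_domains p"
  shows "\<exists>x. (x, -1/2) \<in> W"
proof -
  have pol: "real_polynomial_function p" and hom: "\<And>c x t. c > 0 \<Longrightarrow> p (c *\<^sub>R x, c\<^sup>2 * t) = c ^ d * p (x, t)"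
    using p by (auto simp: hcp_def)
  have ct: "continuous_on UNIV p"
    using pol by (auto intro: continuous_on_subset differentiable_imp_continuous_on
        differentiable_on_real_polynomial_function)
  note Wp = nodal_domain_props[OF W ct]
  obtain x t where xt: "(x, t) \<in> W" "t < 0"
    using caloric_domain_meets_past[OF pol _ W] p by (auto simp: hcp_def)
  define c where "c = 1 / sqrt (- 2 * t)"
  have c: "c > 0" "c\<^sup>2 * t = -1/2" using xt by (auto simp: c_def power_divide)
  define S where "S = (\<lambda>l. (l *\<^sub>R x, l\<^sup>2 * t)) ` {0<..}"
  have "connected S" unfolding S_def
    by (intro connected_continuous_image continuous_intros) auto
  moreover have "p z \<noteq> 0" if "z \<in> S" for z
    using that hom Wp(3)[OF xt(1)] by (auto simp: S_def)
  moreover have "(x, t) \<in> S" unfolding S_def by (rule image_eqI[of _ _ 1]) auto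
  ultimately have "S \<subseteq> W" using Wp(5)[of S] xt by blast
  moreover have "(c *\<^sub>R x, -1/2) \<in> S" unfolding S_def using c by (intro image_eqI[of _ _ c]) auto
  ultimately show ?thesis by blast
qed

subsection \<open>Gaussian densities and the Mehler kernel\<close>

text \<open>The absolute value keeps the density nonnegative for junk values \<open>v < 0\<close>.\<close>

definition gauss_density :: "real \<Rightarrow> 'a::euclidean_space \<Rightarrow> 'a \<Rightarrow> real" where
  "gauss_density v m z = exp (- (norm (z - m))\<^sup>2 / (2 * v)) / sqrt (2 * pi * \<bar>v\<bar>) ^ DIM('a)"

lemma gauss_density_prod:
  assumes "v > 0"
  shows "gauss_density v m z = (\<Prod>b\<in>Basis. normal_density (m \<bullet> b) (sqrt v) (z \<bullet> b))"
proof -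
  have "(norm (z - m))\<^sup>2 = (\<Sum>b\<in>Basis. (z \<bullet> b - m \<bullet> b)\<^sup>2)"
    by (simp only: power2_norm_eq_inner euclidean_inner[of "z - m" "z - m"])
      (simp add: inner_diff_left power2_eq_square)
  then have "- (norm (z - m))\<^sup>2 / (2 * v) = (\<Sum>b\<in>Basis. - (z \<bullet> b - m \<bullet> b)\<^sup>2 / (2 * v))"
    by (simp add: sum_negf sum_divide_distrib)
  then show ?thesis
    using assms by (simp add: gauss_density_def normal_density_def exp_sum prod_dividef)
qed

lemma borel_measurable_gauss_density [measurable]:
  "(\<lambda>x. gauss_density v (f x) (g x)) \<in> borel_measurable M"
  if [measurable]: "f \<in> borel_measurable M" "g \<in> borel_measurable M"
  unfolding gauss_density_def by measurable

lemma gauss_density_nonneg [simp]: "0 \<le> gauss_density v m z"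
  by (simp add: gauss_density_def zero_le_divide_iff)

lemma gauss_density_pos: "v > 0 \<Longrightarrow> 0 < gauss_density v m z"
  by (simp add: gauss_density_def)

lemma nn_integral_gauss_density:
  assumes "v > 0"
  shows "(\<integral>\<^sup>+z. ennreal (gauss_density v m z) \<partial>lborel) = 1"
proof -
  have "(\<integral>\<^sup>+z. ennreal (gauss_density v m z) \<partial>lborel) =
      (\<integral>\<^sup>+z. (\<Prod>b\<in>Basis. ennreal (normal_density (m \<bullet> b) (sqrt v) (z \<bullet> b))) \<partial>lborel)"
    by (simp add: gauss_density_prod[OF assms] prod_ennreal)
  also have "\<dots> = (\<Prod>b\<in>Basis. \<integral>\<^sup>+x. ennreal (normal_density (m \<bullet> b) (sqrt v) x) \<partial>lborel)"
    by (rule nn_integral_lborel_prod) auto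
  also have "\<dots> = 1"
  proof (rule prod.neutral, rule ballI)
    fix b :: 'a
    interpret prob_space "density lborel (normal_density (m \<bullet> b) (sqrt v))"
      using assms by (intro prob_space_normal_density) simp
    show "(\<integral>\<^sup>+x. ennreal (normal_density (m \<bullet> b) (sqrt v) x) \<partial>lborel) = 1"
      using emeasure_space_1 by (simp add: emeasure_density)
  qed
  finally show ?thesis .
qed

lemma integrable_gauss_density: "v > 0 \<Longrightarrow> integrable lborel (gauss_density v m)"
  by (rule integrableI_nn_integral_finite[of _ _ 1]) (auto simp: nn_integral_gauss_density)

text \<open>The density at \<open>(x, y)\<close> of a pair of standard Gaussian vectors with correlation \<open>r\<close>.\<close>

definition mehler :: "real \<Rightarrow> 'a::euclidean_space \<Rightarrow> 'a \<Rightarrow> real" where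
  "mehler r x y = gauss_density 1 0 x * gauss_density (1 - r\<^sup>2) (r *\<^sub>R x) y"

lemma mehler_nonneg [simp]: "0 \<le> mehler r x y"
  by (simp add: mehler_def)

lemma borel_measurable_mehler [measurable]:
  "(\<lambda>x. mehler r (f x) (g x)) \<in> borel_measurable M"
  if [measurable]: "f \<in> borel_measurable M" "g \<in> borel_measurable M"
  unfolding mehler_def by measurable

lemma mehler_commute:
  assumes "\<bar>r\<bar> < 1"
  shows "mehler r x y = mehler r y x"
proof -
  have v: "1 - r\<^sup>2 > 0" using assms by (simp add: abs_square_less_1)
  have "- (norm x)\<^sup>2 / 2 + - (norm (y - r *\<^sub>R x))\<^sup>2 / (2 * (1 - r\<^sup>2)) =
      - (norm y)\<^sup>2 / 2 + - (norm (x - r *\<^sub>R y))\<^sup>2 / (2 * (1 - r\<^sup>2))"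
    unfolding power2_norm_eq_inner using v
    by (simp add: inner_diff_left inner_diff_right inner_commute divide_simps) (simp add: algebra_simps power2_eq_square)
  then have "exp (- (norm x)\<^sup>2 / 2) * exp (- (norm (y - r *\<^sub>R x))\<^sup>2 / (2 * (1 - r\<^sup>2))) =
      exp (- (norm y)\<^sup>2 / 2) * exp (- (norm (x - r *\<^sub>R y))\<^sup>2 / (2 * (1 - r\<^sup>2)))"
    by (simp add: exp_add[symmetric])
  then show ?thesis by (simp add: mehler_def gauss_density_def)
qed

text \<open>Completing the square in the middle point \<open>x\<close>: the steps from
  \<open>y\<close> to \<open>x\<close> and from \<open>x\<close> to \<open>z\<close> amount to the
  double step from \<open>y\<close> to \<open>z\<close> times the density of \<open>x\<close> given
  both ends, whose variance and mean appear in the last factor.\<close>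

lemma gauss_density_chapman_kolmogorov_pointwise:
  fixes x y z :: "'a::euclidean_space"
  assumes r: "\<bar>r\<bar> < 1"
  shows "gauss_density (1 - r\<^sup>2) (r *\<^sub>R y) x * gauss_density (1 - r\<^sup>2) (r *\<^sub>R x) z =
    gauss_density (1 - (r\<^sup>2)\<^sup>2) (r\<^sup>2 *\<^sub>R y) z *
    gauss_density ((1 - r\<^sup>2) / (1 + r\<^sup>2)) ((r / (1 + r\<^sup>2)) *\<^sub>R (y + z)) x"
proof -
  have v: "1 - r\<^sup>2 > 0" using r by (simp add: abs_square_less_1)
  define w where "w = 1 + r\<^sup>2"
  define u where "u = 1 - r\<^sup>2"
  have w: "w > 0" "r\<^sup>2 = w - 1" by (auto simp: w_def add_pos_nonneg)
  have u: "u > 0" "1 - (r\<^sup>2)\<^sup>2 = u * w" using v by (auto simp: w_def u_def algebra_simps power2_eq_square)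
  have "w * ((norm (x - r *\<^sub>R y))\<^sup>2 + (norm (z - r *\<^sub>R x))\<^sup>2) =
     (norm (z - r\<^sup>2 *\<^sub>R y))\<^sup>2 + (norm (w *\<^sub>R x - r *\<^sub>R (y + z)))\<^sup>2"
    unfolding power2_norm_eq_inner w_def
    by (simp add: inner_diff_left inner_diff_right inner_add_left inner_add_right inner_commute
        algebra_simps power2_eq_square)
  also have "w *\<^sub>R x - r *\<^sub>R (y + z) = w *\<^sub>R (x - (r / w) *\<^sub>R (y + z))"
    using w by (simp add: scaleR_diff_right)
  finally have "w * ((norm (x - r *\<^sub>R y))\<^sup>2 + (norm (z - r *\<^sub>R x))\<^sup>2) =
     (norm (z - r\<^sup>2 *\<^sub>R y))\<^sup>2 + w\<^sup>2 * (norm (x - (r / w) *\<^sub>R (y + z)))\<^sup>2"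
    by (simp add: power_mult_distrib)
  moreover have "- A / (2 * u) + - B / (2 * u) = - C / (2 * (u * w)) + - D / (2 * (u / w))"
    if "w * (A + B) = C + w\<^sup>2 * D" for A B C D
  proof -
    have "- A / (2 * u) + - B / (2 * u) = - (w * (A + B)) / (2 * (u * w))"
      using w u by (simp add: field_simps)
    also have "\<dots> = - C / (2 * (u * w)) + - D / (2 * (u / w))"
      unfolding that using w u by (simp add: field_simps power2_eq_square)
    finally show ?thesis .
  qed
  ultimately have "- (norm (x - r *\<^sub>R y))\<^sup>2 / (2 * u) + - (norm (z - r *\<^sub>R x))\<^sup>2 / (2 * u) =
     - (norm (z - r\<^sup>2 *\<^sub>R y))\<^sup>2 / (2 * (u * w)) + - (norm (x - (r / w) *\<^sub>R (y + z)))\<^sup>2 / (2 * (u / w))"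
    by blast
  then have e: "exp (- (norm (x - r *\<^sub>R y))\<^sup>2 / (2 * u)) * exp (- (norm (z - r *\<^sub>R x))\<^sup>2 / (2 * u)) =
     exp (- (norm (z - r\<^sup>2 *\<^sub>R y))\<^sup>2 / (2 * (u * w))) * exp (- (norm (x - (r / w) *\<^sub>R (y + z)))\<^sup>2 / (2 * (u / w)))"
    by (simp only: exp_add[symmetric])
  \<comment> \<open>The normalising constants agree because
    \<open>u * u = (u * w) * (u / w)\<close>.\<close>
  have "2 * pi * \<bar>u\<bar> * (2 * pi * \<bar>u\<bar>) = 2 * pi * \<bar>u * w\<bar> * (2 * pi * \<bar>u / w\<bar>)"
    using w u by simp
  then have "sqrt (2 * pi * \<bar>u\<bar>) * sqrt (2 * pi * \<bar>u\<bar>) = sqrt (2 * pi * \<bar>u * w\<bar>) * sqrt (2 * pi * \<bar>u / w\<bar>)"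
    by (simp only: real_sqrt_mult[symmetric])
  then have c: "sqrt (2 * pi * \<bar>u\<bar>) ^ DIM('a) * sqrt (2 * pi * \<bar>u\<bar>) ^ DIM('a) =
      sqrt (2 * pi * \<bar>u * w\<bar>) ^ DIM('a) * sqrt (2 * pi * \<bar>u / w\<bar>) ^ DIM('a)"
    by (simp only: power_mult_distrib[symmetric])
  show ?thesis
    unfolding gauss_density_def u(2) w_def[symmetric] u_def[symmetric] times_divide_times_eq e c ..
qed

lemma gauss_density_chapman_kolmogorov:
  assumes r: "\<bar>r\<bar> < 1"
  shows "(\<integral>\<^sup>+x. ennreal (gauss_density (1 - r\<^sup>2) (r *\<^sub>R y) x * gauss_density (1 - r\<^sup>2) (r *\<^sub>R x) z) \<partial>lborel)
    = ennreal (gauss_density (1 - (r\<^sup>2)\<^sup>2) (r\<^sup>2 *\<^sub>R y) z)"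
proof -
  have "(1 - r\<^sup>2) / (1 + r\<^sup>2) > 0"
    using r by (simp add: abs_square_less_1 add_pos_nonneg)
  then show ?thesis
    unfolding gauss_density_chapman_kolmogorov_pointwise[OF r]
    by (simp add: ennreal_mult' nn_integral_cmult nn_integral_gauss_density)
qed

lemma nn_integral_mehler:
  assumes "\<bar>r\<bar> < 1"
  shows "(\<integral>\<^sup>+y. ennreal (mehler r x y) \<partial>lborel) = ennreal (gauss_density 1 0 x)"
proof -
  have "1 - r\<^sup>2 > 0" using assms by (simp add: abs_square_less_1)
  then show ?thesis
    by (simp add: mehler_def ennreal_mult' nn_integral_cmult nn_integral_gauss_density)
qed

section \<open>Mehler operators on the Gaussian L2 space\<close>

definition gauss_L2 :: "('a::euclidean_space \<Rightarrow> real) \<Rightarrow> bool" where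
  "gauss_L2 f \<longleftrightarrow> f \<in> borel_measurable borel \<and> integrable lborel (\<lambda>x. (f x)\<^sup>2 * gauss_density 1 0 x)"

definition gauss_norm2 :: "('a::euclidean_space \<Rightarrow> real) \<Rightarrow> real" where
  "gauss_norm2 f = (\<integral>x. (f x)\<^sup>2 * gauss_density 1 0 x \<partial>lborel)"

text \<open>The Gaussian inner product of \<open>f\<close> with \<open>mehler_op r g\<close>, kept
  as a double integral: the jump term can then be expanded pointwise against the same symmetric
  kernel.\<close>

definition mehler_form :: "real \<Rightarrow> ('a::euclidean_space \<Rightarrow> real) \<Rightarrow> ('a \<Rightarrow> real) \<Rightarrow> real" where
  "mehler_form r f g = (\<integral>z. f (fst z) * g (snd z) * mehler r (fst z) (snd z) \<partial>(lborel \<Otimes>\<^sub>M lborel))"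

text \<open>The conditional expectation of \<open>f\<close> at the second of two standard Gaussian
  vectors with correlation \<open>r\<close>, given that the first is \<open>x\<close>. For
  \<open>r = exp (- s)\<close> this is the Ornstein-Uhlenbeck semigroup at time
  \<open>s\<close>.\<close>

definition mehler_op :: "real \<Rightarrow> ('a::euclidean_space \<Rightarrow> real) \<Rightarrow> 'a \<Rightarrow> real" where
  "mehler_op r f x = (\<integral>y. f y * gauss_density (1 - r\<^sup>2) (r *\<^sub>R x) y \<partial>lborel)"

text \<open>Integrating out the second variable leaves the standard Gaussian weight, the marginal of
  \<open>mehler r\<close>.\<close>

lemma integrable_mehler_fst:
  fixes h :: "'a::euclidean_space \<Rightarrow> real"
  assumes r: "\<bar>r\<bar> < 1" and [measurable]: "h \<in> borel_measurable borel"
    and h: "integrable lborel (\<lambda>x. h x * gauss_density 1 0 x)"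
  shows "integrable (lborel \<Otimes>\<^sub>M lborel) (\<lambda>z. h (fst z) * mehler r (fst z) (snd z))"
proof (rule integrableI_bounded)
  have "(\<integral>\<^sup>+z. ennreal (norm (h (fst z) * mehler r (fst z) (snd z))) \<partial>(lborel \<Otimes>\<^sub>M lborel)) =
     (\<integral>\<^sup>+x. (\<integral>\<^sup>+y. ennreal \<bar>h x\<bar> * ennreal (mehler r x y) \<partial>lborel) \<partial>lborel)"
    by (subst lborel.nn_integral_fst[symmetric]) (auto simp: abs_mult ennreal_mult')
  also have "\<dots> = (\<integral>\<^sup>+x. ennreal (norm (h x * gauss_density 1 0 x)) \<partial>lborel)"
    by (simp add: nn_integral_cmult nn_integral_mehler[OF r] abs_mult ennreal_mult')
  also have "\<dots> < \<infinity>" using h by (simp add: integrable_iff_bounded)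
  finally show "(\<integral>\<^sup>+z. ennreal (norm (h (fst z) * mehler r (fst z) (snd z))) \<partial>(lborel \<Otimes>\<^sub>M lborel)) < \<infinity>" .
qed simp

lemma integrable_mehler_snd:
  fixes h :: "'a::euclidean_space \<Rightarrow> real"
  assumes r: "\<bar>r\<bar> < 1" and "h \<in> borel_measurable borel"
    and h: "integrable lborel (\<lambda>x. h x * gauss_density 1 0 x)"
  shows "integrable (lborel \<Otimes>\<^sub>M lborel) (\<lambda>z. h (snd z) * mehler r (fst z) (snd z))"
  using lborel_pair.integrable_product_swap[OF integrable_mehler_fst[OF assms]]
  by (simp add: case_prod_unfold mehler_commute[OF r])

lemma integrable_mehler_form:
  fixes f g :: "'a::euclidean_space \<Rightarrow> real"
  assumes r: "\<bar>r\<bar> < 1" and f: "gauss_L2 f" and g: "gauss_L2 g"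
  shows "integrable (lborel \<Otimes>\<^sub>M lborel) (\<lambda>z. f (fst z) * g (snd z) * mehler r (fst z) (snd z))"
proof (rule Bochner_Integration.integrable_bound)
  have [measurable]: "f \<in> borel_measurable borel" "g \<in> borel_measurable borel" using f g by (auto simp: gauss_L2_def)
  show "integrable (lborel \<Otimes>\<^sub>M lborel) (\<lambda>z. (f (fst z))\<^sup>2 * mehler r (fst z) (snd z) + (g (snd z))\<^sup>2 * mehler r (fst z) (snd z))"
    using f g by (intro Bochner_Integration.integrable_add integrable_mehler_fst[OF r] integrable_mehler_snd[OF r]) (auto simp: gauss_L2_def)
  show "(\<lambda>z. f (fst z) * g (snd z) * mehler r (fst z) (snd z)) \<in> borel_measurable (lborel \<Otimes>\<^sub>M lborel)"
    by measurable
  have "\<bar>f x * g y\<bar> \<le> (f x)\<^sup>2 + (g y)\<^sup>2" for x y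
  proof -
    have "2 * \<bar>f x * g y\<bar> \<le> (f x)\<^sup>2 + (g y)\<^sup>2"
      using sum_squares_bound[of "\<bar>f x\<bar>" "\<bar>g y\<bar>"] by (simp add: abs_mult)
    then show ?thesis using abs_ge_zero[of "f x * g y"] by linarith
  qed
  then have "\<bar>f x * g y\<bar> * mehler r x y \<le> ((f x)\<^sup>2 + (g y)\<^sup>2) * mehler r x y" for x y
    by (rule mult_right_mono) simp
  then show "AE z in lborel \<Otimes>\<^sub>M lborel. norm (f (fst z) * g (snd z) * mehler r (fst z) (snd z)) \<le>
      norm ((f (fst z))\<^sup>2 * mehler r (fst z) (snd z) + (g (snd z))\<^sup>2 * mehler r (fst z) (snd z))"
    by (intro always_eventually allI) (simp add: abs_mult distrib_right)
qed

lemma mehler_form_eq_op: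
  assumes r: "\<bar>r\<bar> < 1" and f: "gauss_L2 f" and g: "gauss_L2 g"
  shows "integrable lborel (\<lambda>x. f x * mehler_op r g x * gauss_density 1 0 x)"
    and "mehler_form r f g = (\<integral>x. f x * mehler_op r g x * gauss_density 1 0 x \<partial>lborel)"
proof -
  note int = integrable_mehler_form[OF assms]
  have *: "(\<integral>y. f x * g y * mehler r x y \<partial>lborel) = f x * mehler_op r g x * gauss_density 1 0 x" for x
  proof -
    have "(\<integral>y. f x * g y * mehler r x y \<partial>lborel) =
        (\<integral>y. (f x * gauss_density 1 0 x) * (g y * gauss_density (1 - r\<^sup>2) (r *\<^sub>R x) y) \<partial>lborel)"
      by (intro Bochner_Integration.integral_cong) (simp_all add: mehler_def)
    also have "\<dots> = f x * gauss_density 1 0 x * mehler_op r g x"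
      unfolding integral_mult_right_zero mehler_op_def ..
    finally show ?thesis by simp
  qed
  show "integrable lborel (\<lambda>x. f x * mehler_op r g x * gauss_density 1 0 x)"
    using lborel_pair.integrable_fst'[OF int] by (simp add: *)
  show "mehler_form r f g = (\<integral>x. f x * mehler_op r g x * gauss_density 1 0 x \<partial>lborel)"
    unfolding mehler_form_def using lborel_pair.integral_fst'[OF int] by (simp add: *)
qed

text \<open>Symmetry and the semigroup law in one. In a triple integral over \<open>y\<close>,
  \<open>z\<close> and a common middle point \<open>x\<close>, integrating \<open>x\<close> first
  gives the form at \<open>r\<^sup>2\<close>, integrating \<open>y\<close> and \<open>z\<close>
  first gives the square.\<close>

lemma gauss_norm2_mehler_op:
  fixes f :: "'a::euclidean_space \<Rightarrow> real"
  assumes r: "\<bar>r\<bar> < 1" and f: "gauss_L2 f"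
  shows "integrable lborel (\<lambda>x. (mehler_op r f x)\<^sup>2 * gauss_density 1 0 x)"
    and "(\<integral>x. (mehler_op r f x)\<^sup>2 * gauss_density 1 0 x \<partial>lborel) = mehler_form (r\<^sup>2) f f"
proof -
  have [measurable]: "f \<in> borel_measurable borel" using f by (auto simp: gauss_L2_def)
  have r2: "\<bar>r\<^sup>2\<bar> < 1" using r by (simp add: abs_square_less_1)
  let ?N = "\<lambda>x. gauss_density (1 - r\<^sup>2) (r *\<^sub>R x)"
  define G where "G = (\<lambda>(w :: 'a \<times> 'a, x). f (fst w) * f (snd w) * (gauss_density 1 0 x * ?N x (fst w) * ?N x (snd w)))"
  interpret P: pair_sigma_finite "lborel \<Otimes>\<^sub>M lborel :: ('a \<times> 'a) measure" "lborel :: 'a measure"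
    by (intro pair_sigma_finite.intro lborel_pair.sigma_finite_measure_axioms lborel.sigma_finite_measure_axioms)
  have G_meas [measurable]: "G \<in> borel_measurable ((lborel \<Otimes>\<^sub>M lborel) \<Otimes>\<^sub>M lborel)"
    unfolding G_def by measurable
  \<comment> \<open>Symmetry turns the weight at the middle point into a step starting at
    \<open>y\<close>, which Chapman-Kolmogorov can compose with the step to
    \<open>z\<close>.\<close>
  have K: "gauss_density 1 0 x * ?N x y * ?N x z = gauss_density 1 0 y * (?N y x * ?N x z)" for x y z
    using mehler_commute[OF r, of x y] by (simp add: mehler_def)
  have v: "1 - r\<^sup>2 > 0" using r by (simp add: abs_square_less_1)
  have nnK: "(\<integral>\<^sup>+x. ennreal (gauss_density 1 0 x * ?N x y * ?N x z) \<partial>lborel) = ennreal (mehler (r\<^sup>2) y z)" for y z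
    unfolding K using gauss_density_chapman_kolmogorov[OF r, of y z]
    by (subst ennreal_mult') (simp_all add: nn_integral_cmult mehler_def ennreal_mult')
  have hK: "has_bochner_integral lborel (\<lambda>x. gauss_density 1 0 x * ?N x y * ?N x z) (mehler (r\<^sup>2) y z)" for y z
    by (rule has_bochner_integral_nn_integral) (auto simp: nnK)
  have "(\<integral>\<^sup>+u. ennreal (norm (G u)) \<partial>((lborel \<Otimes>\<^sub>M lborel) \<Otimes>\<^sub>M lborel)) =
    (\<integral>\<^sup>+w. (\<integral>\<^sup>+x. ennreal \<bar>f (fst w) * f (snd w)\<bar> * ennreal (gauss_density 1 0 x * ?N x (fst w) * ?N x (snd w)) \<partial>lborel) \<partial>(lborel \<Otimes>\<^sub>M lborel))"
    by (subst lborel.nn_integral_fst[symmetric]) (auto simp: G_def abs_mult ennreal_mult' mult.assoc)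
  also have "\<dots> = (\<integral>\<^sup>+w. ennreal (norm (f (fst w) * f (snd w) * mehler (r\<^sup>2) (fst w) (snd w))) \<partial>(lborel \<Otimes>\<^sub>M lborel))"
  proof (rule nn_integral_cong)
    fix w :: "'a \<times> 'a"
    have "(\<integral>\<^sup>+x. ennreal \<bar>f (fst w) * f (snd w)\<bar> * ennreal (gauss_density 1 0 x * ?N x (fst w) * ?N x (snd w)) \<partial>lborel) =
        ennreal \<bar>f (fst w) * f (snd w)\<bar> * ennreal (mehler (r\<^sup>2) (fst w) (snd w))"
      unfolding nnK[symmetric] by (rule nn_integral_cmult) measurable
    then show "(\<integral>\<^sup>+x. ennreal \<bar>f (fst w) * f (snd w)\<bar> * ennreal (gauss_density 1 0 x * ?N x (fst w) * ?N x (snd w)) \<partial>lborel) =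
        ennreal (norm (f (fst w) * f (snd w) * mehler (r\<^sup>2) (fst w) (snd w)))"
      by (simp add: ennreal_mult'[symmetric] abs_mult)
  qed
  also have "\<dots> < \<infinity>" using integrable_mehler_form[OF r2 f f] by (simp add: integrable_iff_bounded)
  finally have int: "integrable ((lborel \<Otimes>\<^sub>M lborel) \<Otimes>\<^sub>M lborel) G"
    by (intro integrableI_bounded G_meas)
  \<comment> \<open>Fubini grants integrability in \<open>w\<close> only for almost every
    \<open>x\<close>.\<close>
  have inner: "AE x in lborel. (\<integral>w. G (w, x) \<partial>(lborel \<Otimes>\<^sub>M lborel)) = (mehler_op r f x)\<^sup>2 * gauss_density 1 0 x"
    using P.AE_integrable_snd[of "\<lambda>w x. G (w, x)", simplified, OF int]
  proof eventually_elim
    fix x assume ix: "integrable (lborel \<Otimes>\<^sub>M lborel) (\<lambda>w. G (w, x))"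
    have "(\<integral>w. G (w, x) \<partial>(lborel \<Otimes>\<^sub>M lborel)) = (\<integral>y. \<integral>z. G ((y, z), x) \<partial>lborel \<partial>lborel)"
      using lborel_pair.integral_fst'[OF ix] by simp
    also have "\<dots> = (\<integral>y. \<integral>z. gauss_density 1 0 x * ((f y * ?N x y) * (f z * ?N x z)) \<partial>lborel \<partial>lborel)"
      by (simp add: G_def mult_ac)
    also have "\<dots> = (mehler_op r f x)\<^sup>2 * gauss_density 1 0 x"
      unfolding integral_mult_right_zero integral_mult_left_zero
      by (simp add: mehler_op_def power2_eq_square)
    finally show "(\<integral>w. G (w, x) \<partial>(lborel \<Otimes>\<^sub>M lborel)) = (mehler_op r f x)\<^sup>2 * gauss_density 1 0 x" .
  qed
  have [measurable]: "mehler_op r f \<in> borel_measurable borel"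
    unfolding mehler_op_def by measurable
  have "integrable lborel (\<lambda>x. \<integral>w. G (w, x) \<partial>(lborel \<Otimes>\<^sub>M lborel))"
    using P.integrable_snd[of "\<lambda>w x. G (w, x)"] int by (simp add: case_prod_unfold)
  then show "integrable lborel (\<lambda>x. (mehler_op r f x)\<^sup>2 * gauss_density 1 0 x)"
    by (rule integrable_cong_AE_imp) (use inner in auto)
  have "(\<integral>x. (mehler_op r f x)\<^sup>2 * gauss_density 1 0 x \<partial>lborel) = (\<integral>x. \<integral>w. G (w, x) \<partial>(lborel \<Otimes>\<^sub>M lborel) \<partial>lborel)"
    by (rule integral_cong_AE) (use inner in auto)
  also have "\<dots> = (\<integral>w. \<integral>x. G (w, x) \<partial>lborel \<partial>(lborel \<Otimes>\<^sub>M lborel))"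
    using P.Fubini_integral[of "\<lambda>w x. G (w, x)"] int by (simp add: case_prod_unfold)
  also have "\<dots> = mehler_form (r\<^sup>2) f f"
    unfolding mehler_form_def G_def prod.case integral_mult_right_zero has_bochner_integral_integral_eq[OF hK] ..
  finally show "(\<integral>x. (mehler_op r f x)\<^sup>2 * gauss_density 1 0 x \<partial>lborel) = mehler_form (r\<^sup>2) f f" .
qed

lemma discriminant_bound:
  fixes A B C :: real
  assumes "\<And>l. 0 \<le> B - 2 * l * A + l\<^sup>2 * C" and "C \<ge> 0"
  shows "A\<^sup>2 \<le> C * B"
proof (cases "C = 0")
  case True
  have "A = 0"
  proof (rule ccontr)
    assume "A \<noteq> 0"
    \<comment> \<open>For \<open>C = 0\<close> the quadratic is linear in \<open>l\<close>, and this
      \<open>l\<close> gives it the value \<open>-1\<close>.\<close>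
    then show False using assms(1)[of "(B + 1) / (2 * A)"] True by (simp add: field_simps)
  qed
  then show ?thesis using True by simp
next
  case False
  then have "0 \<le> C * (B - 2 * (A / C) * A + (A / C)\<^sup>2 * C)"
    using assms(1)[of "A / C"] assms(2) by (rule_tac mult_nonneg_nonneg)
  also have "\<dots> = C * B - A\<^sup>2" using False by (simp add: field_simps power2_eq_square)
  finally show ?thesis by simp
qed

lemma gauss_norm2_nonneg: "gauss_norm2 f \<ge> 0"
  unfolding gauss_norm2_def by (intro integral_nonneg_AE) auto

text \<open>Cauchy-Schwarz for \<open>f\<close> and \<open>mehler_op r f\<close>, the squared norm
  of the latter being the form at \<open>r\<^sup>2\<close>. This passage from \<open>r\<close> to
  \<open>r\<^sup>2\<close> drives the later iteration towards small parameters.\<close>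

lemma mehler_form_cauchy_schwarz:
  assumes r: "\<bar>r\<bar> < 1" and f: "gauss_L2 f"
  shows "(mehler_form r f f)\<^sup>2 \<le> gauss_norm2 f * mehler_form (r\<^sup>2) f f"
proof (rule discriminant_bound[OF _ gauss_norm2_nonneg])
  fix l :: real
  note i1 = gauss_norm2_mehler_op[OF assms] and i2 = mehler_form_eq_op[OF r f f]
  have i3: "integrable lborel (\<lambda>x. (f x)\<^sup>2 * gauss_density 1 0 x)" using f by (simp add: gauss_L2_def)
  have "0 \<le> (\<integral>x. (mehler_op r f x - l * f x)\<^sup>2 * gauss_density 1 0 x \<partial>lborel)"
    by (intro integral_nonneg_AE) auto
  also have "(\<lambda>x. (mehler_op r f x - l * f x)\<^sup>2 * gauss_density 1 0 x) =
     (\<lambda>x. (mehler_op r f x)\<^sup>2 * gauss_density 1 0 x - 2 * l * (f x * mehler_op r f x * gauss_density 1 0 x) + l\<^sup>2 * ((f x)\<^sup>2 * gauss_density 1 0 x))"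
    by (auto simp: power2_eq_square algebra_simps)
  also have "(\<integral>x. \<dots> x \<partial>lborel) = mehler_form (r\<^sup>2) f f - 2 * l * mehler_form r f f + l\<^sup>2 * gauss_norm2 f"
    using i1 i2 i3 by (simp add: gauss_norm2_def)
  finally show "0 \<le> mehler_form (r\<^sup>2) f f - 2 * l * mehler_form r f f + l\<^sup>2 * gauss_norm2 f" .
qed

subsection \<open>The spectral gap on the orthogonal complement of the polynomials\<close>

lemma power_le_fact_exp:
  fixes u :: real
  assumes "u \<ge> 0"
  shows "u ^ k \<le> fact k * exp u"
proof -
  have "(\<Sum>i\<in>{k}. u ^ i / fact i) \<le> (\<Sum>i. u ^ i / fact i)"
    using summable_exp[of u] assms by (intro sum_le_suminf) (auto simp: divide_inverse mult.commute)
  also have "\<dots> = exp u" by (simp add: exp_def divide_inverse mult.commute scaleR_conv_of_real)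
  finally show ?thesis by (simp add: field_simps)
qed

text \<open>The truncation keeps the terms of weight at most \<open>d\<close>, where \<open>A\<close> has weight \<open>1\<close> and \<open>B\<close> weight \<open>2\<close>;
  these are the powers of \<open>r\<close>.\<close>

lemma exp_quadratic_truncation:
  "\<exists>K\<ge>0. \<forall>A B r :: real. 0 < r \<longrightarrow> r \<le> 1/16 \<longrightarrow>
     \<bar>exp (r * A + r\<^sup>2 * B) -
      (\<Sum>k\<le>d. \<Sum>i | i \<le> k \<and> k + i \<le> d. of_nat (k choose i) * (r\<^sup>2 * B) ^ i * (r * A) ^ (k - i) / fact k)\<bar>
     \<le> K * r ^ (d + 1) * exp ((\<bar>A\<bar> + \<bar>B\<bar>) / 8)"
proof -
  \<comment> \<open>The first summand bounds the Taylor remainder of order \<open>d\<close>, the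
    second the discarded terms with \<open>k \<le> d\<close>. The \<open>16\<close> matches
    \<open>r \<le> 1/16\<close>, as powers of \<open>S\<close> are absorbed into
    \<open>exp (S / 16)\<close>; \<open>32\<close> also contains the row sum \<open>2 ^ k\<close> of
    the binomial coefficients.\<close>
  define K :: real where "K = fact (d + 1) * 16 ^ (d + 1) + (\<Sum>k\<le>d. 32 ^ k)"
  have "\<bar>exp (r * A + r\<^sup>2 * B) -
      (\<Sum>k\<le>d. \<Sum>i | i \<le> k \<and> k + i \<le> d. of_nat (k choose i) * (r\<^sup>2 * B) ^ i * (r * A) ^ (k - i) / fact k)\<bar>
     \<le> K * r ^ (d + 1) * exp ((\<bar>A\<bar> + \<bar>B\<bar>) / 8)" if r: "0 < r" "r \<le> 1/16" for A B r :: real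
  proof -
    define S where "S = \<bar>A\<bar> + \<bar>B\<bar>"
    define w where "w = r * A + r\<^sup>2 * B"
    define t where "t k i = of_nat (k choose i) * (r\<^sup>2 * B) ^ i * (r * A) ^ (k - i) / fact k" for k i
    have S0: "S \<ge> 0" by (simp add: S_def)
    have r2: "r\<^sup>2 \<le> r" using r by (simp add: power2_eq_square mult_left_le_one_le)
    have "\<bar>w\<bar> \<le> r * \<bar>A\<bar> + r\<^sup>2 * \<bar>B\<bar>" unfolding w_def using r by (simp add: abs_mult abs_triangle_ineq[THEN order_trans])
    also have "\<dots> \<le> r * S" using r2 by (simp add: S_def distrib_left mult_right_mono)
    finally have wS: "\<bar>w\<bar> \<le> r * S" .
    have "r * S \<le> (1/16) * S" using r S0 by (intro mult_right_mono) auto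
    then have rS: "r * S \<le> S / 16" by simp
    have pw: "S ^ k \<le> 16 ^ k * fact k * exp (S / 16)" for k
      using power_le_fact_exp[of "S / 16" k] S0 by (simp add: power_divide field_simps)
    have split: "w ^ k / fact k = (\<Sum>i | i \<le> k \<and> k + i \<le> d. t k i) + (\<Sum>i | i \<le> k \<and> \<not> k + i \<le> d. t k i)" for k
    proof -
      have "w ^ k / fact k = (\<Sum>i\<le>k. t k i)"
        unfolding w_def add.commute[of "r * A"] binomial_ring t_def sum_divide_distrib ..
      also have "{..k} = {i. i \<le> k \<and> k + i \<le> d} \<union> {i. i \<le> k \<and> \<not> k + i \<le> d}" by auto
      finally show ?thesis by (subst (asm) sum.union_disjoint) auto
    qed
    \<comment> \<open>Discarded terms carry \<open>r ^ (k + i)\<close> with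
      \<open>k + i \<ge> d + 1\<close>.\<close>
    have tb: "\<bar>t k i\<bar> \<le> r ^ (d + 1) * (of_nat (k choose i) * (S ^ k / fact k))" if "i \<le> k" "\<not> k + i \<le> d" for k i
    proof -
      have "\<bar>t k i\<bar> = of_nat (k choose i) * (r ^ (k + i) * (\<bar>B\<bar> ^ i * \<bar>A\<bar> ^ (k - i))) / fact k"
      proof -
        have "r ^ (k + i) = (r\<^sup>2) ^ i * r ^ (k - i)"
          using that by (simp add: power_mult[symmetric] power_add[symmetric] add.commute)
        then show ?thesis unfolding t_def using r
          by (simp add: abs_mult power_abs power_mult_distrib)
      qed
      also have "\<dots> \<le> of_nat (k choose i) * (r ^ (d + 1) * (S ^ i * S ^ (k - i))) / fact k"
        using r that S0 by (intro divide_right_mono mult_left_mono mult_mono power_decreasing power_mono) (auto simp: S_def)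
      also have "S ^ i * S ^ (k - i) = S ^ k" using that by (simp add: power_add[symmetric])
      finally show ?thesis by (simp add: mult_ac)
    qed
    have tail: "\<bar>\<Sum>i | i \<le> k \<and> \<not> k + i \<le> d. t k i\<bar> \<le> r ^ (d + 1) * (32 ^ k * exp (S / 8))" for k
    proof -
      have "\<bar>\<Sum>i | i \<le> k \<and> \<not> k + i \<le> d. t k i\<bar> \<le> (\<Sum>i | i \<le> k \<and> \<not> k + i \<le> d. r ^ (d + 1) * (of_nat (k choose i) * (S ^ k / fact k)))"
        by (rule order_trans[OF sum_abs sum_mono]) (use tb in auto)
      also have "\<dots> \<le> (\<Sum>i\<le>k. r ^ (d + 1) * (of_nat (k choose i) * (S ^ k / fact k)))"
        using r S0 by (intro sum_mono2) auto
      also have "\<dots> = r ^ (d + 1) * (2 ^ k * (S ^ k / fact k))"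
        using arg_cong[OF choose_row_sum[of k], of real]
        by (simp only: sum_distrib_left[symmetric] sum_distrib_right[symmetric] of_nat_sum of_nat_power of_nat_numeral)
      also have "\<dots> \<le> r ^ (d + 1) * (2 ^ k * (16 ^ k * exp (S / 16)))"
        using pw[of k] r by (intro mult_left_mono) (auto simp: field_simps)
      also have "\<dots> \<le> r ^ (d + 1) * (2 ^ k * (16 ^ k * exp (S / 8)))"
        using r S0 by (intro mult_left_mono) auto
      also have "2 ^ k * (16 ^ k * exp (S / 8)) = 32 ^ k * exp (S / 8)"
        by (simp add: power_mult_distrib[symmetric] mult.assoc[symmetric])
      finally show ?thesis .
    qed
    have main: "\<bar>exp w - (\<Sum>k\<le>d. w ^ k / fact k)\<bar> \<le> fact (d + 1) * 16 ^ (d + 1) * r ^ (d + 1) * exp (S / 8)"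
    proof -
      have "\<bar>exp w - (\<Sum>k\<le>d. w ^ k / fact k)\<bar> \<le> exp \<bar>w\<bar> * \<bar>w\<bar> ^ Suc d / fact d"
        using Taylor_exp_field[of w d] by simp
      also have "\<dots> \<le> exp \<bar>w\<bar> * \<bar>w\<bar> ^ Suc d / 1"
        by (intro divide_left_mono) auto
      also have "\<dots> \<le> exp (S / 16) * (r * S) ^ Suc d"
        using wS rS by (simp only: div_by_1) (intro mult_mono power_mono, auto)
      also have "\<dots> = exp (S / 16) * r ^ (d + 1) * S ^ (d + 1)" by (simp add: power_mult_distrib)
      also have "\<dots> \<le> exp (S / 16) * r ^ (d + 1) * (16 ^ (d + 1) * fact (d + 1) * exp (S / 16))"
        using r by (intro mult_left_mono pw) auto
      also have "\<dots> = fact (d + 1) * 16 ^ (d + 1) * r ^ (d + 1) * (exp (S / 16) * exp (S / 16))"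
        by (simp only: mult_ac)
      also have "exp (S / 16) * exp (S / 16) = exp (S / 8)" by (simp add: exp_add[symmetric])
      finally show ?thesis .
    qed
    have "(\<Sum>k\<le>d. w ^ k / fact k) = (\<Sum>k\<le>d. \<Sum>i | i \<le> k \<and> k + i \<le> d. t k i) + (\<Sum>k\<le>d. \<Sum>i | i \<le> k \<and> \<not> k + i \<le> d. t k i)"
      unfolding split sum.distrib ..
    then have "\<bar>exp w - (\<Sum>k\<le>d. \<Sum>i | i \<le> k \<and> k + i \<le> d. t k i)\<bar> \<le>
        \<bar>exp w - (\<Sum>k\<le>d. w ^ k / fact k)\<bar> + \<bar>\<Sum>k\<le>d. \<Sum>i | i \<le> k \<and> \<not> k + i \<le> d. t k i\<bar>" by linarith
    also have "\<bar>\<Sum>k\<le>d. \<Sum>i | i \<le> k \<and> \<not> k + i \<le> d. t k i\<bar> \<le> (\<Sum>k\<le>d. r ^ (d + 1) * (32 ^ k * exp (S / 8)))"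
      by (rule order_trans[OF sum_abs sum_mono]) (rule tail)
    also have "\<dots> = (\<Sum>k\<le>d. 32 ^ k) * r ^ (d + 1) * exp (S / 8)"
      by (simp add: sum_distrib_left sum_distrib_right mult_ac)
    also note main
    finally show ?thesis unfolding K_def S_def w_def t_def by (simp add: algebra_simps)
  qed
  moreover have "K \<ge> 0" by (auto simp: K_def intro!: add_nonneg_nonneg sum_nonneg)
  ultimately show ?thesis by blast
qed

section \<open>Decay of the Mehler form for small parameters\<close>

text \<open>\<open>b q\<close> is not a polynomial in general. This class contains it together with
  the polynomials, is closed under products, and has finite Gaussian integrals.\<close>

definition poly_growth :: "('a::euclidean_space \<Rightarrow> real) \<Rightarrow> bool" where
  "poly_growth f \<longleftrightarrow> f \<in> borel_measurable borel \<and> (\<exists>C N. C \<ge> 0 \<and> (\<forall>x. \<bar>f x\<bar> \<le> C * (1 + norm x) ^ N))"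

lemma poly_growth_mult:
  assumes "poly_growth f" "poly_growth g" shows "poly_growth (\<lambda>x. f x * g x)"
proof -
  obtain C N D M where *: "C \<ge> 0" "D \<ge> 0" "\<And>z. \<bar>f z\<bar> \<le> C * (1 + norm z) ^ N" "\<And>z. \<bar>g z\<bar> \<le> D * (1 + norm z) ^ M"
    using assms unfolding poly_growth_def by metis
  have "\<bar>f z * g z\<bar> \<le> (C * D) * (1 + norm z) ^ (N + M)" for z
  proof -
    have "\<bar>f z * g z\<bar> \<le> (C * (1 + norm z) ^ N) * (D * (1 + norm z) ^ M)"
      unfolding abs_mult using * by (intro mult_mono) auto
    then show ?thesis by (simp add: algebra_simps power_add)
  qed
  moreover have "(\<lambda>x. f x * g x) \<in> borel_measurable borel"
    using assms unfolding poly_growth_def by (intro borel_measurable_times) auto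
  moreover have "C * D \<ge> 0" using * by simp
  ultimately show ?thesis unfolding poly_growth_def by blast
qed

lemma poly_growth_bounded:
  assumes "f \<in> borel_measurable borel" "\<And>x. \<bar>f x\<bar> \<le> C" shows "poly_growth f"
proof -
  have "C \<ge> 0" using assms(2)[of undefined] by linarith
  then show ?thesis unfolding poly_growth_def using assms by (intro conjI exI[of _ C] exI[of _ 0]) auto
qed

lemma poly_growth_polynomial: "real_polynomial_function f \<Longrightarrow> poly_growth f"
  unfolding poly_growth_def using polynomial_function_growth
  by (auto intro!: borel_measurable_continuous_onI differentiable_imp_continuous_on
      differentiable_on_real_polynomial_function)

lemma poly_growth_power: "poly_growth f \<Longrightarrow> poly_growth (\<lambda>x. f x ^ k)"
proof (induction k)
  case 0 show ?case by (rule poly_growth_bounded[of _ 1]) auto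
next
  case (Suc k) then show ?case by (simp add: poly_growth_mult)
qed

lemma poly_growth_inner: "poly_growth (\<lambda>y. x \<bullet> y)"
  by (intro poly_growth_polynomial real_polynomial_function.intros(1) bounded_linear_inner_right)

lemma poly_growth_inner_self: "poly_growth (\<lambda>y. y \<bullet> y)"
  unfolding poly_growth_def
proof (intro conjI exI[of _ "1::real"] exI[of _ "2::nat"] allI)
  fix x :: 'a
  show "\<bar>x \<bullet> x\<bar> \<le> 1 * (1 + norm x)\<^sup>2"
    by (simp add: power2_norm_eq_inner[symmetric] power_mono)
qed auto

text \<open>Weight and density together leave the factor
  \<open>exp (- (norm x)\<^sup>2 / 4)\<close>. Half of the exponent pays for the polynomial growth,
  the other half is a Gaussian of variance \<open>4\<close>.\<close>

lemma integrable_poly_growth_exp: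
  fixes f :: "'a::euclidean_space \<Rightarrow> real"
  assumes f: "poly_growth f"
  shows "integrable lborel (\<lambda>x. f x * exp ((norm x)\<^sup>2 / 4) * gauss_density 1 0 x)"
proof -
  obtain C N where C: "C \<ge> 0" "\<And>x. \<bar>f x\<bar> \<le> C * (1 + norm x) ^ N" and [measurable]: "f \<in> borel_measurable borel"
    using f unfolding poly_growth_def by blast
  define K where "K = C * (fact N * exp 3) * (sqrt (2 * pi * 4) ^ DIM('a) / sqrt (2 * pi * 1) ^ DIM('a))"
  have "norm (f x * exp ((norm x)\<^sup>2 / 4) * gauss_density 1 0 x) \<le> norm (K * gauss_density 4 0 x)" for x
  proof -
    define t where "t = norm x"
    \<comment> \<open>This is \<open>(t - 4)\<^sup>2 \<ge> 0\<close>.\<close>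
    have "t \<le> 2 + t\<^sup>2 / 8" using sum_squares_bound[of t 4] by (simp add: power2_eq_square)
    then have "exp (1 + t) \<le> exp 3 * exp (t\<^sup>2 / 8)" by (simp add: exp_add[symmetric])
    moreover have "(1 + t) ^ N \<le> fact N * exp (1 + t)" by (rule power_le_fact_exp) (simp add: t_def)
    ultimately have "(1 + t) ^ N \<le> fact N * (exp 3 * exp (t\<^sup>2 / 8))"
      by (meson order_trans mult_left_mono fact_ge_zero)
    then have "C * (1 + t) ^ N \<le> C * (fact N * (exp 3 * exp (t\<^sup>2 / 8)))" by (intro mult_left_mono C)
    then have "\<bar>f x\<bar> \<le> C * (fact N * exp 3) * exp (t\<^sup>2 / 8)" using C(2)[of x] by (simp add: t_def mult.assoc)
    then have "\<bar>f x\<bar> * (exp (t\<^sup>2 / 4) * gauss_density 1 0 x) \<le> C * (fact N * exp 3) * exp (t\<^sup>2 / 8) * (exp (t\<^sup>2 / 4) * gauss_density 1 0 x)"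
      by (intro mult_right_mono) auto
    also have "\<dots> = K * gauss_density 4 0 x"
    proof -
      have "exp (t\<^sup>2 / 8) * (exp (t\<^sup>2 / 4) * exp (- t\<^sup>2 / 2)) = exp (- t\<^sup>2 / 8)"
        by (simp add: exp_add[symmetric])
      then show ?thesis unfolding K_def gauss_density_def t_def by simp
    qed
    finally show ?thesis unfolding real_norm_def abs_mult using C by (simp add: t_def mult.assoc K_def)
  qed
  then have "AE x in lborel. norm (f x * exp ((norm x)\<^sup>2 / 4) * gauss_density 1 0 x) \<le> norm (K * gauss_density 4 0 x)"
    by simp
  moreover have "(\<lambda>x. f x * exp ((norm x)\<^sup>2 / 4) * gauss_density 1 0 x) \<in> borel_measurable lborel"
    by measurable
  moreover have "integrable lborel (\<lambda>x::'a. K * gauss_density 4 0 x)"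
    by (intro integrable_mult_right integrable_gauss_density) simp
  ultimately show ?thesis using Bochner_Integration.integrable_bound by blast
qed

lemma integrable_poly_growth:
  fixes f :: "'a::euclidean_space \<Rightarrow> real"
  assumes f: "poly_growth f"
  shows "integrable lborel (\<lambda>x. f x * gauss_density 1 0 x)"
proof (rule Bochner_Integration.integrable_bound[OF integrable_poly_growth_exp[OF f]])
  have [measurable]: "f \<in> borel_measurable borel" using f unfolding poly_growth_def by blast
  show "(\<lambda>x. f x * gauss_density 1 0 x) \<in> borel_measurable lborel" by measurable
  have "\<bar>f x\<bar> * 1 * gauss_density 1 0 x \<le> \<bar>f x\<bar> * exp ((norm x)\<^sup>2 / 4) * gauss_density 1 0 x" for x
    by (intro mult_right_mono mult_left_mono) auto
  then show "AE x in lborel. norm (f x * gauss_density 1 0 x) \<le> norm (f x * exp ((norm x)\<^sup>2 / 4) * gauss_density 1 0 x)"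
    by (simp add: abs_mult)
qed

lemma gauss_L2_poly_growth: "poly_growth f \<Longrightarrow> gauss_L2 f"
  using integrable_poly_growth[OF poly_growth_power[of f 2]] by (simp add: gauss_L2_def poly_growth_def)

text \<open>Isolates \<open>y\<close> and explicit powers of \<open>r\<close>. The factors
  \<open>c = 1 / (1 - r\<^sup>2)\<close> and \<open>k\<close> vary with \<open>r\<close> and
  \<open>x\<close> but stay in fixed ranges, so the exponential can be expanded in the displayed
  \<open>r\<close> with \<open>c\<close> treated as a constant.\<close>

lemma mehler_expand:
  fixes x y :: "'a::euclidean_space"
  assumes r: "0 < r" "r \<le> 1/16"
  shows "\<exists>c k. 1 \<le> c \<and> c \<le> 2 \<and> 0 \<le> k \<and> k \<le> 2 ^ DIM('a) \<and>
    (\<forall>y. mehler r x y = k * gauss_density 1 0 x * gauss_density 1 0 y *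
       exp (r * (c * (x \<bullet> y)) + r\<^sup>2 * (- c * (y \<bullet> y) / 2)))"
proof -
  define v where "v = 1 - r\<^sup>2"
  have "r\<^sup>2 \<le> (1/16)\<^sup>2" using r by (intro power_mono) auto
  then have v: "v \<ge> 1/2" "v \<le> 1" "r\<^sup>2 = 1 - v" by (auto simp: v_def power2_eq_square)
  define k where "k = exp (- (r\<^sup>2 * (norm x)\<^sup>2 / (2 * v))) / sqrt v ^ DIM('a)"
  have "mehler r x y = k * gauss_density 1 0 x * gauss_density 1 0 y *
       exp (r * (1 / v * (x \<bullet> y)) + r\<^sup>2 * (- (1 / v) * (y \<bullet> y) / 2))" for y
  proof -
    have "- (norm x)\<^sup>2 / 2 + - (norm (y - r *\<^sub>R x))\<^sup>2 / (2 * v) =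
      - (r\<^sup>2 * (norm x)\<^sup>2 / (2 * v)) + - (norm x)\<^sup>2 / 2 + - (norm y)\<^sup>2 / 2 +
        (r * (1 / v * (x \<bullet> y)) + r\<^sup>2 * (- (1 / v) * (y \<bullet> y) / 2))"
    proof -
      have e: "(norm (y - r *\<^sub>R x))\<^sup>2 = y \<bullet> y - 2 * r * (x \<bullet> y) + r\<^sup>2 * (x \<bullet> x)"
        unfolding power2_norm_eq_inner by (simp add: inner_diff_left inner_diff_right inner_commute power2_eq_square)
      show ?thesis unfolding e unfolding power2_norm_eq_inner v(3) using v(1)
        by (simp add: field_simps)
    qed
    then have e: "exp (- (norm x)\<^sup>2 / 2) * exp (- (norm (y - r *\<^sub>R x))\<^sup>2 / (2 * v)) =
      exp (- (r\<^sup>2 * (norm x)\<^sup>2 / (2 * v))) * exp (- (norm x)\<^sup>2 / 2) * exp (- (norm y)\<^sup>2 / 2) *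
        exp (r * (1 / v * (x \<bullet> y)) + r\<^sup>2 * (- (1 / v) * (y \<bullet> y) / 2))"
      by (simp only: exp_add[symmetric])
    have "sqrt (2 * pi * \<bar>v\<bar>) ^ DIM('a) = sqrt (2 * pi * \<bar>1\<bar>) ^ DIM('a) * sqrt v ^ DIM('a)"
      using v by (simp add: real_sqrt_mult power_mult_distrib)
    then show ?thesis
      unfolding mehler_def gauss_density_def v_def[symmetric] k_def using e by (simp add: mult_ac)
  qed
  moreover have "1 \<le> 1 / v" "1 / v \<le> 2" using v by (auto simp: field_simps)
  moreover have "0 \<le> k" "k \<le> 2 ^ DIM('a)"
  proof -
    have "sqrt v \<ge> 1/2" using v by (intro real_le_rsqrt) (auto simp: power2_eq_square)
    then have "(1/2) ^ DIM('a) \<le> sqrt v ^ DIM('a)" by (intro power_mono) auto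
    moreover have "0 < sqrt v ^ DIM('a)" using v by simp
    moreover have "exp (- (r\<^sup>2 * (norm x)\<^sup>2 / (2 * v))) \<le> 1" using v by simp
    ultimately have "k \<le> 1 / (1/2) ^ DIM('a)" unfolding k_def by (intro frac_le) auto
    then show "k \<le> 2 ^ DIM('a)" by (simp add: power_divide)
    show "0 \<le> k" using v by (simp add: k_def)
  qed
  ultimately show ?thesis by blast
qed

text \<open>At fixed \<open>x\<close> the kept terms of the kernel expansion are multiples of
  \<open>(x \<bullet> y) ^ i * (y \<bullet> y) ^ j\<close> with \<open>i + 2 * j \<le> d\<close>;
  they integrate to zero against \<open>f\<close>, and only the remainder of order
  \<open>r ^ (d + 1)\<close> survives.\<close>

lemma mehler_op_decay:
  fixes f :: "'a::euclidean_space \<Rightarrow> real"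
  assumes f: "poly_growth f"
    and orth: "\<And>x i j. i + 2 * j \<le> d \<Longrightarrow> (\<integral>y. f y * ((x \<bullet> y) ^ i * (y \<bullet> y) ^ j) * gauss_density 1 0 y \<partial>lborel) = 0"
  shows "\<exists>K\<ge>0. \<forall>r x. 0 < r \<longrightarrow> r \<le> 1/16 \<longrightarrow>
    \<bar>mehler_op r f x * gauss_density 1 0 x\<bar> \<le> K * r ^ (d + 1) * (exp ((norm x)\<^sup>2 / 4) * gauss_density 1 0 x)"
proof -
  obtain K where K: "K \<ge> 0" and trunc: "\<And>A B r :: real. 0 < r \<Longrightarrow> r \<le> 1/16 \<Longrightarrow>
     \<bar>exp (r * A + r\<^sup>2 * B) -
      (\<Sum>k\<le>d. \<Sum>i | i \<le> k \<and> k + i \<le> d. of_nat (k choose i) * (r\<^sup>2 * B) ^ i * (r * A) ^ (k - i) / fact k)\<bar>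
     \<le> K * r ^ (d + 1) * exp ((\<bar>A\<bar> + \<bar>B\<bar>) / 8)"
    using exp_quadratic_truncation[of d] by blast
  define I where "I = (\<integral>y. \<bar>f y\<bar> * exp ((norm y)\<^sup>2 / 4) * gauss_density 1 0 y \<partial>lborel)"
  have fm [measurable]: "f \<in> borel_measurable borel" using f by (simp add: poly_growth_def)
  have iI: "integrable lborel (\<lambda>y. \<bar>f y\<bar> * exp ((norm y)\<^sup>2 / 4) * gauss_density 1 0 y)"
    using integrable_poly_growth_exp[OF f, THEN integrable_abs] by (simp add: abs_mult)
  have I0: "I \<ge> 0" unfolding I_def by (intro integral_nonneg_AE) auto
  have "\<bar>mehler_op r f x * gauss_density 1 0 x\<bar> \<le> 2 ^ DIM('a) * K * I * r ^ (d + 1) * (exp ((norm x)\<^sup>2 / 4) * gauss_density 1 0 x)"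
    if r: "0 < r" "r \<le> 1/16" for r and x :: 'a
  proof -
    obtain c k where c: "1 \<le> c" "c \<le> 2" and k: "0 \<le> k" "k \<le> 2 ^ DIM('a)" and
      expand: "\<And>y. mehler r x y = k * gauss_density 1 0 x * gauss_density 1 0 y *
       exp (r * (c * (x \<bullet> y)) + r\<^sup>2 * (- c * (y \<bullet> y) / 2))"
      using mehler_expand[OF r, of x] by blast
    define E where "E y = exp (r * (c * (x \<bullet> y)) + r\<^sup>2 * (- c * (y \<bullet> y) / 2))" for y
    define P where "P y = (\<Sum>k\<le>d. \<Sum>i | i \<le> k \<and> k + i \<le> d.
        of_nat (k choose i) * (r\<^sup>2 * (- c * (y \<bullet> y) / 2)) ^ i * (r * (c * (x \<bullet> y))) ^ (k - i) / fact k)" for y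
    define a where "a k i = of_nat (k choose i) * (r\<^sup>2 * (- c / 2)) ^ i * (r * c) ^ (k - i) / fact k" for k i
    have P_eq: "f y * P y * gauss_density 1 0 y = (\<Sum>k\<le>d. \<Sum>i | i \<le> k \<and> k + i \<le> d.
        a k i * (f y * ((x \<bullet> y) ^ (k - i) * (y \<bullet> y) ^ i) * gauss_density 1 0 y))" for y
      unfolding P_def sum_distrib_left sum_distrib_right a_def
      by (intro sum.cong refl) (simp add: power_mult_distrib power_divide power_minus' mult_ac)
    have iM: "integrable lborel (\<lambda>y. f y * ((x \<bullet> y) ^ i * (y \<bullet> y) ^ j) * gauss_density 1 0 y)" for i j
      by (intro integrable_poly_growth poly_growth_mult poly_growth_power poly_growth_inner poly_growth_inner_self f)
    have iP: "integrable lborel (\<lambda>y. f y * P y * gauss_density 1 0 y)"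
      unfolding P_eq by (intro Bochner_Integration.integrable_sum integrable_mult_right iM)
    have P0: "(\<integral>y. f y * P y * gauss_density 1 0 y \<partial>lborel) = 0"
      unfolding P_eq
      by (subst Bochner_Integration.integral_sum, intro Bochner_Integration.integrable_sum integrable_mult_right iM,
          subst Bochner_Integration.integral_sum, intro integrable_mult_right iM)
        (auto simp: orth intro!: sum.neutral)
    have bound: "\<bar>f y * (E y - P y) * gauss_density 1 0 y\<bar> \<le>
        K * r ^ (d + 1) * exp ((norm x)\<^sup>2 / 4) * (\<bar>f y\<bar> * exp ((norm y)\<^sup>2 / 4) * gauss_density 1 0 y)" for y
    proof -
      have "\<bar>c * (x \<bullet> y)\<bar> \<le> 2 * (norm x * norm y)"
        using c Cauchy_Schwarz_ineq2[of x y] by (auto simp: abs_mult intro!: mult_mono)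
      also have "\<dots> \<le> (norm x)\<^sup>2 + (norm y)\<^sup>2" using sum_squares_bound[of "norm x" "norm y"] by simp
      finally have 1: "\<bar>c * (x \<bullet> y)\<bar> \<le> (norm x)\<^sup>2 + (norm y)\<^sup>2" .
      have 2: "\<bar>- c * (y \<bullet> y) / 2\<bar> \<le> (norm y)\<^sup>2"
        using c mult_right_mono[OF c(2), of "y \<bullet> y"] by (simp add: abs_mult power2_norm_eq_inner mult.commute)
      \<comment> \<open>The exponents \<open>1/4\<close> are the ones that
        \<open>integrable_poly_growth_exp\<close> can absorb, in \<open>y\<close> now and in
        \<open>x\<close> when the form is integrated.\<close>
      have "(\<bar>c * (x \<bullet> y)\<bar> + \<bar>- c * (y \<bullet> y) / 2\<bar>) / 8 \<le> (norm x)\<^sup>2 / 4 + (norm y)\<^sup>2 / 4"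
      proof -
        have "(u + v) / 8 \<le> X / 4 + Y / 4" if "u \<le> X + Y" "v \<le> Y" "0 \<le> X" for u v X Y :: real
          using that by (simp add: field_simps)
        from this[OF 1 2 zero_le_power2] show ?thesis .
      qed
      then have "\<bar>E y - P y\<bar> \<le> K * r ^ (d + 1) * exp ((norm x)\<^sup>2 / 4 + (norm y)\<^sup>2 / 4)"
        unfolding E_def P_def using r K
        by (intro order_trans[OF trunc[OF r]] mult_left_mono) auto
      then have "\<bar>E y - P y\<bar> * (\<bar>f y\<bar> * gauss_density 1 0 y) \<le>
          K * r ^ (d + 1) * exp ((norm x)\<^sup>2 / 4 + (norm y)\<^sup>2 / 4) * (\<bar>f y\<bar> * gauss_density 1 0 y)"
        by (intro mult_right_mono) auto
      then show ?thesis by (simp add: abs_mult exp_add mult_ac)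
    qed
    have iEP: "integrable lborel (\<lambda>y. f y * (E y - P y) * gauss_density 1 0 y)"
    proof (rule Bochner_Integration.integrable_bound)
      show "integrable lborel (\<lambda>y. K * r ^ (d + 1) * exp ((norm x)\<^sup>2 / 4) * (\<bar>f y\<bar> * exp ((norm y)\<^sup>2 / 4) * gauss_density 1 0 y))"
        by (intro integrable_mult_right iI)
      show "(\<lambda>y. f y * (E y - P y) * gauss_density 1 0 y) \<in> borel_measurable lborel"
        unfolding E_def P_def by measurable
      show "AE y in lborel. norm (f y * (E y - P y) * gauss_density 1 0 y) \<le>
         norm (K * r ^ (d + 1) * exp ((norm x)\<^sup>2 / 4) * (\<bar>f y\<bar> * exp ((norm y)\<^sup>2 / 4) * gauss_density 1 0 y))"
        unfolding real_norm_def by (intro always_eventually allI order_trans[OF bound abs_ge_self])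
    qed
    have "(\<integral>y. f y * E y * gauss_density 1 0 y \<partial>lborel) =
        (\<integral>y. f y * (E y - P y) * gauss_density 1 0 y + f y * P y * gauss_density 1 0 y \<partial>lborel)"
      by (simp add: algebra_simps)
    also have "\<dots> = (\<integral>y. f y * (E y - P y) * gauss_density 1 0 y \<partial>lborel)"
      using iEP iP P0 by simp
    also have "\<bar>\<dots>\<bar> \<le> (\<integral>y. K * r ^ (d + 1) * exp ((norm x)\<^sup>2 / 4) * (\<bar>f y\<bar> * exp ((norm y)\<^sup>2 / 4) * gauss_density 1 0 y) \<partial>lborel)"
      by (rule order_trans[OF integral_abs_bound integral_mono[OF integrable_abs[OF iEP] integrable_mult_right[OF iI] bound]])
    also have "\<dots> = K * r ^ (d + 1) * exp ((norm x)\<^sup>2 / 4) * I" by (simp add: I_def)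
    finally have main: "\<bar>\<integral>y. f y * E y * gauss_density 1 0 y \<partial>lborel\<bar> \<le> K * r ^ (d + 1) * exp ((norm x)\<^sup>2 / 4) * I" .
    have "mehler_op r f x * gauss_density 1 0 x = (\<integral>y. f y * mehler r x y \<partial>lborel)"
      unfolding mehler_op_def mehler_def integral_mult_left_zero[symmetric]
      by (intro Bochner_Integration.integral_cong) auto
    also have "\<dots> = (\<integral>y. (k * gauss_density 1 0 x) * (f y * E y * gauss_density 1 0 y) \<partial>lborel)"
      unfolding expand E_def by (intro Bochner_Integration.integral_cong) auto
    also have "\<dots> = k * gauss_density 1 0 x * (\<integral>y. f y * E y * gauss_density 1 0 y \<partial>lborel)"
      by (rule integral_mult_right_zero)
    finally have eq: "mehler_op r f x * gauss_density 1 0 x = k * gauss_density 1 0 x * (\<integral>y. f y * E y * gauss_density 1 0 y \<partial>lborel)" .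
    have "\<bar>mehler_op r f x * gauss_density 1 0 x\<bar> = k * gauss_density 1 0 x * \<bar>\<integral>y. f y * E y * gauss_density 1 0 y \<partial>lborel\<bar>"
      unfolding eq abs_mult using k by simp
    also have "\<dots> \<le> 2 ^ DIM('a) * gauss_density 1 0 x * (K * r ^ (d + 1) * exp ((norm x)\<^sup>2 / 4) * I)"
      using k by (intro mult_mono main) auto
    finally show ?thesis by (simp only: mult_ac)
  qed
  moreover have "0 \<le> 2 ^ DIM('a) * K * I" using K I0 by simp
  ultimately show ?thesis by blast
qed

lemma mehler_form_decay:
  fixes f :: "'a::euclidean_space \<Rightarrow> real"
  assumes f: "poly_growth f"
    and orth: "\<And>x i j. i + 2 * j \<le> d \<Longrightarrow> (\<integral>y. f y * ((x \<bullet> y) ^ i * (y \<bullet> y) ^ j) * gauss_density 1 0 y \<partial>lborel) = 0"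
  shows "\<exists>K\<ge>0. \<forall>r. 0 < r \<longrightarrow> r \<le> 1/16 \<longrightarrow> mehler_form r f f \<le> K * r ^ (d + 1)"
proof -
  obtain K where K: "K \<ge> 0" and op: "\<And>r x. 0 < r \<Longrightarrow> r \<le> 1/16 \<Longrightarrow>
    \<bar>mehler_op r f x * gauss_density 1 0 x\<bar> \<le> K * r ^ (d + 1) * (exp ((norm x)\<^sup>2 / 4) * gauss_density 1 0 x)"
    using mehler_op_decay[OF assms] by blast
  define I where "I = (\<integral>y. \<bar>f y\<bar> * exp ((norm y)\<^sup>2 / 4) * gauss_density 1 0 y \<partial>lborel)"
  have iI: "integrable lborel (\<lambda>y. \<bar>f y\<bar> * exp ((norm y)\<^sup>2 / 4) * gauss_density 1 0 y)"
    using integrable_poly_growth_exp[OF f, THEN integrable_abs] by (simp add: abs_mult)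
  have I0: "I \<ge> 0" unfolding I_def by (intro integral_nonneg_AE) auto
  have "mehler_form r f f \<le> K * I * r ^ (d + 1)" if r: "0 < r" "r \<le> 1/16" for r
  proof -
    have r1: "\<bar>r\<bar> < 1" using r by simp
    note i = mehler_form_eq_op[OF r1 gauss_L2_poly_growth[OF f] gauss_L2_poly_growth[OF f]]
    have "mehler_form r f f \<le> (\<integral>x. K * r ^ (d + 1) * (\<bar>f x\<bar> * exp ((norm x)\<^sup>2 / 4) * gauss_density 1 0 x) \<partial>lborel)"
      unfolding i(2)
    proof (rule integral_mono[OF i(1)])
      show "integrable lborel (\<lambda>x. K * r ^ (d + 1) * (\<bar>f x\<bar> * exp ((norm x)\<^sup>2 / 4) * gauss_density 1 0 x))"
        by (intro integrable_mult_right iI)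
      fix x :: 'a
      have "f x * (mehler_op r f x * gauss_density 1 0 x) \<le> \<bar>f x\<bar> * \<bar>mehler_op r f x * gauss_density 1 0 x\<bar>"
        by (metis abs_ge_self abs_mult)
      also have "\<dots> \<le> \<bar>f x\<bar> * (K * r ^ (d + 1) * (exp ((norm x)\<^sup>2 / 4) * gauss_density 1 0 x))"
        by (intro mult_left_mono op r) auto
      finally show "f x * mehler_op r f x * gauss_density 1 0 x \<le> K * r ^ (d + 1) * (\<bar>f x\<bar> * exp ((norm x)\<^sup>2 / 4) * gauss_density 1 0 x)"
        by (simp only: mult_ac)
    qed
    then show ?thesis unfolding integral_mult_right_zero I_def by (simp only: mult_ac)
  qed
  then show ?thesis using K I0 by (meson mult_nonneg_nonneg)
qed

text \<open>By Cauchy-Schwarz a failure of the gap at \<open>r\<close> is amplified at \<open>r\<^sup>2\<close>; iterating,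
  it contradicts the decay rate at \<open>0\<close>.\<close>

lemma mehler_form_iterate:
  assumes f: "gauss_L2 f" and r: "0 < r" "r < 1" and S: "gauss_norm2 f > 0"
    and big: "mehler_form r f f \<ge> a * r ^ m * gauss_norm2 f" "a \<ge> 0"
  shows "mehler_form (r ^ (2 ^ k)) f f \<ge> a ^ (2 ^ k) * (r ^ (2 ^ k)) ^ m * gauss_norm2 f"
proof (induction k)
  case (Suc k)
  define s where "s = r ^ (2 ^ k)"
  have s: "\<bar>s\<bar> < 1" "s \<ge> 0" using r by (auto simp: s_def power_less_one_iff)
  have "(a ^ (2 ^ k) * s ^ m * gauss_norm2 f)\<^sup>2 \<le> (mehler_form s f f)\<^sup>2"
    using Suc big S s unfolding s_def[symmetric] by (intro power_mono) auto
  also have "\<dots> \<le> gauss_norm2 f * mehler_form (s\<^sup>2) f f" by (rule mehler_form_cauchy_schwarz[OF s(1) f])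
  finally have le: "(a ^ (2 ^ k) * s ^ m * gauss_norm2 f)\<^sup>2 \<le> gauss_norm2 f * mehler_form (s\<^sup>2) f f" .
  have "gauss_norm2 f * (a ^ (2 ^ Suc k) * (s\<^sup>2) ^ m * gauss_norm2 f) \<le> gauss_norm2 f * mehler_form (s\<^sup>2) f f"
  proof -
    have "a ^ (2 ^ Suc k) = a ^ (2 ^ k) * a ^ (2 ^ k)" by (simp add: power_add[symmetric] mult_2)
    moreover have "(s\<^sup>2) ^ m = s ^ m * s ^ m" by (simp add: power2_eq_square power_mult_distrib)
    ultimately show ?thesis
      using le[unfolded power2_eq_square[of "a ^ (2 ^ k) * s ^ m * gauss_norm2 f"]] by (simp only: mult_ac)
  qed
  then have "a ^ (2 ^ Suc k) * (s\<^sup>2) ^ m * gauss_norm2 f \<le> mehler_form (s\<^sup>2) f f"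
    using S by (simp only: mult_le_cancel_left_pos)
  moreover have "s\<^sup>2 = r ^ (2 ^ Suc k)" by (simp add: s_def power_mult[symmetric] mult.commute)
  ultimately show ?case by simp
qed (use big in simp)

text \<open>If the form at \<open>r\<close> exceeded the bound by a factor \<open>a > 1\<close>, the
  form at \<open>r ^ (2 ^ k)\<close> would do so by at least \<open>a ^ (2 ^ k)\<close>, which
  eventually beats the fixed constant \<open>K\<close>.\<close>

lemma mehler_form_spectral_gap:
  assumes f: "gauss_L2 f" and r: "0 < r" "r < 1" and S: "gauss_norm2 f > 0"
    and decay: "\<And>r. 0 < r \<Longrightarrow> r \<le> 1/16 \<Longrightarrow> mehler_form r f f \<le> K * r ^ m"
  shows "mehler_form r f f \<le> r ^ m * gauss_norm2 f"
proof (rule ccontr)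
  assume neg: "\<not> ?thesis"
  define a where "a = mehler_form r f f / (r ^ m * gauss_norm2 f)"
  have pos: "r ^ m * gauss_norm2 f > 0" using r S by simp
  have a: "a > 1" using neg pos by (simp add: a_def)
  have "a * (r ^ m * gauss_norm2 f) = mehler_form r f f"
    unfolding a_def by (subst nonzero_eq_divide_eq[symmetric]) (use pos in linarith, rule refl)
  then have big: "mehler_form r f f \<ge> a * r ^ m * gauss_norm2 f" by (simp add: mult.assoc)
  have "(\<lambda>k. r ^ (2 ^ k)) \<longlonglongrightarrow> 0"
    using LIMSEQ_subseq_LIMSEQ[OF LIMSEQ_realpow_zero[of r], of "\<lambda>k. 2 ^ k"] r
    by (simp add: strict_mono_def o_def)
  then have "\<forall>\<^sub>F k in sequentially. r ^ (2 ^ k) < 1/16" by (rule order_tendstoD) simp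
  moreover obtain n where n: "K / gauss_norm2 f < a ^ n" using real_arch_pow[OF a] by blast
  have "K / gauss_norm2 f < a ^ (2 ^ k)" if "k \<ge> n" for k
  proof -
    have "n \<le> 2 ^ k" using that less_exp[of k] by linarith
    then have "a ^ n \<le> a ^ (2 ^ k)" using a by (intro power_increasing) auto
    then show ?thesis using n by linarith
  qed
  then have "\<forall>\<^sub>F k in sequentially. a ^ (2 ^ k) > K / gauss_norm2 f"
    by (auto simp: eventually_sequentially)
  ultimately have "\<forall>\<^sub>F k in sequentially. r ^ (2 ^ k) < 1/16 \<and> a ^ (2 ^ k) > K / gauss_norm2 f" by (rule eventually_conj)
  then obtain k where k: "r ^ (2 ^ k) < 1/16" "a ^ (2 ^ k) > K / gauss_norm2 f"
    by (auto dest: eventually_happens)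
  define s where "s = r ^ (2 ^ k)"
  have s: "s > 0" using r by (simp add: s_def)
  have "a ^ (2 ^ k) * s ^ m * gauss_norm2 f \<le> K * s ^ m"
    using mehler_form_iterate[OF f r S big, of k] decay[of s] a s k unfolding s_def by linarith
  then have "(a ^ (2 ^ k) * gauss_norm2 f) * s ^ m \<le> K * s ^ m" by (simp only: mult_ac)
  then have "a ^ (2 ^ k) * gauss_norm2 f \<le> K" using s by simp
  then show False using k(2) S by (simp add: field_simps)
qed

subsection \<open>Homogeneous caloric polynomials as eigenfunctions\<close>

lemma std_normal_moment_rec:
  "(\<integral>x. std_normal_density x * x ^ (k + 2) \<partial>lborel) = real (k + 1) * (\<integral>x. std_normal_density x * x ^ k \<partial>lborel)"
proof (cases "even k")
  case True
  then obtain j where k: "k = 2 * j" by blast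
  have "(fact (2 * (j + 1)) :: real) / (2 ^ (j + 1) * fact (j + 1)) = real (2 * j + 1) * (fact (2 * j) / (2 ^ j * fact j))"
    by (simp add: divide_simps)
  then show ?thesis
    using integral_std_normal_moment_even[of j] integral_std_normal_moment_even[of "j + 1"] by (simp add: k)
next
  case False
  then obtain j where k: "k = 2 * j + 1" using oddE by blast
  show ?thesis
    using integral_std_normal_moment_odd[of j] integral_std_normal_moment_odd[of "j + 1"] by (simp add: k)
qed

lemma integrable_std_normal_affine_power:
  "integrable lborel (\<lambda>z. std_normal_density z * (z ^ j * (m + s * z) ^ k))"
proof (induction k arbitrary: j)
  case 0 show ?case using integrable_std_normal_moment by simp
next
  case (Suc k)
  have "(\<lambda>z. std_normal_density z * (z ^ j * (m + s * z) ^ Suc k)) =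
     (\<lambda>z. m * (std_normal_density z * (z ^ j * (m + s * z) ^ k)) + s * (std_normal_density z * (z ^ Suc j * (m + s * z) ^ k)))"
    by (auto simp: algebra_simps)
  then show ?case using Suc by (simp del: power_Suc)
qed

text \<open>Both sides obey the heat polynomial recursion in \<open>k\<close>; on the Gaussian side
  it is Stein's identity (integration by parts) for \<open>(m + s * z) ^ k\<close>.\<close>

lemma std_normal_affine_power:
  "(\<integral>z. std_normal_density z * (m + s * z) ^ k \<partial>lborel) = heat_poly k m (s\<^sup>2 / 2)"
proof -
  \<comment> \<open>The index \<open>j\<close> is there because splitting off one factor
    \<open>m + s * z\<close> raises the power of \<open>z\<close>.\<close>
  define F where "F j k = (\<integral>z. std_normal_density z * (z ^ j * (m + s * z) ^ k) \<partial>lborel)" for j k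
  have F_Suc: "F j (Suc k) = m * F j k + s * F (Suc j) k" for j k
  proof -
    have "(\<lambda>z. std_normal_density z * (z ^ j * (m + s * z) ^ Suc k)) =
     (\<lambda>z. m * (std_normal_density z * (z ^ j * (m + s * z) ^ k)) + s * (std_normal_density z * (z ^ Suc j * (m + s * z) ^ k)))"
      by (auto simp: algebra_simps)
    then show ?thesis unfolding F_def using integrable_std_normal_affine_power
      by (simp del: power_Suc)
  qed
  \<comment> \<open>Stein's identity for \<open>z ^ j * (m + s * z) ^ k\<close>; at
    \<open>k = 0\<close> it is the recursion of the moments.\<close>
  have ibp: "F (Suc j) k = real j * F (j - 1) k + s * real k * F j (k - 1)" for j k
  proof (induction k arbitrary: j)
    case 0
    show ?case
    proof (cases j)
      case 0 then show ?thesis using integral_std_normal_moment_odd[of 0] by (simp add: F_def)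
    next
      case (Suc i) then show ?thesis using std_normal_moment_rec[of i] by (simp add: F_def)
    qed
  next
    case (Suc k)
    have "F (Suc j) (Suc k) = real j * (m * F (j - 1) k + s * F j k) + s * F j k + s * real k * (m * F j (k - 1) + s * F (Suc j) (k - 1))"
      unfolding F_Suc[of "Suc j"] Suc[of j] Suc[of "Suc j"] by (simp add: algebra_simps)
    also have "real k * (m * F j (k - 1) + s * F (Suc j) (k - 1)) = real k * F j k"
      by (cases k) (simp_all add: F_Suc)
    then have "s * real k * (m * F j (k - 1) + s * F (Suc j) (k - 1)) = s * real k * F j k"
      by (simp add: mult.assoc)
    also have "real j * (m * F (j - 1) k + s * F j k) = real j * F (j - 1) (Suc k)"
      by (cases j) (simp_all add: F_Suc)
    finally show ?case by (simp add: algebra_simps)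
  qed
  have "F 0 k = heat_poly k m (s\<^sup>2 / 2) \<and> F 0 (Suc k) = heat_poly (Suc k) m (s\<^sup>2 / 2)"
  proof (induction k)
    case 0
    show ?case using F_Suc[of 0 0] integral_std_normal_moment_even[of 0] integral_std_normal_moment_odd[of 0]
      by (simp add: F_def)
  next
    case (Suc k)
    have "F 0 (Suc (Suc k)) = m * F 0 (Suc k) + s * F 1 (Suc k)" by (simp add: F_Suc)
    also have "F 1 (Suc k) = s * real (Suc k) * F 0 k" using ibp[of 0 "Suc k"] by simp
    finally show ?case using Suc by (simp add: algebra_simps power2_eq_square)
  qed
  then show ?thesis by (simp add: F_def)
qed

text \<open>\<open>lborel\<close> is a product measure indexed by \<open>Basis\<close>; the index is
  moved to the type \<open>'n\<close> along \<open>axis i 1\<close>.\<close>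

lemma lborel_vec_prod:
  fixes f :: "'n::finite \<Rightarrow> real \<Rightarrow> real"
  assumes f: "\<And>i. integrable lborel (f i)"
  shows "integrable lborel (\<lambda>x :: real ^ 'n. \<Prod>i\<in>UNIV. f i (x $ i))"
    and "(\<integral>x. (\<Prod>i\<in>UNIV. f i (x $ i)) \<partial>(lborel :: (real ^ 'n) measure)) = (\<Prod>i\<in>UNIV. \<integral>x. f i x \<partial>lborel)"
proof -
  interpret product_sigma_finite "\<lambda>_ :: real ^ 'n. lborel :: real measure" ..
  define ax where "ax = (\<lambda>i :: 'n. axis i (1 :: real))"
  have inj: "inj ax" by (auto simp: inj_def ax_def axis_eq_axis)
  have B: "(Basis :: (real ^ 'n) set) = range ax" by (auto simp: Basis_vec_def ax_def)
  define g where "g b = f (inv ax b)" for b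
  have g: "integrable lborel (g b)" for b unfolding g_def by (rule f)
  have [measurable]: "g b \<in> borel_measurable borel" for b using g[of b] by simp
  have pr: "(\<Prod>i\<in>UNIV. f i (x $ i)) = (\<Prod>b\<in>Basis. g b (x \<bullet> b))" for x :: "real ^ 'n"
    unfolding B by (subst prod.reindex[OF inj]) (simp add: g_def inv_f_f[OF inj], simp add: ax_def inner_axis)
  have pm: "(\<Prod>b\<in>Basis. g b ((\<Sum>b\<in>Basis. h b *\<^sub>R b) \<bullet> b)) = (\<Prod>b\<in>(Basis :: (real ^ 'n) set). g b (h b))" for h
    by (intro prod.cong) (auto simp: inner_sum_left inner_Basis if_distrib[of "\<lambda>x. _ * x"] sum.delta cong: if_cong)
  have m1: "(\<lambda>h. \<Sum>b\<in>(Basis :: (real ^ 'n) set). h b *\<^sub>R b) \<in> measurable (\<Pi>\<^sub>M b\<in>Basis. lborel) borel"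
    by measurable
  have m2: "(\<lambda>x :: real ^ 'n. \<Prod>b\<in>Basis. g b (x \<bullet> b)) \<in> borel_measurable borel" by measurable
  show "integrable lborel (\<lambda>x :: real ^ 'n. \<Prod>i\<in>UNIV. f i (x $ i))"
    unfolding pr lborel_eq[where 'a = "real ^ 'n"] integrable_distr_eq[OF m1 m2] pm
    by (intro product_integrable_prod g) auto
  have "(\<integral>x. (\<Prod>i\<in>UNIV. f i (x $ i)) \<partial>(lborel :: (real ^ 'n) measure)) = (\<Prod>b\<in>(Basis :: (real ^ 'n) set). \<integral>x. g b x \<partial>lborel)"
    unfolding pr lborel_eq[where 'a = "real ^ 'n"] integral_distr[OF m1 m2] pm
    by (intro product_integral_prod g) auto
  also have "\<dots> = (\<Prod>i\<in>UNIV. \<integral>x. f i x \<partial>lborel)"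
    unfolding B by (subst prod.reindex[OF inj]) (simp add: g_def inv_f_f[OF inj])
  finally show "(\<integral>x. (\<Prod>i\<in>UNIV. f i (x $ i)) \<partial>(lborel :: (real ^ 'n) measure)) = (\<Prod>i\<in>UNIV. \<integral>x. f i x \<partial>lborel)" .
qed

lemma gauss_density_std_normal: "gauss_density 1 0 (z :: real ^ 'n::finite) = (\<Prod>i\<in>UNIV. std_normal_density (z $ i))"
proof -
  define ax where "ax = (\<lambda>i :: 'n. axis i (1 :: real))"
  have inj: "inj ax" by (auto simp: inj_def ax_def axis_eq_axis)
  have B: "(Basis :: (real ^ 'n) set) = range ax" by (auto simp: Basis_vec_def ax_def)
  show ?thesis unfolding gauss_density_prod[OF zero_less_one] B
    by (subst prod.reindex[OF inj]) (simp add: ax_def inner_axis)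
qed

lemma gauss_integral_prod_power:
  fixes m :: "real ^ 'n::finite"
  shows "(\<integral>z. (\<Prod>i\<in>UNIV. ((m + s *\<^sub>R z) $ i) ^ a i) * gauss_density 1 0 z \<partial>lborel) = heat_prod a (m, s\<^sup>2 / 2)"
proof -
  have "(\<integral>z. (\<Prod>i\<in>UNIV. ((m + s *\<^sub>R z) $ i) ^ a i) * gauss_density 1 0 z \<partial>lborel) =
    (\<integral>z. (\<Prod>i\<in>UNIV. std_normal_density (z $ i) * (m $ i + s * z $ i) ^ a i) \<partial>lborel)"
    unfolding gauss_density_std_normal prod.distrib by (simp add: mult.commute)
  also have "\<dots> = (\<Prod>i\<in>UNIV. \<integral>z. std_normal_density z * (m $ i + s * z) ^ a i \<partial>lborel)"
    using integrable_std_normal_affine_power[of 0] by (intro lborel_vec_prod(2)) simp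
  finally show ?thesis by (simp add: std_normal_affine_power heat_prod_def)
qed

section \<open>Polynomials of bounded degree and their caloric extensions\<close>

text \<open>The linear span of the monomials of degree at most \<open>d\<close>, given inductively
  so that linear statements about it reduce to monomials by rule induction.\<close>

inductive deg_le :: "nat \<Rightarrow> (real ^ 'n::finite \<Rightarrow> real) \<Rightarrow> bool" for d where
  prod_power: "(\<Sum>i\<in>UNIV. a i) \<le> d \<Longrightarrow> deg_le d (\<lambda>x. \<Prod>i\<in>UNIV. (x $ i) ^ a i)"
| add: "deg_le d f \<Longrightarrow> deg_le d g \<Longrightarrow> deg_le d (\<lambda>x. f x + g x)"
| scale: "deg_le d f \<Longrightarrow> deg_le d (\<lambda>x. c * f x)"

lemma deg_le_const: "deg_le d (\<lambda>x. c)"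
  using deg_le.scale[OF deg_le.prod_power[of "\<lambda>_. 0" d], of c] by simp

lemma deg_le_sum:
  assumes "finite I" "\<And>i. i \<in> I \<Longrightarrow> deg_le d (f i)" shows "deg_le d (\<lambda>x. \<Sum>i\<in>I. f i x)"
  using assms by (induction I) (auto intro: deg_le_const deg_le.add)

lemma deg_le_nth: "d \<ge> 1 \<Longrightarrow> deg_le d (\<lambda>x. x $ j)"
  using deg_le.prod_power[of "\<lambda>i. if i = j then 1 else 0" d]
  by (simp add: if_distrib[of "\<lambda>k. _ ^ k"] prod.delta cong: if_cong)

lemma deg_le_mono: "deg_le d f \<Longrightarrow> d \<le> e \<Longrightarrow> deg_le e f"
  by (induction rule: deg_le.induct) (auto intro: deg_le.intros)

lemma deg_le_mult:
  assumes "deg_le d f" "deg_le e g" shows "deg_le (d + e) (\<lambda>x. f x * g x)"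
  using assms(1)
proof induction
  case (prod_power a)
  show ?case using assms(2)
  proof induction
    case (prod_power b)
    have "deg_le (d + e) (\<lambda>x. \<Prod>i\<in>UNIV. (x $ i) ^ (a i + b i))"
      by (rule deg_le.prod_power) (use prod_power \<open>sum a UNIV \<le> d\<close> in \<open>simp add: sum.distrib\<close>)
    then show ?case by (simp add: power_add prod.distrib)
  next
    case (add f g) then show ?case using deg_le.add by (fastforce simp: distrib_left)
  next
    case (scale f c) then show ?case using deg_le.scale by (fastforce simp: mult.left_commute)
  qed
next
  case (add f g) then show ?case using deg_le.add by (fastforce simp: distrib_right)
next
  case (scale f c) then show ?case using deg_le.scale by (fastforce simp: mult.assoc)
qed

lemma deg_le_power: "deg_le d f \<Longrightarrow> deg_le (k * d) (\<lambda>x. f x ^ k)"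
proof (induction k)
  case 0 show ?case by (simp add: deg_le_const)
next
  case (Suc k) then show ?case using deg_le_mult[of d f "k * d" "\<lambda>x. f x ^ k"] by simp
qed

text \<open>Links the functions in the kernel expansion to the monomials that the linear system for
  the coefficients of \<open>b\<close> controls.\<close>

lemma deg_le_inner_powers:
  assumes "i + 2 * j \<le> d"
  shows "deg_le d (\<lambda>y :: real ^ 'n::finite. (x \<bullet> y) ^ i * (y \<bullet> y) ^ j)"
proof -
  have "deg_le 1 (\<lambda>y. x \<bullet> y)"
    unfolding inner_vec_def inner_real_def by (intro deg_le_sum deg_le.scale deg_le_nth) auto
  moreover have "deg_le (1 + 1) (\<lambda>y :: real ^ 'n. y \<bullet> y)"
    unfolding inner_vec_def inner_real_def by (intro deg_le_sum deg_le_mult deg_le_nth) auto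
  ultimately have "deg_le (i * 1 + j * (1 + 1)) (\<lambda>y. (x \<bullet> y) ^ i * (y \<bullet> y) ^ j)"
    by (intro deg_le_mult deg_le_power)
  then show ?thesis by (rule deg_le_mono) (use assms in simp)
qed

lemma deg_le_imp_polynomial: "deg_le d f \<Longrightarrow> real_polynomial_function f"
proof (induction rule: deg_le.induct)
  case (prod_power a)
  show ?case
    by (intro real_polynomial_function_prod real_polynomial_function_power
        real_polynomial_function.intros(1) bounded_linear_vec_nth) auto
qed (intro real_polynomial_function.intros(2-4); assumption)+

lemma polynomial_imp_deg_le:
  fixes f :: "real ^ 'n::finite \<Rightarrow> real"
  assumes "real_polynomial_function f" shows "\<exists>d. deg_le d f"
  using assms
proof induction
  case (linear f)
  then interpret bounded_linear f .
  have "f x = (\<Sum>i\<in>UNIV. f (axis i 1) * (x $ i))" for x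
  proof -
    have "f x = f (\<Sum>i\<in>UNIV. x $ i *\<^sub>R axis i 1)"
      using basis_expansion[of x] by (simp add: scalar_mult_eq_scaleR)
    then show ?thesis by (simp add: sum scaleR mult.commute)
  qed
  then have "f = (\<lambda>x. \<Sum>i\<in>UNIV. f (axis i 1) * (x $ i))" by (rule ext)
  moreover have "deg_le 1 (\<lambda>x. \<Sum>i\<in>UNIV. f (axis i 1) * (x $ i))"
    by (intro deg_le_sum deg_le.scale deg_le_nth) auto
  ultimately show ?case by metis
next
  case (const c) show ?case using deg_le_const by blast
next
  case (add f g)
  then obtain d e where "deg_le d f" "deg_le e g" by blast
  then have "deg_le (max d e) (\<lambda>x. f x + g x)" by (intro deg_le.add) (auto intro: deg_le_mono)
  then show ?case by blast
next
  case (mult f g) then show ?case using deg_le_mult by blast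
qed

lemma integrable_polynomial_affine_gauss:
  fixes f :: "real ^ 'n::finite \<Rightarrow> real"
  assumes "real_polynomial_function f"
  shows "integrable lborel (\<lambda>z. f (m + s *\<^sub>R z) * gauss_density 1 0 z)"
proof -
  have "polynomial_function (\<lambda>z :: real ^ 'n. m + s *\<^sub>R z)"
    by (intro polynomial_function_add polynomial_function_const polynomial_function_cmul polynomial_function_id)
  then have "real_polynomial_function (f \<circ> (\<lambda>z. m + s *\<^sub>R z))"
    by (rule real_polynomial_function_compose) (rule assms)
  then show ?thesis using integrable_poly_growth poly_growth_polynomial by (fastforce simp: o_def)
qed

text \<open>Caloric extension and Gaussian average are both linear in \<open>f\<close>, and for a
  monomial with exponents \<open>a\<close> both are given by \<open>heat_prod a\<close>.\<close>

lemma caloric_extension: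
  fixes f :: "real ^ 'n::finite \<Rightarrow> real"
  assumes "deg_le d f"
  shows "\<exists>H. real_polynomial_function H \<and> (\<forall>z. time_deriv H z - space_laplacian H z = 0) \<and>
     (\<forall>x. H (x, 0) = f x) \<and>
     (\<forall>m s. (\<integral>z. f (m + s *\<^sub>R z) * gauss_density 1 0 z \<partial>lborel) = H (m, s\<^sup>2 / 2))"
  using assms
proof induction
  case (prod_power a)
  show ?case
    by (rule exI[of _ "heat_prod a"])
      (simp add: polynomial_function_heat_prod time_deriv_heat_prod space_laplacian_heat_prod
        heat_prod_time_0 gauss_integral_prod_power del: vector_add_component vector_scaleR_component)
next
  case (add f g)
  then obtain H K where *: "real_polynomial_function H" "\<And>z. time_deriv H z - space_laplacian H z = 0"
    "\<And>x. H (x, 0) = f x" "\<And>m s. (\<integral>z. f (m + s *\<^sub>R z) * gauss_density 1 0 z \<partial>lborel) = H (m, s\<^sup>2 / 2)"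
    "real_polynomial_function K" "\<And>z. time_deriv K z - space_laplacian K z = 0"
    "\<And>x. K (x, 0) = g x" "\<And>m s. (\<integral>z. g (m + s *\<^sub>R z) * gauss_density 1 0 z \<partial>lborel) = K (m, s\<^sup>2 / 2)"
    by blast
  note i = add.hyps[THEN deg_le_imp_polynomial, THEN integrable_polynomial_affine_gauss]
  show ?case
    by (rule exI[of _ "\<lambda>z. 1 * H z + 1 * K z"])
      (use caloric_linear_combination[OF *(1,2,5,6), of 1 1] * i in \<open>simp add: distrib_right\<close>)
next
  case (scale f c)
  then obtain H where *: "real_polynomial_function H" "\<And>z. time_deriv H z - space_laplacian H z = 0"
    "\<And>x. H (x, 0) = f x" "\<And>m s. (\<integral>z. f (m + s *\<^sub>R z) * gauss_density 1 0 z \<partial>lborel) = H (m, s\<^sup>2 / 2)"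
    by blast
  show ?case
    by (rule exI[of _ "\<lambda>z. c * H z + 0 * H z"])
      (use caloric_linear_combination[OF *(1,2,1,2), of c 0] * in \<open>simp add: mult.assoc\<close>)
qed

text \<open>A nodal domain containing \<open>(x, t)\<close> would reach negative time by the maximum
  principle and, being connected, would meet \<open>t = 0\<close>, where \<open>u\<close>
  vanishes.\<close>

lemma caloric_unique:
  fixes u :: "(real ^ 'n::finite) \<times> real \<Rightarrow> real"
  assumes u: "real_polynomial_function u" and cal: "\<And>z. time_deriv u z - space_laplacian u z = 0"
    and init: "\<And>x. u (x, 0) = 0" and t: "t \<ge> 0"
  shows "u (x, t) = 0"
proof (rule ccontr)
  assume nz: "u (x, t) \<noteq> 0"
  define W where "W = connected_component_set {z. u z \<noteq> 0} (x, t)"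
  have W: "W \<in> nodal_domains u" using nz by (auto simp: W_def nodal_domains_def components_def)
  have "(x, t) \<in> W" using nz by (simp add: W_def connected_component_refl)
  obtain z where z: "z \<in> W" "snd z < 0" using caloric_domain_meets_past[OF u cal W] by blast
  have "connected (snd ` W)"
    by (intro connected_continuous_image continuous_intros) (simp add: W_def)
  then have "0 \<in> snd ` W"
    by (rule connectedD_interval[of _ "snd z" "snd (x, t)"])
      (use z t imageI[OF \<open>(x, t) \<in> W\<close>, of snd] in auto)
  then obtain y where "(y, 0) \<in> W" by force
  then have "u (y, 0) \<noteq> 0" unfolding W_def using connected_component_subset by blast
  then show False using init by simp
qed

lemma gauss_density_affine:
  assumes v: "v > 0"
  shows "gauss_density v m (m + sqrt v *\<^sub>R z) * sqrt v ^ DIM('a) = gauss_density 1 0 (z :: 'a::euclidean_space)"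
  using v by (simp add: gauss_density_def power_mult_distrib real_sqrt_mult)

lemma nn_integral_gauss_affine:
  fixes h :: "'a::euclidean_space \<Rightarrow> ennreal"
  assumes v: "v > 0" and [measurable]: "h \<in> borel_measurable borel"
  shows "(\<integral>\<^sup>+y. h y * ennreal (gauss_density v m y) \<partial>lborel) =
    (\<integral>\<^sup>+z. h (m + sqrt v *\<^sub>R z) * ennreal (gauss_density 1 0 z) \<partial>lborel)"
proof -
  have "(\<integral>\<^sup>+y. h y * ennreal (gauss_density v m y) \<partial>lborel) =
     (\<integral>\<^sup>+z. ennreal (sqrt v ^ DIM('a)) * (h (m + sqrt v *\<^sub>R z) * ennreal (gauss_density v m (m + sqrt v *\<^sub>R z))) \<partial>lborel)"
    by (subst lborel_affine[of "sqrt v" m]) (use v in \<open>auto simp: nn_integral_density nn_integral_distr abs_of_nonneg\<close>)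
  also have "\<dots> = (\<integral>\<^sup>+z. h (m + sqrt v *\<^sub>R z) * ennreal (gauss_density 1 0 z) \<partial>lborel)"
    unfolding gauss_density_affine[OF v, of m, symmetric] using v
    by (intro nn_integral_cong) (simp add: ennreal_mult' mult_ac)
  finally show ?thesis .
qed

lemma integral_gauss_affine:
  fixes h :: "'a::euclidean_space \<Rightarrow> real"
  assumes v: "v > 0" and [measurable]: "h \<in> borel_measurable borel"
  shows "(\<integral>y. h y * gauss_density v m y \<partial>lborel) = (\<integral>z. h (m + sqrt v *\<^sub>R z) * gauss_density 1 0 z \<partial>lborel)"
proof -
  have "(\<integral>y. h y * gauss_density v m y \<partial>lborel) =
     (\<integral>z. sqrt v ^ DIM('a) * (h (m + sqrt v *\<^sub>R z) * gauss_density v m (m + sqrt v *\<^sub>R z)) \<partial>lborel)"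
    by (subst lborel_affine[of "sqrt v" m]) (use v in \<open>auto simp: integral_density integral_distr abs_of_nonneg\<close>)
  also have "\<dots> = (\<integral>z. h (m + sqrt v *\<^sub>R z) * gauss_density 1 0 z \<partial>lborel)"
    unfolding gauss_density_affine[OF v, of m, symmetric]
    by (intro Bochner_Integration.integral_cong) (simp_all add: mult_ac)
  finally show ?thesis .
qed

lemma polynomial_slice:
  fixes p :: "(real ^ 'n::finite) \<times> real \<Rightarrow> real"
  assumes "real_polynomial_function p"
  shows "real_polynomial_function (\<lambda>x. p (x, t))" "real_polynomial_function (\<lambda>(x, s). p (x, s + t))"
proof -
  have "polynomial_function (\<lambda>x :: real ^ 'n. (x, 0) + (0, t))"
    by (intro polynomial_function_add polynomial_function_const polynomial_function_bounded_linear
        bounded_linear_Pair bounded_linear_ident bounded_linear_zero)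
  then show "real_polynomial_function (\<lambda>x. p (x, t))"
    using real_polynomial_function_compose[of "\<lambda>x. (x, 0) + (0, t)" p] assms by (simp add: o_def)
  have "polynomial_function (\<lambda>z :: (real ^ 'n) \<times> real. z + (0, t))"
    by (intro polynomial_function_add polynomial_function_const polynomial_function_id)
  then show "real_polynomial_function (\<lambda>(x, s). p (x, s + t))"
    using real_polynomial_function_compose[of "\<lambda>z. z + (0, t)" p] assms by (simp add: o_def case_prod_unfold plus_prod_def)
qed

lemma mehler_op_hcp:
  fixes p :: "(real ^ 'n::finite) \<times> real \<Rightarrow> real"
  assumes p: "hcp d p" and r: "0 < r" "r < 1"
  shows "mehler_op r (\<lambda>x. p (x, -1/2)) x = r ^ d * p (x, -1/2)"
proof -
  have pol: "real_polynomial_function p" and cal: "\<And>z. time_deriv p z - space_laplacian p z = 0"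
    and hom: "p (r *\<^sub>R x, r\<^sup>2 * (-1/2)) = r ^ d * p (x, -1/2)" using p r unfolding hcp_def by blast+
  define q where "q = (\<lambda>x. p (x, -1/2))"
  have qpol: "real_polynomial_function q" unfolding q_def by (rule polynomial_slice[OF pol])
  obtain e where "deg_le e q" using polynomial_imp_deg_le[OF qpol] by blast
  from caloric_extension[OF this] obtain H where H: "real_polynomial_function H"
    "\<And>z. time_deriv H z - space_laplacian H z = 0" "\<And>x. H (x, 0) = q x"
    "\<And>m s. (\<integral>z. q (m + s *\<^sub>R z) * gauss_density 1 0 z \<partial>lborel) = H (m, s\<^sup>2 / 2)"
    by blast
  \<comment> \<open>Shifting time makes the slice the initial time, so \<open>P\<close> and
    \<open>H\<close> start from the same values.\<close>
  define P where "P = (\<lambda>(x, s). p (x, s + -1/2))"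
  have Ppol: "real_polynomial_function P" unfolding P_def by (rule polynomial_slice[OF pol])
  have sd: "space_deriv i (\<lambda>(x, s). u (x, s + -1/2)) = (\<lambda>(x, s). space_deriv i u (x, s + -1/2))"
    for i and u :: "(real ^ 'n) \<times> real \<Rightarrow> real" by (auto simp: space_deriv_def)
  have Pcal: "time_deriv P z - space_laplacian P z = 0" for z
  proof -
    obtain y s where z: "z = (y, s)" by fastforce
    have "((\<lambda>s. p (y, s + -1/2)) has_field_derivative time_deriv p (y, s + -1/2)) (at s)"
      using time_deriv_polynomial(2)[OF pol] DERIV_shift[of "\<lambda>s. p (y, s)" _ s "-1/2"] by blast
    then have "time_deriv P z = time_deriv p (y, s + -1/2)"
      unfolding z P_def time_deriv_def by (auto intro: DERIV_imp_deriv)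
    moreover have "space_laplacian P z = space_laplacian p (y, s + -1/2)"
      unfolding space_laplacian_def P_def sd z by simp
    ultimately show ?thesis using cal[of "(y, s + -1/2)"] by simp
  qed
  have v: "1 - r\<^sup>2 > 0" using r by (simp add: abs_square_less_1)
  \<comment> \<open>The elapsed time \<open>(1 - r\<^sup>2) / 2\<close> ends at the original time
    \<open>- r\<^sup>2 / 2\<close>, exactly where \<open>hom\<close> applies. The factors
    \<open>1\<close> and \<open>-1\<close> fit \<open>caloric_linear_combination\<close>.\<close>
  have "1 * H (r *\<^sub>R x, (1 - r\<^sup>2) / 2) + -1 * P (r *\<^sub>R x, (1 - r\<^sup>2) / 2) = 0"
  proof (rule caloric_unique[where u = "\<lambda>z. 1 * H z + -1 * P z"])
    show "1 * H (y, 0) + -1 * P (y, 0) = 0" for y using H(3) by (simp add: P_def q_def)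
    show "0 \<le> (1 - r\<^sup>2) / 2" using v by simp
  qed (rule caloric_linear_combination[OF H(1,2) Ppol Pcal])+
  then have H1: "H (r *\<^sub>R x, (1 - r\<^sup>2) / 2) = p (r *\<^sub>R x, r\<^sup>2 * (-1/2))"
    by (simp add: P_def diff_divide_distrib)
  have qm: "q \<in> borel_measurable borel"
    using poly_growth_polynomial[OF qpol] by (simp add: poly_growth_def)
  have "(sqrt (1 - r\<^sup>2))\<^sup>2 = 1 - r\<^sup>2" using v by simp
  then have "mehler_op r q x = H (r *\<^sub>R x, (1 - r\<^sup>2) / 2)"
    unfolding mehler_op_def integral_gauss_affine[OF v qm] H(4) by simp
  then show ?thesis using hom H1 by (simp add: q_def)
qed

subsection \<open>The jump term\<close>

text \<open>Makes the smallness of \<open>q\<close> near its zeros quantitative, with a factor that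
  grows only polynomially and so stays integrable.\<close>

lemma polynomial_function_locally_lipschitz:
  fixes f :: "'a::real_normed_vector \<Rightarrow> real"
  assumes "real_polynomial_function f"
  shows "\<exists>C N. C \<ge> 0 \<and> (\<forall>x y. \<bar>f x - f y\<bar> \<le> C * (1 + norm x + norm y) ^ N * norm (x - y))"
  using assms
proof induction
  case (linear f)
  then interpret bounded_linear f .
  obtain K where K: "K > 0" "\<And>z. norm (f z) \<le> norm z * K" using pos_bounded by blast
  have "\<bar>f x - f y\<bar> \<le> K * (1 + norm x + norm y) ^ 0 * norm (x - y)" for x y
    using K(2)[of "x - y"] by (simp add: diff mult.commute)
  then show ?case using K by (meson less_imp_le)
next
  case (const c)
  show ?case by (rule exI[of _ 0], rule exI[of _ 0]) auto
next
  case (add f g)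
  then obtain C N D M where *: "C \<ge> 0" "D \<ge> 0"
    "\<And>x y. \<bar>f x - f y\<bar> \<le> C * (1 + norm x + norm y) ^ N * norm (x - y)"
    "\<And>x y. \<bar>g x - g y\<bar> \<le> D * (1 + norm x + norm y) ^ M * norm (x - y)"
    by metis
  have "\<bar>(f x + g x) - (f y + g y)\<bar> \<le> (C + D) * (1 + norm x + norm y) ^ (N + M) * norm (x - y)" for x y
  proof -
    have "\<bar>(f x + g x) - (f y + g y)\<bar> \<le> C * (1 + norm x + norm y) ^ N * norm (x - y) + D * (1 + norm x + norm y) ^ M * norm (x - y)"
      using *(3,4)[of x y] by linarith
    also have "\<dots> \<le> C * (1 + norm x + norm y) ^ (N + M) * norm (x - y) + D * (1 + norm x + norm y) ^ (N + M) * norm (x - y)"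
      using * by (intro add_mono mult_right_mono mult_left_mono power_increasing) auto
    finally show ?thesis by (simp add: algebra_simps)
  qed
  then show ?case using * by (meson add_nonneg_nonneg)
next
  case (mult f g)
  then obtain C N D M where *: "C \<ge> 0" "D \<ge> 0"
    "\<And>x y. \<bar>f x - f y\<bar> \<le> C * (1 + norm x + norm y) ^ N * norm (x - y)"
    "\<And>x y. \<bar>g x - g y\<bar> \<le> D * (1 + norm x + norm y) ^ M * norm (x - y)"
    by metis
  obtain A K B L where **: "A \<ge> 0" "B \<ge> 0" "\<And>z. \<bar>f z\<bar> \<le> A * (1 + norm z) ^ K" "\<And>z. \<bar>g z\<bar> \<le> B * (1 + norm z) ^ L"
    using polynomial_function_growth[OF mult.hyps(1)] polynomial_function_growth[OF mult.hyps(2)] by metis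
  have "\<bar>f x * g x - f y * g y\<bar> \<le> (A * D + B * C) * (1 + norm x + norm y) ^ (K + L + N + M) * norm (x - y)" for x y
  proof -
    define u where "u = 1 + norm x + norm y"
    have u: "u \<ge> 1" "1 + norm x \<le> u" "1 + norm y \<le> u" by (auto simp: u_def)
    have fx: "\<bar>f x\<bar> \<le> A * u ^ K" using **(3)[of x] ** u by (meson mult_left_mono power_mono order_trans add_nonneg_nonneg norm_ge_zero zero_le_one)
    have gy: "\<bar>g y\<bar> \<le> B * u ^ L" using **(4)[of y] ** u by (meson mult_left_mono power_mono order_trans add_nonneg_nonneg norm_ge_zero zero_le_one)
    have "f x * g x - f y * g y = f x * (g x - g y) + g y * (f x - f y)" by (simp add: algebra_simps)
    then have "\<bar>f x * g x - f y * g y\<bar> \<le> \<bar>f x\<bar> * \<bar>g x - g y\<bar> + \<bar>g y\<bar> * \<bar>f x - f y\<bar>"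
      by (metis abs_mult abs_triangle_ineq)
    also have "\<dots> \<le> (A * u ^ K) * (D * u ^ M * norm (x - y)) + (B * u ^ L) * (C * u ^ N * norm (x - y))"
    proof (rule add_mono)
      show "\<bar>f x\<bar> * \<bar>g x - g y\<bar> \<le> (A * u ^ K) * (D * u ^ M * norm (x - y))"
        using ** u by (intro mult_mono[OF fx *(4)[of x y, folded u_def]]) auto
      show "\<bar>g y\<bar> * \<bar>f x - f y\<bar> \<le> (B * u ^ L) * (C * u ^ N * norm (x - y))"
        using ** u by (intro mult_mono[OF gy *(3)[of x y, folded u_def]]) auto
    qed
    also have "\<dots> = (A * D * u ^ (K + M) + B * C * u ^ (L + N)) * norm (x - y)"
      by (simp add: algebra_simps power_add)
    also have "\<dots> \<le> (A * D * u ^ (K + L + N + M) + B * C * u ^ (K + L + N + M)) * norm (x - y)"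
    proof -
      have "u ^ (K + M) \<le> u ^ (K + L + N + M)" "u ^ (L + N) \<le> u ^ (K + L + N + M)"
        by (rule power_increasing; use u in simp)+
      then show ?thesis using * ** by (intro mult_right_mono add_mono mult_left_mono) auto
    qed
    finally show ?thesis by (simp add: algebra_simps u_def)
  qed
  moreover have "A * D + B * C \<ge> 0" using * ** by simp
  ultimately show ?case by blast
qed

lemma mehler_form_commute:
  assumes r: "\<bar>r\<bar> < 1" and f: "gauss_L2 f" and g: "gauss_L2 g"
  shows "mehler_form r f g = mehler_form r g f"
proof -
  have "(\<lambda>z. g (fst z) * f (snd z) * mehler r (fst z) (snd z)) \<in> borel_measurable (lborel \<Otimes>\<^sub>M lborel)"
    using integrable_mehler_form[OF r g f] by simp
  from lborel_pair.integral_product_swap[OF this] show ?thesis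
    unfolding mehler_form_def
    by (simp add: case_prod_unfold mehler_commute[OF r] mult_ac)
qed

text \<open>Given \<open>x\<close>, the second variable is
  \<open>r *\<^sub>R x + sqrt (1 - r\<^sup>2) *\<^sub>R z\<close> with \<open>z\<close> an
  independent standard Gaussian vector. After this change the measure no longer depends on
  \<open>r\<close>, as dominated convergence requires.\<close>

lemma nn_integral_mehler_substitution:
  fixes h :: "'a::euclidean_space \<times> 'a \<Rightarrow> real"
  assumes r: "\<bar>r\<bar> < 1" and [measurable]: "h \<in> borel_measurable (borel \<Otimes>\<^sub>M borel)"
  shows "(\<integral>\<^sup>+z. ennreal (\<bar>h z\<bar> * mehler r (fst z) (snd z)) \<partial>(lborel \<Otimes>\<^sub>M lborel)) =
    (\<integral>\<^sup>+z. ennreal (\<bar>h (fst z, r *\<^sub>R fst z + sqrt (1 - r\<^sup>2) *\<^sub>R snd z)\<bar> * gauss_density 1 0 (fst z) * gauss_density 1 0 (snd z))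
       \<partial>(lborel \<Otimes>\<^sub>M lborel))"
proof -
  have v: "1 - r\<^sup>2 > 0" using r by (simp add: abs_square_less_1)
  have "(\<integral>\<^sup>+z. ennreal (\<bar>h z\<bar> * mehler r (fst z) (snd z)) \<partial>(lborel \<Otimes>\<^sub>M lborel)) =
    (\<integral>\<^sup>+x. \<integral>\<^sup>+y. ennreal (\<bar>h (x, y)\<bar> * mehler r x y) \<partial>lborel \<partial>lborel)"
    by (subst lborel.nn_integral_fst[symmetric]) auto
  also have "\<dots> = (\<integral>\<^sup>+x. \<integral>\<^sup>+z. ennreal (\<bar>h (x, r *\<^sub>R x + sqrt (1 - r\<^sup>2) *\<^sub>R z)\<bar> * gauss_density 1 0 x * gauss_density 1 0 z) \<partial>lborel \<partial>lborel)"
  proof (rule nn_integral_cong)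
    fix x :: 'a
    have [measurable]: "(\<lambda>y. h (x, y)) \<in> borel_measurable borel" by measurable
    have "(\<integral>\<^sup>+y. ennreal (\<bar>h (x, y)\<bar> * mehler r x y) \<partial>lborel) =
        (\<integral>\<^sup>+y. ennreal (\<bar>h (x, y)\<bar> * gauss_density 1 0 x) * ennreal (gauss_density (1 - r\<^sup>2) (r *\<^sub>R x) y) \<partial>lborel)"
      by (simp add: mehler_def ennreal_mult'[symmetric] mult.assoc)
    also have "\<dots> = (\<integral>\<^sup>+z. ennreal (\<bar>h (x, r *\<^sub>R x + sqrt (1 - r\<^sup>2) *\<^sub>R z)\<bar> * gauss_density 1 0 x) * ennreal (gauss_density 1 0 z) \<partial>lborel)"
      by (rule nn_integral_gauss_affine[OF v, where h = "\<lambda>y. ennreal (\<bar>h (x, y)\<bar> * gauss_density 1 0 x)"]) measurable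
    finally show "(\<integral>\<^sup>+y. ennreal (\<bar>h (x, y)\<bar> * mehler r x y) \<partial>lborel) =
        (\<integral>\<^sup>+z. ennreal (\<bar>h (x, r *\<^sub>R x + sqrt (1 - r\<^sup>2) *\<^sub>R z)\<bar> * gauss_density 1 0 x * gauss_density 1 0 z) \<partial>lborel)"
      by (simp add: ennreal_mult'[symmetric])
  qed
  also have "\<dots> = (\<integral>\<^sup>+z. ennreal (\<bar>h (fst z, r *\<^sub>R fst z + sqrt (1 - r\<^sup>2) *\<^sub>R snd z)\<bar> * gauss_density 1 0 (fst z) * gauss_density 1 0 (snd z))
       \<partial>(lborel \<Otimes>\<^sub>M lborel))"
    by (subst lborel.nn_integral_fst[symmetric]) auto
  finally show ?thesis .
qed

text \<open>A jump of \<open>b\<close> forces a zero of \<open>q\<close> between \<open>x\<close>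
  and \<open>y\<close>, so both values of \<open>q\<close> are at most a growth factor times
  \<open>norm (x - y)\<close>. Their product is quadratic in that distance, hence of order
  \<open>1 - r\<close>.\<close>

lemma jump_product_bound:
  fixes q b :: "'a::euclidean_space \<Rightarrow> real"
  assumes q: "real_polynomial_function q" and b: "\<And>x. \<bar>b x\<bar> \<le> B"
    and jump: "\<And>x y. b x \<noteq> b y \<Longrightarrow> q x \<noteq> 0 \<Longrightarrow> q y \<noteq> 0 \<Longrightarrow> \<exists>w\<in>closed_segment x y. q w = 0"
  shows "\<exists>C N. C \<ge> 0 \<and> (\<forall>x z r. 0 < r \<longrightarrow> r < 1 \<longrightarrow>
     (let y = r *\<^sub>R x + sqrt (1 - r\<^sup>2) *\<^sub>R z in
      \<bar>(b x - b y)\<^sup>2 * q x * q y\<bar> \<le> (1 - r) * (C * ((1 + norm x) ^ N * (1 + norm z) ^ N))))"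
proof -
  obtain C N where C: "C \<ge> 0" "\<And>x y. \<bar>q x - q y\<bar> \<le> C * (1 + norm x + norm y) ^ N * norm (x - y)"
    using polynomial_function_locally_lipschitz[OF q] by blast
  have B: "B \<ge> 0" using b[of undefined] by linarith
  \<comment> \<open>The factors are the squared jump, two Lipschitz bounds whose growth base is at
    most \<open>4 * u\<close>, and the \<open>4\<close> from the bound on the squared
    distance.\<close>
  define D where "D = (2 * B)\<^sup>2 * (C * 4 ^ N)\<^sup>2 * 4"
  have "\<bar>(b x - b y)\<^sup>2 * q x * q y\<bar> \<le> (1 - r) * (D * ((1 + norm x) ^ (2 * N + 2) * (1 + norm z) ^ (2 * N + 2)))"
    if r: "0 < r" "r < 1" and y: "y = r *\<^sub>R x + sqrt (1 - r\<^sup>2) *\<^sub>R z" for x y z r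
  proof (cases "b x \<noteq> b y \<and> q x \<noteq> 0 \<and> q y \<noteq> 0")
    case False
    then have 0: "\<bar>(b x - b y)\<^sup>2 * q x * q y\<bar> = 0" by auto
    have "D \<ge> 0" by (simp add: D_def)
    then show ?thesis using r unfolding 0 by simp
  next
    case True
    then obtain w where w: "w \<in> closed_segment x y" "q w = 0" using jump by blast
    define n where "n = norm (x - y)"
    define s where "s = sqrt (1 - r\<^sup>2)"
    have v: "0 \<le> 1 - r\<^sup>2" using r by (simp add: abs_square_le_1)
    have s: "0 \<le> s" "s \<le> 1" "s\<^sup>2 = (1 - r) * (1 + r)" using v by (auto simp: s_def algebra_simps power2_eq_square)
    define u where "u = (1 + norm x) * (1 + norm z)"
    have u1: "1 + norm x + norm z \<le> u" by (simp add: u_def algebra_simps)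
    have u0: "u \<ge> 0" by (simp add: u_def)
    have ny: "norm y \<le> norm x + norm z"
    proof -
      have "norm y \<le> r * norm x + s * norm z"
        unfolding y s_def using norm_triangle_ineq[of "r *\<^sub>R x" "sqrt (1 - r\<^sup>2) *\<^sub>R z"] r v by simp
      also have "\<dots> \<le> 1 * norm x + 1 * norm z" using r s by (intro add_mono mult_right_mono) auto
      finally show ?thesis by simp
    qed
    have wx: "norm (x - w) \<le> n" "norm (y - w) \<le> n"
      using segment_bound[OF w(1)] by (auto simp: norm_minus_commute n_def)
    have nw: "norm w \<le> 2 * norm x + norm y"
      using norm_triangle_sub[of w x] wx(1) norm_triangle_ineq4[of x y] by (simp add: norm_minus_commute n_def)
    have qx: "\<bar>q x'\<bar> \<le> C * (4 * u) ^ N * n" if x': "norm x' \<le> norm x + norm z" "norm (x' - w) \<le> n" for x'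
    proof -
      have "1 + norm x' + norm w \<le> 4 * u" using x' nw ny u1 norm_ge_zero[of x] norm_ge_zero[of z] by argo
      have "\<bar>q x'\<bar> \<le> C * (1 + norm x' + norm w) ^ N * norm (x' - w)"
        using C(2)[of x' w] w by simp
      also have "\<dots> \<le> C * (4 * u) ^ N * n"
        using C x' \<open>1 + norm x' + norm w \<le> 4 * u\<close> u0 by (intro mult_mono power_mono) auto
      finally show ?thesis .
    qed
    \<comment> \<open>The distance is of order \<open>sqrt (1 - r)\<close>, since the coefficient
      \<open>s\<close> of \<open>z\<close> satisfies
      \<open>s\<^sup>2 = (1 - r) * (1 + r)\<close>.\<close>
    have n2: "n\<^sup>2 \<le> 4 * (1 - r) * u\<^sup>2"
    proof -
      have "x - y = (1 - r) *\<^sub>R x - s *\<^sub>R z" by (simp add: y s_def algebra_simps)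
      then have "n \<le> (1 - r) * norm x + s * norm z"
        unfolding n_def using norm_triangle_ineq4[of "(1 - r) *\<^sub>R x" "s *\<^sub>R z"] r s by simp
      then have "n\<^sup>2 \<le> ((1 - r) * norm x + s * norm z)\<^sup>2" by (intro power_mono) (auto simp: n_def)
      also have "\<dots> \<le> 2 * ((1 - r) * norm x)\<^sup>2 + 2 * (s * norm z)\<^sup>2"
        using sum_squares_bound[of "(1 - r) * norm x" "s * norm z"] unfolding power2_sum by linarith
      also have "\<dots> = (1 - r) * (2 * (1 - r) * (norm x)\<^sup>2 + 2 * (1 + r) * (norm z)\<^sup>2)"
        unfolding power_mult_distrib s(3) by (simp add: power2_eq_square algebra_simps)
      also have "\<dots> \<le> (1 - r) * (4 * (norm x)\<^sup>2 + 4 * (norm z)\<^sup>2)"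
        using r by (intro mult_left_mono add_mono mult_right_mono) auto
      also have "\<dots> = 4 * (1 - r) * ((norm x)\<^sup>2 + (norm z)\<^sup>2)" by (simp add: algebra_simps)
      also have "(norm x)\<^sup>2 + (norm z)\<^sup>2 \<le> (norm x + norm z)\<^sup>2" by (simp add: power2_sum)
      also have "(norm x + norm z)\<^sup>2 \<le> u\<^sup>2" using u1 by (intro power_mono) auto
      finally show ?thesis using r by (simp add: mult_left_mono)
    qed
    have "(b x - b y)\<^sup>2 \<le> (2 * B)\<^sup>2" using b[of x] b[of y] B by (intro abs_le_square_iff[THEN iffD1]) auto
    moreover have "\<bar>q x\<bar> * \<bar>q y\<bar> \<le> (C * (4 * u) ^ N * n) * (C * (4 * u) ^ N * n)"
      using C u0 ny wx by (intro mult_mono qx) (auto simp: n_def)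
    ultimately have "(b x - b y)\<^sup>2 * (\<bar>q x\<bar> * \<bar>q y\<bar>) \<le> (2 * B)\<^sup>2 * ((C * (4 * u) ^ N * n) * (C * (4 * u) ^ N * n))"
      by (rule mult_mono) auto
    also have "\<dots> = (2 * B)\<^sup>2 * (C * 4 ^ N)\<^sup>2 * u ^ (2 * N) * n\<^sup>2"
    proof -
      have "u ^ (2 * N) = u ^ N * u ^ N" by (simp add: mult_2 power_add)
      then show ?thesis unfolding power_mult_distrib power2_eq_square by (simp only: mult_ac)
    qed
    also have "\<dots> \<le> (2 * B)\<^sup>2 * (C * 4 ^ N)\<^sup>2 * u ^ (2 * N) * (4 * (1 - r) * u\<^sup>2)"
      using n2 u0 by (intro mult_left_mono) auto
    also have "\<dots> = (1 - r) * (D * u ^ (2 * N + 2))"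
      unfolding D_def power_add by (simp only: mult_ac)
    finally show ?thesis unfolding u_def power_mult_distrib by (simp add: abs_mult mult.assoc)
  qed
  moreover have "D \<ge> 0" by (simp add: D_def)
  ultimately show ?thesis unfolding Let_def by blast
qed

lemma integrable_power_norm_gauss_pair:
  "integrable (lborel \<Otimes>\<^sub>M lborel)
    (\<lambda>z :: 'a::euclidean_space \<times> 'a. C * ((1 + norm (fst z)) ^ N * (1 + norm (snd z)) ^ N) * (gauss_density 1 0 (fst z) * gauss_density 1 0 (snd z)))"
proof -
  have "poly_growth (\<lambda>x::'a. (1 + norm x) ^ N)"
    unfolding poly_growth_def by (intro conjI exI[of _ "1::real"] exI[of _ N]) auto
  then have i: "integrable lborel (\<lambda>x::'a. (1 + norm x) ^ N * gauss_density 1 0 x)" by (rule integrable_poly_growth)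
  have "integrable (lborel \<Otimes>\<^sub>M lborel) (\<lambda>z :: 'a \<times> 'a. ((1 + norm (fst z)) ^ N * gauss_density 1 0 (fst z)) * ((1 + norm (snd z)) ^ N * gauss_density 1 0 (snd z)))"
    by (rule lborel_pair.Fubini_integrable) (use i in \<open>auto simp: abs_mult\<close>)
  from integrable_mult_right[OF this, of C] show ?thesis by (simp add: mult_ac)
qed

text \<open>Expanding the square gives two mixed terms of \<open>b\<^sup>2 q\<close> with
  \<open>q\<close>, each \<open>r ^ d * gauss_norm2 f\<close> by the eigenvalue equation, and minus
  twice the form of \<open>f\<close>. It is the nonlocal counterpart of testing the eigenvalue
  equation with \<open>b\<^sup>2 q\<close>.\<close>

lemma jump_form_identity:
  fixes q b :: "'a::euclidean_space \<Rightarrow> real"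
  assumes q: "poly_growth q" and b: "b \<in> borel_measurable borel" "\<And>x. \<bar>b x\<bar> \<le> B"
    and r: "0 < r" "r < 1" and eig: "\<And>x. mehler_op r q x = r ^ d * q x"
  defines "f \<equiv> \<lambda>x. b x * q x"
  shows "integrable (lborel \<Otimes>\<^sub>M lborel) (\<lambda>z. (b (fst z) - b (snd z))\<^sup>2 * q (fst z) * q (snd z) * mehler r (fst z) (snd z))"
    and "(\<integral>z. (b (fst z) - b (snd z))\<^sup>2 * q (fst z) * q (snd z) * mehler r (fst z) (snd z) \<partial>(lborel \<Otimes>\<^sub>M lborel)) =
      2 * r ^ d * gauss_norm2 f - 2 * mehler_form r f f"
proof -
  have r1: "\<bar>r\<bar> < 1" using r by simp
  define g where "g x = b x * b x * q x" for x
  have pb: "poly_growth b" by (rule poly_growth_bounded[OF b])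
  have pf: "poly_growth f" unfolding f_def by (intro poly_growth_mult pb q)
  have pg: "poly_growth g" unfolding g_def by (intro poly_growth_mult pb q)
  note L = gauss_L2_poly_growth[OF q] gauss_L2_poly_growth[OF pf] gauss_L2_poly_growth[OF pg]
  note i = integrable_mehler_form[OF r1 L(3) L(1)] integrable_mehler_form[OF r1 L(1) L(3)] integrable_mehler_form[OF r1 L(2) L(2)]
  have eq: "(b (fst z) - b (snd z))\<^sup>2 * q (fst z) * q (snd z) * mehler r (fst z) (snd z) =
     g (fst z) * q (snd z) * mehler r (fst z) (snd z) + q (fst z) * g (snd z) * mehler r (fst z) (snd z)
      - 2 * (f (fst z) * f (snd z) * mehler r (fst z) (snd z))" for z
    by (simp add: f_def g_def power2_eq_square algebra_simps)
  show "integrable (lborel \<Otimes>\<^sub>M lborel) (\<lambda>z. (b (fst z) - b (snd z))\<^sup>2 * q (fst z) * q (snd z) * mehler r (fst z) (snd z))"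
    unfolding eq using i by (intro Bochner_Integration.integrable_diff Bochner_Integration.integrable_add integrable_mult_right)
  have "mehler_form r g q = (\<integral>x. r ^ d * ((f x)\<^sup>2 * gauss_density 1 0 x) \<partial>lborel)"
    unfolding mehler_form_eq_op(2)[OF r1 L(3) L(1)] eig
    by (intro Bochner_Integration.integral_cong) (auto simp: f_def g_def power2_eq_square)
  also have "\<dots> = r ^ d * gauss_norm2 f" unfolding gauss_norm2_def by (rule integral_mult_right_zero)
  finally have 1: "mehler_form r g q = r ^ d * gauss_norm2 f" .
  have "(\<integral>z. (b (fst z) - b (snd z))\<^sup>2 * q (fst z) * q (snd z) * mehler r (fst z) (snd z) \<partial>(lborel \<Otimes>\<^sub>M lborel)) =
      mehler_form r g q + mehler_form r q g - 2 * mehler_form r f f"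
    unfolding eq mehler_form_def using i by simp
  then show "(\<integral>z. (b (fst z) - b (snd z))\<^sup>2 * q (fst z) * q (snd z) * mehler r (fst z) (snd z) \<partial>(lborel \<Otimes>\<^sub>M lborel)) =
      2 * r ^ d * gauss_norm2 f - 2 * mehler_form r f f"
    using 1 mehler_form_commute[OF r1 L(3) L(1)] by simp
qed

text \<open>With \<open>y = r *\<^sub>R x + sqrt (1 - r\<^sup>2) *\<^sub>R z\<close> the two points approach each other as \<open>r\<close> tends to \<open>1\<close>,
  so a jump of \<open>b\<close> between them forces both values of \<open>q\<close> to be of order \<open>sqrt (1 - r)\<close>,
  and for fixed \<open>x\<close>, \<open>z\<close> there is eventually no jump at all.\<close>

lemma jump_form_small:
  fixes q b :: "'a::euclidean_space \<Rightarrow> real"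
  assumes q: "real_polynomial_function q" and b: "b \<in> borel_measurable borel" "\<And>x. \<bar>b x\<bar> \<le> B"
    and jump: "\<And>x y. b x \<noteq> b y \<Longrightarrow> q x \<noteq> 0 \<Longrightarrow> q y \<noteq> 0 \<Longrightarrow> \<exists>w\<in>closed_segment x y. q w = 0"
  defines "r \<equiv> \<lambda>k::nat. 1 - 1 / (real k + 2)"
  shows "(\<lambda>k. \<integral>\<^sup>+z. ennreal (\<bar>(b (fst z) - b (snd z))\<^sup>2 * q (fst z) * q (snd z) / (1 - r k)\<bar> * mehler (r k) (fst z) (snd z))
    \<partial>(lborel \<Otimes>\<^sub>M lborel)) \<longlonglongrightarrow> 0"
proof -
  have r: "0 < r k" "r k < 1" "\<bar>r k\<bar> < 1" for k by (auto simp: r_def field_simps)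
  have rlim: "r \<longlonglongrightarrow> 1" unfolding r_def by real_asymp
  have [measurable]: "q \<in> borel_measurable borel" "b \<in> borel_measurable borel"
    using poly_growth_polynomial[OF q] b by (auto simp: poly_growth_def)
  define h where "h k z = (b (fst z) - b (snd z))\<^sup>2 * q (fst z) * q (snd z) / (1 - r k)" for k and z :: "'a \<times> 'a"
  have hm [measurable]: "h k \<in> borel_measurable (borel \<Otimes>\<^sub>M borel)" for k unfolding h_def by measurable
  define y where "y k z = r k *\<^sub>R fst z + sqrt (1 - (r k)\<^sup>2) *\<^sub>R snd z" for k and z :: "'a \<times> 'a"
  have ym [measurable]: "y k \<in> borel_measurable (lborel \<Otimes>\<^sub>M lborel)" for k unfolding y_def by measurable
  define G :: "'a \<times> 'a \<Rightarrow> real" where "G z = gauss_density 1 0 (fst z) * gauss_density 1 0 (snd z)" for z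
  have G0: "G z \<ge> 0" for z by (simp add: G_def)
  have Gm [measurable]: "G \<in> borel_measurable (lborel \<Otimes>\<^sub>M lborel)" unfolding G_def by measurable
  obtain C N where C: "C \<ge> 0" and bound: "\<And>x z r. 0 < r \<Longrightarrow> r < 1 \<Longrightarrow>
     (let y = r *\<^sub>R x + sqrt (1 - r\<^sup>2) *\<^sub>R z in
      \<bar>(b x - b y)\<^sup>2 * q x * q y\<bar> \<le> (1 - r) * (C * ((1 + norm x) ^ N * (1 + norm z) ^ N)))"
    using jump_product_bound[where b = b, OF q b(2) jump] by blast
  \<comment> \<open>The integrand after the substitution. Division by \<open>1 - r k\<close> cancels
    the factor in the bound, so the majorant \<open>W\<close> is independent of
    \<open>k\<close>.\<close>
  define U where "U k z = ennreal (\<bar>h k (fst z, y k z)\<bar> * G z)" for k z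
  define W where "W z = C * ((1 + norm (fst z)) ^ N * (1 + norm (snd z)) ^ N) * G z" for z
  have "(\<lambda>k. \<integral>\<^sup>+z. U k z \<partial>(lborel \<Otimes>\<^sub>M lborel)) \<longlonglongrightarrow> (\<integral>\<^sup>+z. 0 \<partial>((lborel :: 'a measure) \<Otimes>\<^sub>M (lborel :: 'a measure)))"
  proof (rule nn_integral_dominated_convergence[where u = U and u' = "\<lambda>_. 0" and w = "\<lambda>z. ennreal (W z)"])
    show "U k \<in> borel_measurable (lborel \<Otimes>\<^sub>M lborel)" for k unfolding U_def by measurable
    show "(\<lambda>z. ennreal (W z)) \<in> borel_measurable (lborel \<Otimes>\<^sub>M lborel)" unfolding W_def by measurable
    have "integrable (lborel \<Otimes>\<^sub>M lborel) W"
      unfolding W_def G_def by (rule integrable_power_norm_gauss_pair)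
    moreover have "W z \<ge> 0" for z using C G0 by (simp add: W_def)
    ultimately show "(\<integral>\<^sup>+z. ennreal (W z) \<partial>(lborel \<Otimes>\<^sub>M lborel)) < \<infinity>"
      by (simp add: integrable_iff_bounded)
    show "AE z in lborel \<Otimes>\<^sub>M lborel. U k z \<le> ennreal (W z)" for k
    proof (rule always_eventually, rule allI)
      fix z :: "'a \<times> 'a"
      have "\<bar>h k (fst z, y k z)\<bar> \<le> C * ((1 + norm (fst z)) ^ N * (1 + norm (snd z)) ^ N)"
        using bound[OF r(1,2), of k "fst z" "snd z"] r(2)[of k]
        by (simp add: Let_def h_def y_def abs_mult divide_simps mult_ac)
      then show "U k z \<le> ennreal (W z)" unfolding U_def W_def
        by (intro ennreal_leI mult_right_mono G0)
    qed
    show "AE z in lborel \<Otimes>\<^sub>M lborel. (\<lambda>k. U k z) \<longlonglongrightarrow> 0"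
    proof (rule always_eventually, rule allI)
      fix z :: "'a \<times> 'a"
      have "\<forall>\<^sub>F k in sequentially. h k (fst z, y k z) = 0"
      proof (cases "q (fst z) = 0")
        case True then show ?thesis by (simp add: h_def)
      next
        case False
        have "isCont q (fst z)"
          using differentiable_at_real_polynomial_function[OF q] differentiable_imp_continuous_within by blast
        then obtain e where e: "e > 0" "\<And>x. dist x (fst z) < e \<Longrightarrow> q x \<noteq> 0"
          using continuous_at_avoid[of "fst z" q 0] False by (auto simp: dist_commute)
        have "(\<lambda>k. y k z) \<longlonglongrightarrow> 1 *\<^sub>R fst z + sqrt (1 - 1\<^sup>2) *\<^sub>R snd z"
          unfolding y_def by (intro tendsto_intros rlim)
        then have "\<forall>\<^sub>F k in sequentially. dist (y k z) (fst z) < e"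
          using e by (simp add: tendstoD)
        then show ?thesis
        proof eventually_elim
          case (elim k)
          show ?case
          proof (rule ccontr)
            assume "h k (fst z, y k z) \<noteq> 0"
            then have "b (fst z) \<noteq> b (y k z)" "q (fst z) \<noteq> 0" "q (y k z) \<noteq> 0" by (auto simp: h_def)
            then obtain w where w: "w \<in> closed_segment (fst z) (y k z)" "q w = 0" using jump by blast
            have "dist w (fst z) \<le> dist (y k z) (fst z)"
              using segment_bound[OF w(1)] by (simp add: dist_norm)
            then show False using e(2)[of w] elim w by simp
          qed
        qed
      qed
      then show "(\<lambda>k. U k z) \<longlonglongrightarrow> 0"
        unfolding U_def by (intro tendsto_eventually) (auto elim: eventually_mono)
    qed
  qed simp
  moreover have "(\<integral>\<^sup>+z. ennreal (\<bar>h k z\<bar> * mehler (r k) (fst z) (snd z)) \<partial>(lborel \<Otimes>\<^sub>M lborel)) = (\<integral>\<^sup>+z. U k z \<partial>(lborel \<Otimes>\<^sub>M lborel))" for k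
    unfolding nn_integral_mehler_substitution[OF r(3) hm] U_def G_def y_def by (simp add: mult.assoc)
  ultimately show ?thesis unfolding h_def by simp
qed

text \<open>Gap and jump identity bound the jump form below by \<open>2 * r ^ d * (1 - r)\<close>
  times the squared norm. Divided by \<open>1 - r\<close>, the jump form tends to \<open>0\<close>
  along a sequence, which leaves no room for a positive norm.\<close>

lemma orthogonal_locally_scaled_eigenfunction_zero:
  fixes q b :: "'a::euclidean_space \<Rightarrow> real"
  assumes q: "real_polynomial_function q" and b: "b \<in> borel_measurable borel" "\<And>x. \<bar>b x\<bar> \<le> B"
    and jump: "\<And>x y. b x \<noteq> b y \<Longrightarrow> q x \<noteq> 0 \<Longrightarrow> q y \<noteq> 0 \<Longrightarrow> \<exists>w\<in>closed_segment x y. q w = 0"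
    and eig: "\<And>r x. 0 < r \<Longrightarrow> r < 1 \<Longrightarrow> mehler_op r q x = r ^ d * q x"
    and orth: "\<And>x i j. i + 2 * j \<le> d \<Longrightarrow> (\<integral>y. b y * q y * ((x \<bullet> y) ^ i * (y \<bullet> y) ^ j) * gauss_density 1 0 y \<partial>lborel) = 0"
  shows "gauss_norm2 (\<lambda>x. b x * q x) = 0"
proof (rule ccontr)
  define f where "f = (\<lambda>x. b x * q x)"
  define S where "S = gauss_norm2 f"
  assume "\<not> ?thesis"
  then have S: "S > 0" using gauss_norm2_nonneg[of f] by (simp add: S_def f_def)
  have pq: "poly_growth q" by (rule poly_growth_polynomial[OF q])
  have pf: "poly_growth f" unfolding f_def by (intro poly_growth_mult poly_growth_bounded[OF b] pq)
  obtain K where "\<And>r. 0 < r \<Longrightarrow> r \<le> 1/16 \<Longrightarrow> mehler_form r f f \<le> K * r ^ (d + 1)"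
    using mehler_form_decay[OF pf, of d] orth by (auto simp: f_def)
  then have gap: "mehler_form r f f \<le> r ^ (d + 1) * S" if "0 < r" "r < 1" for r
    using mehler_form_spectral_gap[OF gauss_L2_poly_growth[OF pf] that] S unfolding S_def by blast
  define r where "r = (\<lambda>k::nat. 1 - 1 / (real k + 2))"
  have r: "0 < r k" "r k < 1" "1/2 \<le> r k" for k by (auto simp: r_def field_simps)
  define J where "J k = (\<integral>\<^sup>+z. ennreal (\<bar>(b (fst z) - b (snd z))\<^sup>2 * q (fst z) * q (snd z) / (1 - r k)\<bar> * mehler (r k) (fst z) (snd z))
    \<partial>(lborel \<Otimes>\<^sub>M lborel))" for k
  \<comment> \<open>\<open>r k \<ge> 1/2\<close> replaces \<open>r k ^ d\<close> by a positive
    constant independent of \<open>k\<close>.\<close>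
  have lower: "ennreal (2 * (1/2) ^ d * S) \<le> J k" for k
  proof -
    let ?h = "\<lambda>z. (b (fst z) - b (snd z))\<^sup>2 * q (fst z) * q (snd z) * mehler (r k) (fst z) (snd z)"
    note id = jump_form_identity[OF pq b r(1,2)[of k] eig[OF r(1,2)[of k]], folded f_def]
    have "2 * (1/2) ^ d * S \<le> 2 * r k ^ d * S"
      using r[of k] S by (intro mult_right_mono mult_left_mono power_mono) auto
    also have "\<dots> = (2 * r k ^ d * S - 2 * (r k ^ (d + 1) * S)) / (1 - r k)"
      using r[of k] by (simp add: field_simps)
    also have "\<dots> \<le> (2 * r k ^ d * S - 2 * mehler_form (r k) f f) / (1 - r k)"
      using r[of k] gap[OF r(1,2)[of k]] by (intro divide_right_mono) auto
    also have "\<dots> = (\<integral>z. ?h z / (1 - r k) \<partial>(lborel \<Otimes>\<^sub>M lborel))"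
      using id(2) by (simp add: S_def)
    finally have "ennreal (2 * (1/2) ^ d * S) \<le> ennreal (norm (\<integral>z. ?h z / (1 - r k) \<partial>(lborel \<Otimes>\<^sub>M lborel)))"
      unfolding real_norm_def by (intro ennreal_leI order_trans[OF _ abs_ge_self])
    also have "\<dots> \<le> (\<integral>\<^sup>+z. ennreal (norm (?h z / (1 - r k))) \<partial>(lborel \<Otimes>\<^sub>M lborel))"
      using id(1) by (intro integral_norm_bound_ennreal) simp
    also have "\<dots> = J k" unfolding J_def
      by (intro nn_integral_cong) (simp add: abs_mult)
    finally show ?thesis .
  qed
  have "J \<longlonglongrightarrow> 0" unfolding J_def r_def by (rule jump_form_small[OF q b jump])
  then have "ennreal (2 * (1/2) ^ d * S) \<le> 0" using lower by (intro LIMSEQ_le_const) auto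
  then show False using S by simp
qed

subsection \<open>Counting nodal domains\<close>

text \<open>Gaussian elimination, one equation of \<open>A\<close> per induction step.\<close>

lemma underdetermined_system_solution:
  fixes M :: "'a \<Rightarrow> 'j \<Rightarrow> real"
  assumes "finite A" "finite J" "card A < card J"
  shows "\<exists>c. (\<exists>j\<in>J. c j \<noteq> 0) \<and> (\<forall>a\<in>A. (\<Sum>j\<in>J. c j * M a j) = 0)"
  using assms
proof (induction A arbitrary: J M)
  case empty
  then obtain j where "j \<in> J" by fastforce
  then show ?case by (intro exI[of _ "\<lambda>_. 1"]) auto
next
  case (insert a A)
  show ?case
  proof (cases "\<forall>j\<in>J. M a j = 0")
    case True
    obtain c where "\<exists>j\<in>J. c j \<noteq> 0" "\<forall>a\<in>A. (\<Sum>j\<in>J. c j * M a j) = 0"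
      using insert.IH[of J M] insert.prems insert.hyps by auto
    then show ?thesis using True by (intro exI[of _ c]) auto
  next
    case False
    then obtain k where k: "k \<in> J" "M a k \<noteq> 0" by blast
    define J' where "J' = J - {k}"
    \<comment> \<open>Equation \<open>a\<close> has the pivot \<open>k\<close>: it removes this
      unknown from the other equations, and \<open>c' k\<close> is then found by
      back-substitution.\<close>
    define M' where "M' x j = M x j - M x k * M a j / M a k" for x j
    have "card A < card J'" using insert.prems insert.hyps k by (simp add: J'_def)
    then obtain c where c: "\<exists>j\<in>J'. c j \<noteq> 0" "\<And>x. x \<in> A \<Longrightarrow> (\<Sum>j\<in>J'. c j * M' x j) = 0"
      using insert.IH[of J' M'] insert.prems by (auto simp: J'_def)
    define T where "T = (\<Sum>j\<in>J'. c j * M a j)"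
    define c' where "c' = c(k := - T / M a k)"
    have split: "(\<Sum>j\<in>J. c' j * M x j) = - T / M a k * M x k + (\<Sum>j\<in>J'. c j * M x j)" for x
    proof -
      have "(\<Sum>j\<in>J. c' j * M x j) = c' k * M x k + (\<Sum>j\<in>J'. c' j * M x j)"
        unfolding J'_def using insert.prems k by (intro sum.remove) auto
      also have "(\<Sum>j\<in>J'. c' j * M x j) = (\<Sum>j\<in>J'. c j * M x j)"
        by (intro sum.cong) (auto simp: c'_def J'_def)
      finally show ?thesis by (simp add: c'_def)
    qed
    have "(\<Sum>j\<in>J. c' j * M x j) = 0" if "x \<in> A" for x
    proof -
      have "(\<Sum>j\<in>J'. c j * M' x j) = (\<Sum>j\<in>J'. c j * M x j) - M x k / M a k * T"
        unfolding M'_def T_def sum_distrib_left sum_subtractf[symmetric]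
        by (intro sum.cong) (auto simp: algebra_simps)
      then show ?thesis using c(2)[OF that] unfolding split by simp
    qed
    moreover have "(\<Sum>j\<in>J. c' j * M a j) = 0" unfolding split using k by (simp add: T_def)
    moreover have "\<exists>j\<in>J. c' j \<noteq> 0" using c(1) by (auto simp: c'_def J'_def)
    ultimately show ?thesis by (intro exI[of _ c']) auto
  qed
qed

text \<open>Stars and bars: appending the slack turns exponents of total at most \<open>d\<close>
  into lists of length \<open>CARD('n) + 1\<close> with sum exactly \<open>d\<close>.\<close>

lemma card_bounded_exponents:
  fixes d :: nat
  defines "A \<equiv> {a :: 'n::finite \<Rightarrow> nat. (\<Sum>i\<in>UNIV. a i) \<le> d}"
  shows "finite A" "card A \<le> (CARD('n) + d) choose CARD('n)"
proof -
  obtain e where e: "bij_betw e {0..<CARD('n)} (UNIV :: 'n set)"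
    using ex_bij_betw_nat_finite[of "UNIV :: 'n set"] by auto
  define F where "F a = map (a \<circ> e) [0..<CARD('n)] @ [d - (\<Sum>i\<in>UNIV. a i)]" for a :: "'n \<Rightarrow> nat"
  define L where "L = {l :: nat list. length l = CARD('n) + 1 \<and> sum_list l = d}"
  have cL: "card L = (CARD('n) + d) choose CARD('n)"
  proof -
    have "card L = (d + CARD('n)) choose d" unfolding L_def card_length_sum_list by simp
    also have "\<dots> = (CARD('n) + d) choose CARD('n)"
      using binomial_symmetric[of d "d + CARD('n)"] by (simp add: add.commute)
    finally show ?thesis .
  qed
  then have fL: "finite L" by (intro card_ge_0_finite) (simp add: zero_less_binomial_iff)
  have inj: "inj_on F A"
  proof (rule inj_onI)
    fix a b assume "F a = F b"
    then have "map (a \<circ> e) [0..<CARD('n)] = map (b \<circ> e) [0..<CARD('n)]" by (simp add: F_def)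
    then have "a (e k) = b (e k)" if "k \<in> {0..<CARD('n)}" for k using that by (simp add: map_eq_conv)
    then have "a x = b x" for x using e by (metis UNIV_I bij_betw_imp_surj_on imageE)
    then show "a = b" by blast
  qed
  have img: "F ` A \<subseteq> L"
  proof safe
    fix a assume a: "a \<in> A"
    have "sum_list (map (a \<circ> e) [0..<CARD('n)]) = (\<Sum>k\<in>{0..<CARD('n)}. a (e k))"
      by (simp add: sum_list_distinct_conv_sum_set)
    also have "\<dots> = (\<Sum>i\<in>UNIV. a i)" by (rule sum.reindex_bij_betw[OF e])
    finally show "F a \<in> L" using a by (simp add: F_def L_def A_def)
  qed
  show "finite A" using inj_on_finite[OF inj img fL] .
  show "card A \<le> (CARD('n) + d) choose CARD('n)" using card_inj_on_le[OF inj img fL] cL by simp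
qed

lemma gauss_norm2_zero_imp_AE:
  fixes f :: "'a::euclidean_space \<Rightarrow> real"
  assumes "gauss_L2 f" "gauss_norm2 f = 0"
  shows "AE x in lborel. f x = 0"
proof -
  have "AE x in lborel. (f x)\<^sup>2 * gauss_density 1 0 x = 0"
    using assms unfolding gauss_L2_def gauss_norm2_def
    by (subst integral_nonneg_eq_0_iff_AE[symmetric]) auto
  moreover have "gauss_density 1 0 x \<noteq> 0" for x :: 'a using gauss_density_pos[of 1 0 x] by simp
  ultimately show ?thesis by (auto elim!: eventually_mono)
qed

lemma AE_zero_on_open:
  fixes f :: "'a::euclidean_space \<Rightarrow> real"
  assumes "AE x in lborel. f x = 0" "open U" "U \<noteq> {}"
  shows "\<exists>x\<in>U. f x = 0"
proof (rule ccontr)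
  assume nz: "\<not> ?thesis"
  obtain x e where e: "e > 0" "ball x e \<subseteq> U" using assms open_contains_ball by blast
  have "AE y in lborel. y \<notin> ball x e"
    using assms(1) by eventually_elim (use nz e in auto)
  then have "emeasure lborel {y \<in> space lborel. y \<in> ball x e} = 0" by (rule emeasure_eq_0_AE)
  then have "measure lborel (ball x e) = 0" by (simp add: measure_def ball_def)
  then show False using content_ball_pos[OF e(1), of x] by simp
qed

lemma num_nodal_domains_upper:
  fixes p :: "(real ^ 'n::finite) \<times> real \<Rightarrow> real"
  assumes p: "hcp d p"
  shows "num_nodal_domains p \<le> enat ((CARD('n) + d) choose CARD('n))"
proof (rule ccontr)
  assume neg: "\<not> ?thesis"
  define A where "A = {a :: 'n \<Rightarrow> nat. (\<Sum>i\<in>UNIV. a i) \<le> d}"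
  have A: "finite A" "card A \<le> (CARD('n) + d) choose CARD('n)"
    unfolding A_def by (rule card_bounded_exponents)+
  \<comment> \<open>A finite subfamily larger than \<open>A\<close> covers infinitely many domains
    together with the finite case.\<close>
  obtain J where J: "J \<subseteq> nodal_domains p" "finite J" "card A < card J"
  proof (cases "finite (nodal_domains p)")
    case True
    then show ?thesis using that[of "nodal_domains p"] neg A by (simp add: num_nodal_domains_def)
  next
    case False
    then obtain J where "finite J" "card J = Suc (card A)" "J \<subseteq> nodal_domains p"
      using infinite_arbitrarily_large by blast
    then show ?thesis using that[of J] by simp
  qed
  have pol: "real_polynomial_function p" using p by (simp add: hcp_def)
  have ct: "continuous_on UNIV p"
    using pol by (auto intro: continuous_on_subset differentiable_imp_continuous_on
        differentiable_on_real_polynomial_function)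
  define q where "q x = p (x, -1/2)" for x
  have qpol: "real_polynomial_function q" unfolding q_def by (rule polynomial_slice[OF pol])
  have qg: "poly_growth q" by (rule poly_growth_polynomial[OF qpol])
  define slice where "slice W = {x. (x, -1/2 :: real) \<in> W}" for W :: "((real ^ 'n) \<times> real) set"
  have op: "open (slice W)" if "W \<in> J" for W
  proof -
    have "open W" using nodal_domain_props(1)[OF _ ct] J that by blast
    then have "open ((\<lambda>x. (x, -1/2)) -` W)" by (intro open_vimage continuous_intros)
    then show ?thesis by (simp add: slice_def vimage_def)
  qed
  have [measurable]: "slice W \<in> sets borel" if "W \<in> J" for W using op[OF that] by simp
  \<comment> \<open>One row per monomial, one column per domain; a kernel vector \<open>c\<close>
    makes \<open>b q\<close> orthogonal to every monomial of degree at most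
    \<open>d\<close>.\<close>
  define M where "M a W = (\<integral>x. indicator (slice W) x * q x * (\<Prod>i\<in>UNIV. (x $ i) ^ a i) * gauss_density 1 0 x \<partial>lborel)"
    for a :: "'n \<Rightarrow> nat" and W
  obtain c where c: "\<exists>W\<in>J. c W \<noteq> 0" "\<And>a. a \<in> A \<Longrightarrow> (\<Sum>W\<in>J. c W * M a W) = 0"
    using underdetermined_system_solution[OF A(1) J(2,3), of M] by blast
  define b where "b x = (\<Sum>W\<in>J. c W * indicator (slice W) x)" for x
  have bm: "b \<in> borel_measurable borel" unfolding b_def
    by (intro borel_measurable_sum borel_measurable_times borel_measurable_const borel_measurable_indicator) measurable
  have bb: "\<bar>b x\<bar> \<le> (\<Sum>W\<in>J. \<bar>c W\<bar>)" for x unfolding b_def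
    by (rule order_trans[OF sum_abs sum_mono]) (simp add: abs_mult indicator_def)
  \<comment> \<open>If \<open>q\<close> has no zero on the segment, its lift to the slice is a
    connected subset of the nonzero set of \<open>p\<close> and cannot leave a nodal domain.\<close>
  have jump: "\<exists>w\<in>closed_segment x y. q w = 0" if "b x \<noteq> b y" for x y
  proof (rule ccontr)
    assume nz: "\<not> ?thesis"
    define S where "S = (\<lambda>w. (w, -1/2 :: real)) ` closed_segment x y"
    have S: "connected S" unfolding S_def
      by (intro connected_continuous_image continuous_intros connected_segment)
    have "x \<in> slice W \<longleftrightarrow> y \<in> slice W" if "W \<in> J" for W
    proof -
      have "S \<subseteq> W" if "S \<inter> W \<noteq> {}"
        using nodal_domain_props(5)[OF _ ct S that] J(1) \<open>W \<in> J\<close> nz by (auto simp: S_def q_def)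
      then show ?thesis unfolding slice_def S_def by fastforce
    qed
    then have "b x = b y" unfolding b_def by (intro sum.cong) (auto simp: indicator_def)
    then show False using \<open>b x \<noteq> b y\<close> by simp
  qed
  have pgb: "poly_growth b" by (rule poly_growth_bounded[OF bm bb])
  \<comment> \<open>The second conjunct travels through the induction to supply integrability in the
    sum case.\<close>
  have orth_deg: "(\<integral>y. b y * q y * g y * gauss_density 1 0 y \<partial>lborel) = 0 \<and> real_polynomial_function g"
    if "deg_le d g" for g
    using that
  proof induction
    case (prod_power a)
    have i: "integrable lborel (\<lambda>x. indicator (slice W) x * q x * (\<Prod>i\<in>UNIV. (x $ i) ^ a i) * gauss_density 1 0 x)" if "W \<in> J" for W
    proof -
      have ind: "poly_growth (indicator (slice W))"
        by (rule poly_growth_bounded[of _ 1]) (use that in \<open>auto simp: indicator_def\<close>)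
      then show ?thesis
        using deg_le_imp_polynomial[OF deg_le.prod_power[OF prod_power]]
        by (intro integrable_poly_growth poly_growth_mult ind qg poly_growth_polynomial)
    qed
    have "(\<lambda>x. b x * q x * (\<Prod>i\<in>UNIV. (x $ i) ^ a i) * gauss_density 1 0 x) =
      (\<lambda>x. \<Sum>W\<in>J. c W * (indicator (slice W) x * q x * (\<Prod>i\<in>UNIV. (x $ i) ^ a i) * gauss_density 1 0 x))"
      unfolding b_def sum_distrib_right by (simp add: mult.assoc)
    then have "(\<integral>x. b x * q x * (\<Prod>i\<in>UNIV. (x $ i) ^ a i) * gauss_density 1 0 x \<partial>lborel) = (\<Sum>W\<in>J. c W * M a W)"
      unfolding M_def using i by simp
    then show ?case using c(2)[of a] prod_power deg_le_imp_polynomial[OF deg_le.prod_power[OF prod_power]] by (simp add: A_def)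
  next
    case (add f g)
    have "integrable lborel (\<lambda>y. b y * q y * h y * gauss_density 1 0 y)" if "real_polynomial_function h" for h
      using that by (intro integrable_poly_growth poly_growth_mult qg pgb poly_growth_polynomial)
    then show ?case using add.IH by (simp add: distrib_left distrib_right real_polynomial_function.intros(3))
  next
    case (scale f k)
    have "(\<lambda>y. b y * q y * (k * f y) * gauss_density 1 0 y) = (\<lambda>y. k * (b y * q y * f y * gauss_density 1 0 y))"
      by (simp add: mult_ac)
    then show ?case using scale.IH by (simp add: real_polynomial_function.intros(2,4))
  qed
  have "gauss_norm2 (\<lambda>x. b x * q x) = 0"
  proof (rule orthogonal_locally_scaled_eigenfunction_zero[OF qpol bm bb, where d = d])
    show "mehler_op r q x = r ^ d * q x" if "0 < r" "r < 1" for r x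
      using mehler_op_hcp[OF p that, of x] by (simp add: q_def[abs_def])
    show "(\<integral>y. b y * q y * ((x \<bullet> y) ^ i * (y \<bullet> y) ^ j) * gauss_density 1 0 y \<partial>lborel) = 0" if "i + 2 * j \<le> d" for x i j
      using orth_deg[OF deg_le_inner_powers[OF that, of x]] by simp
  qed (use jump in blast)
  then have ae: "AE x in lborel. b x * q x = 0"
    by (intro gauss_norm2_zero_imp_AE gauss_L2_poly_growth poly_growth_mult pgb qg)
  \<comment> \<open>On the nonempty open slice of such a \<open>W\<close>, \<open>b q\<close> is
    \<open>c W * q\<close> and has no zero, contrary to its vanishing almost everywhere.\<close>
  obtain W where W: "W \<in> J" "c W \<noteq> 0" using c(1) by blast
  have "slice W \<noteq> {}" using nodal_domain_meets_slice[OF p, of W] J W by (auto simp: slice_def)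
  then obtain x where x: "x \<in> slice W" "b x * q x = 0" using AE_zero_on_open[OF ae op[OF W(1)]] by blast
  have "q x \<noteq> 0" using nodal_domain_props(3)[OF _ ct, of W "(x, -1/2)"] J W x by (auto simp: slice_def q_def)
  moreover have "b x = c W"
  proof -
    have "indicator (slice V) x = (if V = W then 1 else 0 :: real)" if "V \<in> J" for V
    proof (cases "V = W")
      case True then show ?thesis using x by simp
    next
      case False
      then have "V \<inter> W = {}"
        using J that W components_nonoverlap[of V "{z. p z \<noteq> 0}" W] by (auto simp: nodal_domains_def)
      then show ?thesis using x False by (auto simp: slice_def indicator_def)
    qed
    then have "b x = (\<Sum>V\<in>J. if V = W then c V else 0)" unfolding b_def by (intro sum.cong) auto
    then show ?thesis using J(2) W by simp
  qed
  ultimately show False using x W by simp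
qed

section \<open>The maximum and its order of growth\<close>

lemma max_nodal_domains_bounds:
  fixes d :: nat
  assumes n: "CARD('n::finite) \<ge> 2" and d: "d \<ge> 2"
  shows "enat ((d div CARD('n)) ^ CARD('n)) \<le> max_nodal_domains TYPE('n) d"
    and "max_nodal_domains TYPE('n) d \<le> enat ((CARD('n) + d) choose CARD('n))"
    and "\<exists>p :: (real ^ 'n) \<times> real \<Rightarrow> real.
      hcp d p \<and> time_dependent p \<and> num_nodal_domains p = max_nodal_domains TYPE('n) d"
proof -
  define P where "P = {p :: (real ^ 'n) \<times> real \<Rightarrow> real. hcp d p \<and> time_dependent p}"
  have max: "max_nodal_domains TYPE('n) d = Sup (num_nodal_domains ` P)"
    by (simp add: max_nodal_domains_def P_def)
  obtain p where p: "p \<in> P" "enat ((d div CARD('n)) ^ CARD('n)) \<le> num_nodal_domains p"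
    using exists_hcp_many_nodal_domains[OF n d] by (auto simp: P_def)
  show "enat ((d div CARD('n)) ^ CARD('n)) \<le> max_nodal_domains TYPE('n) d"
    unfolding max using p by (meson SUP_upper order_trans)
  have ub: "num_nodal_domains p \<le> enat ((CARD('n) + d) choose CARD('n))" if "p \<in> P" for p
    using that num_nodal_domains_upper by (auto simp: P_def)
  show "max_nodal_domains TYPE('n) d \<le> enat ((CARD('n) + d) choose CARD('n))"
    unfolding max by (rule SUP_least) (rule ub)
  \<comment> \<open>Values below a finite bound in \<open>enat\<close> form a finite set, so the
    supremum is attained.\<close>
  have "num_nodal_domains ` P \<subseteq> enat ` {..(CARD('n) + d) choose CARD('n)}"
    using ub enat_ile by fastforce
  then have fin: "finite (num_nodal_domains ` P)" by (rule finite_subset) simp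
  have ne: "num_nodal_domains ` P \<noteq> {}" using p by blast
  have "Sup (num_nodal_domains ` P) \<in> num_nodal_domains ` P"
    using Max_in[OF fin ne] unfolding Max_Sup[OF fin ne] .
  then show "\<exists>p :: (real ^ 'n) \<times> real \<Rightarrow> real.
      hcp d p \<and> time_dependent p \<and> num_nodal_domains p = max_nodal_domains TYPE('n) d"
    unfolding max by (auto simp: P_def)
qed

text \<open>For \<open>d \<ge> n\<close> the quotient is at least \<open>1\<close>, so rounding down
  loses at most a factor \<open>2\<close>.\<close>

lemma div_power_lower_bound:
  fixes n d :: nat
  assumes "n \<ge> 1" "d \<ge> n"
  shows "inverse (real (2 * n) ^ n) * real d ^ n \<le> real ((d div n) ^ n)"
proof -
  have "d < n * (d div n) + n" using assms by (metis add.commute mult.commute dividend_less_div_times less_le_trans zero_less_one)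
  moreover have "n * 1 \<le> n * (d div n)" using assms by (intro mult_left_mono) (auto simp: div_greater_zero_iff Suc_le_eq)
  ultimately have "d \<le> 2 * (n * (d div n))" by linarith
  then have "d \<le> 2 * n * (d div n)" by (simp add: mult.assoc)
  then have "real d \<le> real (2 * n) * real (d div n)" by (metis of_nat_le_iff of_nat_mult)
  then have "real d ^ n \<le> real (2 * n) ^ n * real (d div n) ^ n"
    unfolding power_mult_distrib[symmetric] by (intro power_mono) auto
  then show ?thesis using assms by (simp add: field_simps)
qed

lemma binomial_upper_bound:
  fixes n d :: nat
  assumes "n \<ge> 1" "d \<ge> n"
  shows "real ((n + d) choose n) \<le> real (2 * n) ^ n * real d ^ n"
proof -
  have "(n + d) choose n \<le> (n + d) ^ n" by (rule binomial_le_pow) simp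
  also have "\<dots> \<le> (2 * n * d) ^ n"
  proof (rule power_mono)
    have "1 * d \<le> n * d" using assms by (intro mult_right_mono) auto
    then have "n + d \<le> 2 * (n * d)" using assms by linarith
    then show "n + d \<le> 2 * n * d" by (simp add: mult.assoc)
  qed simp
  finally show ?thesis by (metis of_nat_le_iff of_nat_mult of_nat_power power_mult_distrib)
qed

theorem theorem1p2:
  assumes "CARD('n::finite) \<ge> 2"
  shows "(\<forall>d\<ge>2. \<exists>p :: (real ^ 'n) \<times> real \<Rightarrow> real.
            hcp d p \<and> time_dependent p \<and> num_nodal_domains p = max_nodal_domains TYPE('n) d)
       \<and> (\<exists>C::real. C > 0 \<and> (\<forall>\<^sub>F d in sequentially.
            ereal (inverse C * real d ^ CARD('n)) \<le> ereal_of_enat (max_nodal_domains TYPE('n) d) \<and>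
            ereal_of_enat (max_nodal_domains TYPE('n) d) \<le> ereal (C * real d ^ CARD('n))))
       \<and> (\<forall>d\<ge>2. enat ((d div CARD('n)) ^ CARD('n)) \<le> max_nodal_domains TYPE('n) d \<and>
            max_nodal_domains TYPE('n) d \<le> enat ((CARD('n) + d) choose CARD('n)))"
proof (intro conjI)
  show "\<exists>C::real. C > 0 \<and> (\<forall>\<^sub>F d in sequentially.
            ereal (inverse C * real d ^ CARD('n)) \<le> ereal_of_enat (max_nodal_domains TYPE('n) d) \<and>
            ereal_of_enat (max_nodal_domains TYPE('n) d) \<le> ereal (C * real d ^ CARD('n)))"
  \<comment> \<open>One constant serves both sides: \<open>d \<le> 2 * n * (d div n)\<close> below
    and \<open>n + d \<le> 2 * n * d\<close> above, with \<open>n\<close> for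
    \<open>CARD('n)\<close> and \<open>d \<ge> n\<close>.\<close>
  proof (intro exI[of _ "real (2 * CARD('n)) ^ CARD('n)"] conjI)
    show "\<forall>\<^sub>F d in sequentially.
            ereal (inverse (real (2 * CARD('n)) ^ CARD('n)) * real d ^ CARD('n)) \<le> ereal_of_enat (max_nodal_domains TYPE('n) d) \<and>
            ereal_of_enat (max_nodal_domains TYPE('n) d) \<le> ereal (real (2 * CARD('n)) ^ CARD('n) * real d ^ CARD('n))"
      using eventually_ge_at_top[of "CARD('n)"]
    proof eventually_elim
      case (elim d)
      have d: "d \<ge> 2" using elim assms by simp
      obtain k where k: "max_nodal_domains TYPE('n) d = enat k"
        using max_nodal_domains_bounds(2)[OF assms d] enat_ile by blast
      have "(d div CARD('n)) ^ CARD('n) \<le> k" "k \<le> (CARD('n) + d) choose CARD('n)"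
        using max_nodal_domains_bounds(1,2)[OF assms d] by (simp_all add: k)
      then have "real ((d div CARD('n)) ^ CARD('n)) \<le> real k" "real k \<le> real ((CARD('n) + d) choose CARD('n))"
        by (simp_all only: of_nat_le_iff)
      then have "inverse (real (2 * CARD('n)) ^ CARD('n)) * real d ^ CARD('n) \<le> real k"
        "real k \<le> real (2 * CARD('n)) ^ CARD('n) * real d ^ CARD('n)"
        using div_power_lower_bound[of "CARD('n)" d] binomial_upper_bound[of "CARD('n)" d] assms elim
        by linarith+
      then show ?case unfolding k by simp
    qed
  qed simp
qed (use max_nodal_domains_bounds[OF assms] in blast)+

end
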